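(* For $F\in L^2_{\mathbb{X}}$ with the infinite Hoeffding decomposition $F=\sum_{M\in\mathcal{P}_{fin}(\mathbb{N})}F_M=\sum_{p=0}^\infty F^{(p)}$ the following conditions are equivalent: (i) $F\in\operatorname{dom}(L)$. (ii) The series $\sum_{k=1}^\infty D_kF$ converges in $L^2_{\mathbb{X}}$. (iii) $\displaystyle\sup_{m\in\mathbb{N}}\mathbb{E}\Bigl[\Bigl(\sum_{k=1}^m D_kF\Bigr)^2\Bigr]<\infty$. (iv) $\displaystyle\sum_{p=1}^\infty p^2\,\mathbb{E}\bigl[(F^{(p)})^2\bigr]=\sum_{p=1}^\infty p^2\,\mathbb{E}\bigl[J_p(F)^2\bigr]=\sum_{M\in\mathcal{P}_{fin}(\mathbb{N})}|M|^2\,\mathbb{E}[F_M^2]<\infty$. In this case, $LF=-\sum_{k=1}^\infty D_kF$ has the infinite Hoeffding decomposition $$LF=-\sum_{M\in\mathcal{P}_{fin}(\mathbb{N})}|M|\,F_M=-\sum_{p=1}^\infty p\,F^{(p)}=-\sum_{p=1}^\infty p\,J_p(F).$$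
   Context: $\mathbb{N}=\{1,2,\ldots\}$ and $\mathcal{P}_{fin}(\mathbb{N})$ is the collection of finite subsets of $\mathbb{N}$. Let $(E_n,\mathcal{B}_n,\mu_n)$, $n\in\mathbb{N}$, be arbitrary probability spaces, and let $\mathbb{X}=(X_n)_{n\in\mathbb{N}}$ be a sequence of independent random variables on a probability space $(\Omega,\mathcal{A},\mathbb{P})$, where $X_n$ takes values in $E_n$ and has distribution $\mu_n$. Let $\mathcal{F}=\sigma(\mathbb{X})$, $\mathbb{P}_{\mathcal{F}}$ the restriction of $\mathbb{P}$ to $\mathcal{F}$, $L^2_{\mathbb{X}}=L^2(\Omega,\mathcal{F},\mathbb{P})$ (real-valued), and let $\kappa$ be the counting measure on $\mathbb{N}$. For $M\subseteq\mathbb{N}$ let $\mathcal{F}_M=\sigma(X_j,j\in M)$ and let $\mathcal{G}_k=\sigma(X_j,j\neq k)$. Infinite Hoeffding decomposition: for $F\in L^2_{\mathbb{X}}$ and $M\in\mathcal{P}_{fin}(\mathbb{N})$ put $F_M:=\sum_{L\subseteq M}(-1)^{|M|-|L|}\mathbb{E}[F\,|\,\mathcal{F}_L]$, and $F^{(p)}=J_p(F):=\sum_{|M|=p}F_M$ for $p\in\mathbb{N}_0=\{0,1,2,\ldots\}$. Then $F=\sum_{M\in\mathcal{P}_{fin}(\mathbb{N})}F_M=\sum_{p=0}^\infty F^{(p)}$, where all series converge unconditionally in $L^2(\mathbb{P})$ and have orthogonal summands; this decomposition is a.s. unique. $J_p$ is the orthogonal projection onto $\mathcal{H}_p=\{F\in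 L^2_{\mathbb{X}}:F=F^{(p)}\}$. Malliavin operators: for $F\in L^2_{\mathbb{X}}$, $D_kF:=F-\mathbb{E}[F\,|\,\mathcal{G}_k]$. On the dense subspace $\mathcal{S}\subseteq L^2_{\mathbb{X}}$ of random variables that are $\sigma(X_1,\dotsc,X_n)$-measurable for some $n$, define $DF:=(D_kF)_{k\in\mathbb{N}}\in L^2(\kappa\otimes\mathbb{P}_{\mathcal{F}})$. This operator is closable; its closure is again denoted by $D$, with domain $\operatorname{dom}(D)\subseteq L^2_{\mathbb{X}}$, and $DF=(D_kF)_{k\in\mathbb{N}}$ for all $F\in\operatorname{dom}(D)$. The divergence $\delta$ is the adjoint of $D$: $\operatorname{dom}(\delta)$ is the set of all $U=(U_k)_{k}\in L^2(\kappa\otimes\mathbb{P}_{\mathcal{F}})$ for which there is $C<\infty$ with $\bigl|\sum_{k=1}^\infty\mathbb{E}[D_kF\,U_k]\bigr|\leq C\|F\|_2$ for all $F\in\operatorname{dom}(D)$, and $\mathbb{E}[F\,\delta U]=\sum_{k=1}^\infty\mathbb{E}[D_kF\,U_k]$ for all such $F$. The Ornstein-Uhlenbeck generator $L$ has domain $\operatorname{dom}(L):=\{F\in\operatorname{dom}(D): DF\in\operatorname{dom}(\delta)\}$ and $LF:=-\delta DF$ for $F\in\operatorname{dom}(L)$. *)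

theory Defs
  imports "HOL-Probability.Probability"
begin

text \<open>
  The sequence \<open>X\<close> is indexed by \<open>{1..}\<close>; the probability space \<open>(E\<^sub>n, B\<^sub>n, \<mu>\<^sub>n)\<close> is the
  measure \<open>\<mu> n\<close>. Random variables are functions and not equivalence classes, so elements
  of \<open>L\<^sup>2\<close>-spaces are only determined almost everywhere.
\<close>

definition L2 :: "'a measure \<Rightarrow> ('a \<Rightarrow> real) set" where
  "L2 M = {f \<in> borel_measurable M. integrable M (\<lambda>x. (f x)\<^sup>2)}"

definition L2_norm :: "'a measure \<Rightarrow> ('a \<Rightarrow> real) \<Rightarrow> real" where
  "L2_norm M f = sqrt (\<integral>x. (f x)\<^sup>2 \<partial>M)"

definition L2_converges ::
    "'a measure \<Rightarrow> ('i \<Rightarrow> 'a \<Rightarrow> real) \<Rightarrow> ('a \<Rightarrow> real) \<Rightarrow> 'i filter \<Rightarrow> bool" where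
  "L2_converges M f g Fl \<longleftrightarrow>
     (\<forall>\<^sub>F i in Fl. f i \<in> L2 M) \<and> g \<in> L2 M \<and>
     ((\<lambda>i. L2_norm M (\<lambda>x. f i x - g x)) \<longlongrightarrow> 0) Fl"

text \<open>
  Unconditional convergence of a series, as convergence of the net of finite partial sums
  (the analogue of \<^const>\<open>has_sum\<close> for the \<open>L\<^sup>2\<close>-seminorm).
\<close>

definition L2_has_sum ::
    "'a measure \<Rightarrow> ('i \<Rightarrow> 'a \<Rightarrow> real) \<Rightarrow> 'i set \<Rightarrow> ('a \<Rightarrow> real) \<Rightarrow> bool" where
  "L2_has_sum M f I g \<longleftrightarrow>
     L2_converges M (\<lambda>A x. \<Sum>i\<in>A. f i x) g (finite_subsets_at_top I)"

definition Pfin :: "nat set set" where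
  "Pfin = {M. finite M \<and> M \<subseteq> {1..}}"


subsection \<open>The \<open>\<sigma>\<close>-algebras generated by the sequence\<close>

text \<open>\<open>sigma_X P \<mu> X M\<close> is \<open>\<sigma>(X\<^sub>j, j \<in> M)\<close>; only its space and its sets matter.\<close>

definition sigma_X ::
    "'w measure \<Rightarrow> (nat \<Rightarrow> 'e measure) \<Rightarrow> (nat \<Rightarrow> 'w \<Rightarrow> 'e) \<Rightarrow> nat set \<Rightarrow> 'w measure" where
  "sigma_X P \<mu> X M = sigma (space P) (\<Union>j\<in>M. {X j -` A \<inter> space P | A. A \<in> sets (\<mu> j)})"

definition P_F :: "'w measure \<Rightarrow> (nat \<Rightarrow> 'e measure) \<Rightarrow> (nat \<Rightarrow> 'w \<Rightarrow> 'e) \<Rightarrow> 'w measure" where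
  "P_F P \<mu> X = restr_to_subalg P (sigma_X P \<mu> X {1..})"

definition L2X :: "'w measure \<Rightarrow> (nat \<Rightarrow> 'e measure) \<Rightarrow> (nat \<Rightarrow> 'w \<Rightarrow> 'e) \<Rightarrow> ('w \<Rightarrow> real) set" where
  "L2X P \<mu> X = L2 (P_F P \<mu> X)"


subsection \<open>The infinite Hoeffding decomposition\<close>

definition hoeffding ::
    "'w measure \<Rightarrow> (nat \<Rightarrow> 'e measure) \<Rightarrow> (nat \<Rightarrow> 'w \<Rightarrow> 'e) \<Rightarrow> ('w \<Rightarrow> real) \<Rightarrow> nat set \<Rightarrow> 'w \<Rightarrow> real" where
  "hoeffding P \<mu> X F M w =
     (\<Sum>L\<in>Pow M. (- 1) ^ (card M - card L) * real_cond_exp P (sigma_X P \<mu> X L) F w)"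

text \<open>\<open>J P \<mu> X p F\<close> is a version of \<open>F\<^sup>(\<^sup>p\<^sup>)\<close>; it is determined only almost surely.\<close>

definition J ::
    "'w measure \<Rightarrow> (nat \<Rightarrow> 'e measure) \<Rightarrow> (nat \<Rightarrow> 'w \<Rightarrow> 'e) \<Rightarrow> nat \<Rightarrow> ('w \<Rightarrow> real) \<Rightarrow> 'w \<Rightarrow> real" where
  "J P \<mu> X p F =
     (SOME G. L2_has_sum (P_F P \<mu> X) (hoeffding P \<mu> X F) {M \<in> Pfin. card M = p} G)"


subsection \<open>Malliavin operators\<close>

definition D_comp ::
    "'w measure \<Rightarrow> (nat \<Rightarrow> 'e measure) \<Rightarrow> (nat \<Rightarrow> 'w \<Rightarrow> 'e) \<Rightarrow> nat \<Rightarrow> ('w \<Rightarrow> real) \<Rightarrow> 'w \<Rightarrow> real" where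
  "D_comp P \<mu> X k F w = F w - real_cond_exp P (sigma_X P \<mu> X ({1..} - {k})) F w"

definition D ::
    "'w measure \<Rightarrow> (nat \<Rightarrow> 'e measure) \<Rightarrow> (nat \<Rightarrow> 'w \<Rightarrow> 'e) \<Rightarrow> ('w \<Rightarrow> real) \<Rightarrow> nat \<times> 'w \<Rightarrow> real" where
  "D P \<mu> X F = (\<lambda>(k, w). D_comp P \<mu> X k F w)"

definition kappa_P ::
    "'w measure \<Rightarrow> (nat \<Rightarrow> 'e measure) \<Rightarrow> (nat \<Rightarrow> 'w \<Rightarrow> 'e) \<Rightarrow> (nat \<times> 'w) measure" where
  "kappa_P P \<mu> X = count_space {1..} \<Otimes>\<^sub>M P_F P \<mu> X"

definition S_X :: "'w measure \<Rightarrow> (nat \<Rightarrow> 'e measure) \<Rightarrow> (nat \<Rightarrow> 'w \<Rightarrow> 'e) \<Rightarrow> ('w \<Rightarrow> real) set" where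
  "S_X P \<mu> X = {F \<in> L2X P \<mu> X. \<exists>n. F \<in> borel_measurable (sigma_X P \<mu> X {1..n})}"

text \<open>The closure in \<open>L\<^sup>2 \<times> L\<^sup>2\<close> of the graph of \<open>D\<close> restricted to \<^const>\<open>S_X\<close>.\<close>

definition D_closure ::
    "'w measure \<Rightarrow> (nat \<Rightarrow> 'e measure) \<Rightarrow> (nat \<Rightarrow> 'w \<Rightarrow> 'e) \<Rightarrow>
     (('w \<Rightarrow> real) \<times> (nat \<times> 'w \<Rightarrow> real)) set" where
  "D_closure P \<mu> X = {(F, U). \<exists>f. (\<forall>n::nat. f n \<in> S_X P \<mu> X) \<and>
      L2_converges (P_F P \<mu> X) f F sequentially \<and>
      L2_converges (kappa_P P \<mu> X) (\<lambda>n. D P \<mu> X (f n)) U sequentially}"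

text \<open>
  The lemma \<open>D_closure_eq_D\<close> below shows that \<^const>\<open>D_closure\<close> is single-valued up to null
  sets and that its value at \<open>F\<close> is \<open>D P \<mu> X F\<close>. So the closed operator is \<^const>\<open>D\<close>
  on the following domain.
\<close>

definition dom_D :: "'w measure \<Rightarrow> (nat \<Rightarrow> 'e measure) \<Rightarrow> (nat \<Rightarrow> 'w \<Rightarrow> 'e) \<Rightarrow> ('w \<Rightarrow> real) set" where
  "dom_D P \<mu> X = {F. \<exists>U. (F, U) \<in> D_closure P \<mu> X}"

lemma subalgebra_sigma_X:
  assumes "\<And>n. n \<ge> 1 \<Longrightarrow> X n \<in> measurable P (\<mu> n)" and "M \<subseteq> {1..}"
  shows "subalgebra P (sigma_X P \<mu> X M)"
proof -
  have gen: "(\<Union>j\<in>M. {X j -` A \<inter> space P | A. A \<in> sets (\<mu> j)}) \<subseteq> sets P"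
    using assms by (auto intro!: measurable_sets)
  then have "(\<Union>j\<in>M. {X j -` A \<inter> space P | A. A \<in> sets (\<mu> j)}) \<subseteq> Pow (space P)"
    using sets.space_closed by (rule subset_trans)
  then show ?thesis
    unfolding subalgebra_def sigma_X_def
    using sets.sigma_sets_subset[OF gen] by (simp add: sets_measure_of space_measure_of)
qed

lemma subalgebra_sigma_X_mono:
  assumes "M \<subseteq> N"
  shows "subalgebra (sigma_X P \<mu> X N) (sigma_X P \<mu> X M)"
proof -
  have "(\<Union>j\<in>K. {X j -` A \<inter> space P | A. A \<in> sets (\<mu> j)}) \<subseteq> Pow (space P)" for K
    by auto
  moreover have "(\<Union>j\<in>M. {X j -` A \<inter> space P | A. A \<in> sets (\<mu> j)})
      \<subseteq> (\<Union>j\<in>N. {X j -` A \<inter> space P | A. A \<in> sets (\<mu> j)})"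
    using assms by auto
  ultimately show ?thesis
    unfolding subalgebra_def sigma_X_def
    by (simp add: space_measure_of sets_measure_of sigma_sets_mono')
qed

lemma L2X_imp_L2:
  assumes X: "\<And>n. n \<ge> 1 \<Longrightarrow> X n \<in> measurable P (\<mu> n)" and F: "F \<in> L2X P \<mu> X"
  shows "F \<in> borel_measurable P" "integrable P (\<lambda>x. (F x)\<^sup>2)"
proof -
  have sub: "subalgebra P (sigma_X P \<mu> X {1..})"
    by (rule subalgebra_sigma_X[OF X]) auto
  from F have "F \<in> borel_measurable (P_F P \<mu> X)" "integrable (P_F P \<mu> X) (\<lambda>x. (F x)\<^sup>2)"
    unfolding L2X_def L2_def by auto
  then show "F \<in> borel_measurable P" "integrable P (\<lambda>x. (F x)\<^sup>2)"
    unfolding P_F_def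
    using measurable_from_subalg[OF sub] integrable_from_subalg[OF sub]
      measurable_in_subalg'[OF sub] by blast+
qed

lemma D_comp_L2_bound:
  assumes P: "prob_space P" and X: "\<And>n. n \<ge> 1 \<Longrightarrow> X n \<in> measurable P (\<mu> n)"
    and G: "G \<in> borel_measurable P" "integrable P (\<lambda>x. (G x)\<^sup>2)"
  shows "integrable P (\<lambda>w. (D_comp P \<mu> X k G w)\<^sup>2)"
    and "(\<integral>w. (D_comp P \<mu> X k G w)\<^sup>2 \<partial>P) \<le> 4 * (\<integral>w. (G w)\<^sup>2 \<partial>P)"
proof -
  interpret prob_space P by fact
  let ?F = "sigma_X P \<mu> X ({1..} - {k})"
  have sub: "subalgebra P ?F" by (rule subalgebra_sigma_X[OF X]) auto
  interpret finite_measure_subalgebra P ?F by unfold_locales (rule sub)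
  let ?E = "real_cond_exp P ?F G"
  have intG: "integrable P G"
    by (rule square_integrable_imp_integrable[OF G])
  have conv: "convex_on UNIV (\<lambda>x::real. x\<^sup>2)"
    by (rule convex_on_subset[OF convex_power2]) auto
  have I: "integrable P (\<lambda>w. (?E w)\<^sup>2)"
    by (rule integrable_convex_cond_exp[OF intG, where I=UNIV]) (use conv G in auto)
  have J: "AE w in P. (?E w)\<^sup>2 \<le> real_cond_exp P ?F (\<lambda>w. (G w)\<^sup>2) w"
    by (rule real_cond_exp_jensens_inequality(2)[OF intG, where I=UNIV]) (use conv G in auto)
  have "(\<integral>w. (?E w)\<^sup>2 \<partial>P) \<le> (\<integral>w. real_cond_exp P ?F (\<lambda>w. (G w)\<^sup>2) w \<partial>P)"
    by (rule integral_mono_AE[OF I real_cond_exp_int(1)[OF G(2)] J])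
  also have "\<dots> = (\<integral>w. (G w)\<^sup>2 \<partial>P)" by (rule real_cond_exp_int(2)[OF G(2)])
  finally have le: "(\<integral>w. (?E w)\<^sup>2 \<partial>P) \<le> (\<integral>w. (G w)\<^sup>2 \<partial>P)" .
  have pt: "(a - b)\<^sup>2 \<le> 2 * a\<^sup>2 + 2 * b\<^sup>2" for a b :: real
    using zero_le_power2[of "a + b"] by (simp add: power2_eq_square algebra_simps)
  have [measurable]: "?E \<in> borel_measurable P" "G \<in> borel_measurable P"
    using G by auto
  show int: "integrable P (\<lambda>w. (D_comp P \<mu> X k G w)\<^sup>2)"
    unfolding D_comp_def
    by (rule Bochner_Integration.integrable_bound[of _ "\<lambda>w. 2 * (G w)\<^sup>2 + 2 * (?E w)\<^sup>2"])
       (use I G pt in auto)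
  have "(\<integral>w. (D_comp P \<mu> X k G w)\<^sup>2 \<partial>P) \<le> (\<integral>w. 2 * (G w)\<^sup>2 + 2 * (?E w)\<^sup>2 \<partial>P)"
    by (rule integral_mono[OF int]) (use I G pt in \<open>auto simp: D_comp_def\<close>)
  also have "\<dots> \<le> 4 * (\<integral>w. (G w)\<^sup>2 \<partial>P)" using I G le by simp
  finally show "(\<integral>w. (D_comp P \<mu> X k G w)\<^sup>2 \<partial>P) \<le> 4 * (\<integral>w. (G w)\<^sup>2 \<partial>P)" .
qed

lemma L2_diff:
  assumes "g \<in> L2 M" "h \<in> L2 M"
  shows "(\<lambda>x. g x - h x) \<in> L2 M"
proof -
  have pt: "(a - b)\<^sup>2 \<le> 2 * a\<^sup>2 + 2 * b\<^sup>2" for a b :: real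
    using zero_le_power2[of "a + b"] by (simp add: power2_eq_square algebra_simps)
  have [measurable]: "g \<in> borel_measurable M" "h \<in> borel_measurable M"
    using assms by (auto simp: L2_def)
  have "integrable M (\<lambda>x. (g x - h x)\<^sup>2)"
    by (rule Bochner_Integration.integrable_bound[of _ "\<lambda>w. 2 * (g w)\<^sup>2 + 2 * (h w)\<^sup>2"])
       (use assms pt in \<open>auto simp: L2_def\<close>)
  then show ?thesis by (simp add: L2_def)
qed

lemma D_closure_eq_D:
  assumes P: "prob_space P" and X: "\<And>n. n \<ge> 1 \<Longrightarrow> X n \<in> measurable P (\<mu> n)"
    and FU: "(F, U) \<in> D_closure P \<mu> X" and k: "k \<ge> 1"
  shows "AE w in P. U (k, w) = D P \<mu> X F (k, w)"
proof -
  interpret prob_space P by fact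
  let ?F = "sigma_X P \<mu> X {1..}" and ?Q = "P_F P \<mu> X" and ?K = "kappa_P P \<mu> X"
  have sub: "subalgebra P ?F" by (rule subalgebra_sigma_X[OF X]) auto
  interpret Q: prob_space ?Q
    unfolding P_F_def by (rule prob_space_restr_to_subalg[OF sub]) fact
  interpret C: sigma_finite_measure "count_space {1::nat..}"
    by (rule sigma_finite_measure_count_space_countable) auto
  interpret K: pair_sigma_finite "count_space {1::nat..}" ?Q ..
  have PQ: "g \<in> borel_measurable ?Q \<Longrightarrow> g \<in> borel_measurable P" for g :: "'a \<Rightarrow> real"
    unfolding P_F_def
    using measurable_from_subalg[OF sub] measurable_in_subalg'[OF sub] by blast
  have PQi: "g \<in> borel_measurable ?Q \<Longrightarrow> integrable ?Q g \<Longrightarrow>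
      integrable P g \<and> (\<integral>w. g w \<partial>?Q) = (\<integral>w. g w \<partial>P)" for g :: "'a \<Rightarrow> real"
    unfolding P_F_def
    using integrable_from_subalg[OF sub] integral_subalgebra2[OF sub]
      measurable_in_subalg'[OF sub] by blast
  from FU obtain f where f: "\<And>n::nat. f n \<in> S_X P \<mu> X"
    and fF: "L2_converges ?Q f F sequentially"
    and DU: "L2_converges ?K (\<lambda>n. D P \<mu> X (f n)) U sequentially"
    unfolding D_closure_def by auto
  have fL: "f n \<in> L2X P \<mu> X" for n using f unfolding S_X_def by auto
  have FL: "F \<in> L2X P \<mu> X" using fF unfolding L2_converges_def L2X_def by auto
  have sect: "integrable ?Q (\<lambda>w. (g (k, w))\<^sup>2) \<and> (\<lambda>w. g (k, w)) \<in> borel_measurable ?Q \<and>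
      (\<integral>w. (g (k, w))\<^sup>2 \<partial>?Q) \<le> (\<integral>z. (g z)\<^sup>2 \<partial>?K)"
    if g: "g \<in> L2 ?K" for g
  proof -
    have m: "g \<in> borel_measurable ?K" and i: "integrable ?K (\<lambda>z. (g z)\<^sup>2)"
      using g by (auto simp: L2_def)
    have 1: "integrable ?Q (\<lambda>w. (g (k, w))\<^sup>2)"
      using K.AE_integrable_fst'[of "\<lambda>z. (g z)\<^sup>2"] i k by (simp add: kappa_P_def AE_count_space)
    have "(\<lambda>w. (k, w)) \<in> measurable ?Q ?K"
      unfolding kappa_P_def using k by (intro measurable_Pair1') auto
    then have 2: "(\<lambda>w. g (k, w)) \<in> borel_measurable ?Q"
      using m by (rule measurable_compose)
    let ?p = "\<lambda>j. \<integral>w. (g (j, w))\<^sup>2 \<partial>?Q"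
    have ip: "integrable (count_space {1..}) ?p"
      using K.integrable_fst'[of "\<lambda>z. (g z)\<^sup>2"] i by (simp add: kappa_P_def)
    have "ennreal (?p k) \<le> (\<integral>\<^sup>+j. ennreal (?p j) \<partial>count_space {1..})"
      by (rule nn_integral_ge_point) (use k in auto)
    also have "\<dots> = ennreal (\<integral>j. ?p j \<partial>count_space {1..})"
      by (rule nn_integral_eq_integral[OF ip]) auto
    also have "(\<integral>j. ?p j \<partial>count_space {1..}) = (\<integral>z. (g z)\<^sup>2 \<partial>?K)"
      using K.integral_fst'[of "\<lambda>z. (g z)\<^sup>2"] i by (simp add: kappa_P_def)
    finally have "?p k \<le> (\<integral>z. (g z)\<^sup>2 \<partial>?K)" by (subst (asm) ennreal_le_iff) auto
    then show ?thesis using 1 2 by auto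
  qed
  let ?G = "sigma_X P \<mu> X ({1..} - {k})"
  have subG: "subalgebra P ?G" by (rule subalgebra_sigma_X[OF X]) auto
  interpret G: finite_measure_subalgebra P ?G by unfold_locales (rule subG)
  have UL: "U \<in> L2 ?K" using DU by (simp add: L2_converges_def)
  have [measurable]: "(\<lambda>w. U (k, w)) \<in> borel_measurable P"
    using sect[OF UL] PQ by blast
  have [measurable]: "F \<in> borel_measurable P" "f n \<in> borel_measurable P" for n
    using L2X_imp_L2(1)[OF X FL] L2X_imp_L2(1)[OF X fL] by auto
  have [measurable]: "D_comp P \<mu> X k g \<in> borel_measurable P" if "g \<in> borel_measurable P" for g
    using that unfolding D_comp_def by measurable
  define a where "a n = L2_norm ?Q (\<lambda>x. f n x - F x)" for n
  define b where "b n = L2_norm ?K (\<lambda>x. D P \<mu> X (f n) x - U x)" for n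
  let ?h = "\<lambda>w. U (k, w) - D_comp P \<mu> X k F w"
  have pt: "(x - z)\<^sup>2 \<le> 2 * (y - x)\<^sup>2 + 2 * (y - z)\<^sup>2" for x y z :: real
    using zero_le_power2[of "(y - x) + (y - z)"] by (simp add: power2_eq_square algebra_simps)
  have est: "integrable P (\<lambda>w. (?h w)\<^sup>2) \<and> (\<integral>w. (?h w)\<^sup>2 \<partial>P) \<le> 2 * (b n)\<^sup>2 + 8 * (a n)\<^sup>2"
    if Dn: "D P \<mu> X (f n) \<in> L2 ?K" for n
  proof -
    let ?u = "\<lambda>w. D_comp P \<mu> X k (f n) w - U (k, w)"
    let ?e = "\<lambda>w. f n w - F w"
    have eQ: "?e \<in> L2 ?Q" using L2_diff[of "f n" _ F] fL[of n] FL by (simp add: L2X_def)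
    have eP: "?e \<in> borel_measurable P" "integrable P (\<lambda>w. (?e w)\<^sup>2)"
      using L2X_imp_L2[OF X eQ[folded L2X_def]] by auto
    note v = D_comp_L2_bound[OF P X eP, where k=k]
    note u = sect[OF L2_diff[OF Dn UL]]
    have u': "integrable P (\<lambda>w. (?u w)\<^sup>2)" "(\<integral>w. (?u w)\<^sup>2 \<partial>P) \<le> (b n)\<^sup>2"
      using u PQi[of "\<lambda>w. (?u w)\<^sup>2"] by (simp_all add: D_def b_def L2_norm_def borel_measurable_power)
    have "(\<integral>w. (?e w)\<^sup>2 \<partial>P) = (a n)\<^sup>2"
      using PQi[of "\<lambda>w. (?e w)\<^sup>2"] eQ by (simp add: a_def L2_norm_def L2_def borel_measurable_power)
    with v(2) have v': "(\<integral>w. (D_comp P \<mu> X k ?e w)\<^sup>2 \<partial>P) \<le> 4 * (a n)\<^sup>2" by simp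
    have ifn: "integrable P (f n)" "integrable P F"
      using square_integrable_imp_integrable[OF L2X_imp_L2[OF X fL]]
        square_integrable_imp_integrable[OF L2X_imp_L2[OF X FL]] by blast+
    have lin: "AE w in P. D_comp P \<mu> X k ?e w = D_comp P \<mu> X k (f n) w - D_comp P \<mu> X k F w"
      using G.real_cond_exp_diff[OF ifn] by eventually_elim (simp add: D_comp_def)
    have le: "AE w in P. (?h w)\<^sup>2 \<le> 2 * (?u w)\<^sup>2 + 2 * (D_comp P \<mu> X k ?e w)\<^sup>2"
      using lin by eventually_elim (metis pt)
    have R: "integrable P (\<lambda>w. 2 * (?u w)\<^sup>2 + 2 * (D_comp P \<mu> X k ?e w)\<^sup>2)"
      using u'(1) v(1) by auto
    have H: "integrable P (\<lambda>w. (?h w)\<^sup>2)"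
      by (rule Bochner_Integration.integrable_bound[OF R]) (use le in auto)
    have "(\<integral>w. (?h w)\<^sup>2 \<partial>P) \<le> (\<integral>w. 2 * (?u w)\<^sup>2 + 2 * (D_comp P \<mu> X k ?e w)\<^sup>2 \<partial>P)"
      by (rule integral_mono_AE[OF H R le])
    also have "\<dots> \<le> 2 * (b n)\<^sup>2 + 8 * (a n)\<^sup>2"
      using u' v(1) v' by simp
    finally show ?thesis using H by simp
  qed
  have ev: "\<forall>\<^sub>F n in sequentially. D P \<mu> X (f n) \<in> L2 ?K"
    using DU by (simp add: L2_converges_def)
  have "a \<longlonglongrightarrow> 0" "b \<longlonglongrightarrow> 0"
    using fF DU unfolding L2_converges_def a_def b_def by auto
  then have "(\<lambda>n. 2 * (b n)\<^sup>2 + 8 * (a n)\<^sup>2) \<longlonglongrightarrow> 2 * 0\<^sup>2 + 8 * 0\<^sup>2"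
    by (intro tendsto_intros)
  moreover have "\<forall>\<^sub>F n in sequentially. (\<integral>w. (?h w)\<^sup>2 \<partial>P) \<le> 2 * (b n)\<^sup>2 + 8 * (a n)\<^sup>2"
    using ev by eventually_elim (use est in blast)
  ultimately have "(\<integral>w. (?h w)\<^sup>2 \<partial>P) \<le> 0"
    using tendsto_lowerbound[of _ _ sequentially] by fastforce
  then have "(\<integral>w. (?h w)\<^sup>2 \<partial>P) = 0"
    by (intro antisym) auto
  moreover have H: "integrable P (\<lambda>w. (?h w)\<^sup>2)"
    using ev est by (auto simp: eventually_sequentially)
  ultimately have "AE w in P. (?h w)\<^sup>2 = 0"
    using integral_nonneg_eq_0_iff_AE[OF H] by auto
  then show ?thesis by eventually_elim (simp add: D_def)
qed

definition D_pairing ::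
    "'w measure \<Rightarrow> (nat \<Rightarrow> 'e measure) \<Rightarrow> (nat \<Rightarrow> 'w \<Rightarrow> 'e) \<Rightarrow>
     ('w \<Rightarrow> real) \<Rightarrow> (nat \<times> 'w \<Rightarrow> real) \<Rightarrow> real" where
  "D_pairing P \<mu> X F U = (\<Sum>k. \<integral>w. D_comp P \<mu> X (Suc k) F w * U (Suc k, w) \<partial>P)"

definition dom_\<delta> ::
    "'w measure \<Rightarrow> (nat \<Rightarrow> 'e measure) \<Rightarrow> (nat \<Rightarrow> 'w \<Rightarrow> 'e) \<Rightarrow> (nat \<times> 'w \<Rightarrow> real) set" where
  "dom_\<delta> P \<mu> X = {U \<in> L2 (kappa_P P \<mu> X).
      \<exists>C. \<forall>F \<in> dom_D P \<mu> X. \<bar>D_pairing P \<mu> X F U\<bar> \<le> C * L2_norm P F}"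

definition \<delta> ::
    "'w measure \<Rightarrow> (nat \<Rightarrow> 'e measure) \<Rightarrow> (nat \<Rightarrow> 'w \<Rightarrow> 'e) \<Rightarrow> (nat \<times> 'w \<Rightarrow> real) \<Rightarrow> 'w \<Rightarrow> real" where
  "\<delta> P \<mu> X U = (SOME V. V \<in> L2X P \<mu> X \<and>
      (\<forall>F \<in> dom_D P \<mu> X. (\<integral>w. F w * V w \<partial>P) = D_pairing P \<mu> X F U))"

definition dom_L :: "'w measure \<Rightarrow> (nat \<Rightarrow> 'e measure) \<Rightarrow> (nat \<Rightarrow> 'w \<Rightarrow> 'e) \<Rightarrow> ('w \<Rightarrow> real) set" where
  "dom_L P \<mu> X = {F \<in> dom_D P \<mu> X. D P \<mu> X F \<in> dom_\<delta> P \<mu> X}"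

definition L ::
    "'w measure \<Rightarrow> (nat \<Rightarrow> 'e measure) \<Rightarrow> (nat \<Rightarrow> 'w \<Rightarrow> 'e) \<Rightarrow> ('w \<Rightarrow> real) \<Rightarrow> 'w \<Rightarrow> real" where
  "L P \<mu> X F = (\<lambda>w. - \<delta> P \<mu> X (D P \<mu> X F) w)"

end

theory Submission
  imports Defs
begin

text \<open>
  Call \<open>G\<close> a multiplier image of \<open>F\<close> with coefficients \<open>c\<close> if \<open>G\<^sub>M = c\<^sub>M F\<^sub>M\<close> for all finite \<open>M\<close>.
  Independence gives \<open>E[E[F | \<A>\<^sub>M] | \<A>\<^sub>N] = E[F | \<A>\<^sub>M\<^sub>\<inter>\<^sub>N]\<close>, so all the operators in question act on the
  Hoeffding components as multipliers: \<open>D\<^sub>k\<close> by the indicator of \<open>k \<in> M\<close>, \<open>J\<^sub>p\<close> by that of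
  \<open>card M = p\<close>, and \<open>D\<^sub>1 + \<dots> + D\<^sub>m\<close> by \<open>card (M \<inter> {1..m})\<close>. By the Parseval identity
  \<open>E[G\<^sup>2] = \<Sum>\<^sub>M c\<^sub>M\<^sup>2 E[F\<^sub>M\<^sup>2]\<close>, each condition on \<open>F\<close> becomes the summability of
  \<open>card(M)\<^sup>2 E[F\<^sub>M\<^sup>2]\<close>. For \<open>dom L\<close> this uses \<open>\<Sum>\<^sub>k E[D\<^sub>k G D\<^sub>k F] = E[G \<Sum>\<^sub>k D\<^sub>k F]\<close>.
\<close>


subsection \<open>The space \<open>L\<^sup>2\<close>\<close>

text \<open>Random variables are functions, not classes, and \<open>J\<close> and
  \<open>\<delta>\<close> are picked by \<open>SOME\<close>, so statements about them can only hold
  almost everywhere. Being a multiplier image is therefore a relation that fixes \<open>G\<close> up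
  to null sets, and two candidates are compared through their coefficients. The relation also
  absorbs unboundedness: coefficients such as \<open>card M\<close> have an image only for some
  \<open>F\<close>, and completeness of \<open>L2\<close> produces it. The exact domain of
  \<open>D\<close> is never computed: summability of \<open>card M * E[F_M^2]\<close> is shown to
  put \<open>F\<close> into \<open>dom D\<close>, and conversely the bound in the definition of
  \<open>dom_\<delta>\<close> is tested only on functions with finitely many components.
  Independence enters in a single place, \<open>CE_Int\<close>.\<close>

lemma L2_add:
  assumes "f \<in> L2 M" "g \<in> L2 M"
  shows "(\<lambda>x. f x + g x) \<in> L2 M"
proof -
  have "(\<lambda>x. - g x) \<in> L2 M" using assms(2) by (auto simp: L2_def)
  from L2_diff[OF assms(1) this] show ?thesis by simp
qed

lemma L2_cmult: "f \<in> L2 M \<Longrightarrow> (\<lambda>x. c * f x) \<in> L2 M"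
  by (auto simp: L2_def power_mult_distrib)

lemma L2_zero: "(\<lambda>x. 0) \<in> L2 M"
  by (simp add: L2_def)

lemma L2_sum: "(\<And>i. i \<in> I \<Longrightarrow> f i \<in> L2 M) \<Longrightarrow> (\<lambda>x. \<Sum>i\<in>I. f i x) \<in> L2 M"
  by (induction I rule: infinite_finite_induct) (auto intro: L2_zero L2_add)

lemma L2_integrable_mult:
  assumes "f \<in> L2 M" "g \<in> L2 M"
  shows "integrable M (\<lambda>x. f x * g x)"
proof -
  have [measurable]: "f \<in> borel_measurable M" "g \<in> borel_measurable M"
    using assms by (auto simp: L2_def)
  have pt: "\<bar>a * b\<bar> \<le> a\<^sup>2 + b\<^sup>2" for a b :: real
    using sum_squares_bound[of "\<bar>a\<bar>" "\<bar>b\<bar>"] mult_nonneg_nonneg[of "\<bar>a\<bar>" "\<bar>b\<bar>"]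
    unfolding abs_mult power2_abs by linarith
  show ?thesis
    by (rule Bochner_Integration.integrable_bound[of _ "\<lambda>w. (f w)\<^sup>2 + (g w)\<^sup>2"])
       (use assms pt in \<open>auto simp: L2_def\<close>)
qed

lemma L2_norm_nonneg: "0 \<le> L2_norm M f"
  by (simp add: L2_norm_def)

lemma L2_norm_power2: "(L2_norm M f)\<^sup>2 = (\<integral>x. (f x)\<^sup>2 \<partial>M)"
  by (simp add: L2_norm_def)

lemma L2_converges_iff:
  "L2_converges M f g Fl \<longleftrightarrow>
     (\<forall>\<^sub>F i in Fl. f i \<in> L2 M) \<and> g \<in> L2 M \<and> ((\<lambda>i. \<integral>x. (f i x - g x)\<^sup>2 \<partial>M) \<longlongrightarrow> 0) Fl"
proof -
  have "((\<lambda>i. L2_norm M (\<lambda>x. f i x - g x)) \<longlongrightarrow> 0) Fl \<longleftrightarrow>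
      ((\<lambda>i. \<integral>x. (f i x - g x)\<^sup>2 \<partial>M) \<longlongrightarrow> 0) Fl" (is "?l \<longleftrightarrow> ?r")
  proof
    assume ?l
    then have "((\<lambda>i. (L2_norm M (\<lambda>x. f i x - g x))\<^sup>2) \<longlongrightarrow> 0\<^sup>2) Fl" by (rule tendsto_power)
    then show ?r by (simp add: L2_norm_power2)
  next
    assume ?r
    then have "((\<lambda>i. sqrt (\<integral>x. (f i x - g x)\<^sup>2 \<partial>M)) \<longlongrightarrow> sqrt 0) Fl" by (rule tendsto_real_sqrt)
    then show ?l by (simp add: L2_norm_def)
  qed
  then show ?thesis by (simp add: L2_converges_def)
qed

text \<open>The quadratic form \<open>s\<^sup>2 * a + 2 * s * t * b + t\<^sup>2 * c\<close> is the
  integral of a square, hence nonnegative; keeping it homogeneous in \<open>s\<close> and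
  \<open>t\<close> avoids dividing by \<open>c\<close>.\<close>

lemma L2_Cauchy_Schwarz:
  assumes "f \<in> L2 M" "g \<in> L2 M"
  shows "\<bar>\<integral>x. f x * g x \<partial>M\<bar> \<le> L2_norm M f * L2_norm M g"
proof -
  define a b c where "a = (\<integral>x. (f x)\<^sup>2 \<partial>M)" and "b = (\<integral>x. f x * g x \<partial>M)" and "c = (\<integral>x. (g x)\<^sup>2 \<partial>M)"
  have sq: "integrable M (\<lambda>x. (f x)\<^sup>2)" "integrable M (\<lambda>x. (g x)\<^sup>2)"
    using assms by (auto simp: L2_def)
  have a: "a \<ge> 0" and c: "c \<ge> 0" by (auto simp: a_def c_def)
  have q: "0 \<le> s\<^sup>2 * a + 2 * s * t * b + t\<^sup>2 * c" for s t
  proof -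
    have "0 \<le> (\<integral>x. (s * f x + t * g x)\<^sup>2 \<partial>M)" by simp
    also have "\<dots> = (\<integral>x. s\<^sup>2 * (f x)\<^sup>2 + 2 * s * t * (f x * g x) + t\<^sup>2 * (g x)\<^sup>2 \<partial>M)"
      by (intro arg_cong[where f="integral\<^sup>L M"] ext) (simp add: power2_eq_square algebra_simps)
    also have "\<dots> = s\<^sup>2 * a + 2 * s * t * b + t\<^sup>2 * c"
      using sq L2_integrable_mult[OF assms] by (simp add: a_def b_def c_def)
    finally show ?thesis .
  qed
  have "b\<^sup>2 \<le> a * c"
  proof (cases "c = 0")
    case True
    have "b = 0"
    proof (rule ccontr)
      assume "b \<noteq> 0"
      \<comment> \<open>With \<open>c = 0\<close> the form is affine in \<open>t\<close>, and this
        \<open>t\<close> is chosen to make its value \<open>-1\<close>.\<close>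
      have "0 \<le> a + 2 * (- (a + 1) / (2 * b)) * b" using q[of 1 "- (a + 1) / (2 * b)"] True by simp
      also have "\<dots> = -1" using \<open>b \<noteq> 0\<close> by (simp add: field_simps)
      finally show False by simp
    qed
    then show ?thesis using a c by simp
  next
    case False
    \<comment> \<open>For \<open>s = 1\<close> the minimum is at \<open>t = - b / c\<close>; both
      are scaled by \<open>c\<close>.\<close>
    have "0 \<le> c\<^sup>2 * a + 2 * c * (- b) * b + (- b)\<^sup>2 * c" by (rule q)
    also have "\<dots> = c * (a * c - b\<^sup>2)" by (simp add: power2_eq_square algebra_simps)
    finally show ?thesis using False c by (simp add: zero_le_mult_iff)
  qed
  then have "\<bar>b\<bar> \<le> sqrt (a * c)" by (metis real_sqrt_abs real_sqrt_le_mono)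
  then show ?thesis by (simp add: a_def b_def c_def L2_norm_def real_sqrt_mult)
qed

lemma power2_diff_le: "(a - c)\<^sup>2 \<le> 2 * (a - b)\<^sup>2 + 2 * (b - c)\<^sup>2" for a b c :: real
  using zero_le_power2[of "(a - b) - (b - c)"] by (simp add: power2_eq_square algebra_simps)

text \<open>The weighted terms tend to zero, so some \<open>C\<close> bounds them and
  \<open>h\<close> has a geometric majorant of ratio \<open>sqrt (1/2)\<close>. In the completeness
  proof this turns an integrated estimate of increments into their pointwise summability.\<close>

lemma summable_of_summable_weighted_squares:
  fixes h :: "nat \<Rightarrow> real"
  assumes "summable (\<lambda>n. 2 ^ n * (h n)\<^sup>2)"
  shows "summable h"
proof -
  have "(\<lambda>n. 2 ^ n * (h n)\<^sup>2) \<longlonglongrightarrow> 0" by (rule summable_LIMSEQ_zero[OF assms])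
  then have "Bseq (\<lambda>n. 2 ^ n * (h n)\<^sup>2)" by (rule convergent_imp_Bseq[OF convergentI])
  then obtain C where C: "C > 0" "\<And>n. norm (2 ^ n * (h n)\<^sup>2) \<le> C" by (auto elim: BseqE)
  have le: "norm (h n) \<le> sqrt C * (sqrt (1/2)) ^ n" for n
  proof -
    have "(h n)\<^sup>2 \<le> C * (1/2) ^ n" using C(2)[of n] by (simp add: field_simps power_one_over)
    then have "sqrt ((h n)\<^sup>2) \<le> sqrt (C * (1/2) ^ n)" by (rule real_sqrt_le_mono)
    also have "\<dots> = sqrt C * (sqrt (1/2)) ^ n" by (simp only: real_sqrt_mult real_sqrt_power)
    finally show ?thesis by simp
  qed
  have "sqrt (1/2) < (1::real)" by (simp add: real_sqrt_lt_1_iff)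
  then have "summable (\<lambda>n. sqrt C * (sqrt (1/2)) ^ n)"
    by (intro summable_mult summable_geometric) auto
  then show ?thesis by (rule summable_comparison_test'[where N=0]) (use le in auto)
qed

text \<open>Riesz-Fischer: a fast subsequence converges almost everywhere, and Fatou's lemma along
  it bounds the distance of every late \<open>f m\<close> to the limit.\<close>

theorem L2_complete:
  fixes f :: "nat \<Rightarrow> 'a \<Rightarrow> real"
  assumes f: "\<And>n. f n \<in> L2 M"
    and Cauchy: "\<And>e. e > 0 \<Longrightarrow> \<exists>N. \<forall>m\<ge>N. \<forall>n\<ge>N. (\<integral>x. (f m x - f n x)\<^sup>2 \<partial>M) < e"
  shows "\<exists>g. L2_converges M f g sequentially"
proof -
  have [measurable]: "f n \<in> borel_measurable M" for n using f by (auto simp: L2_def)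
  have dL: "integrable M (\<lambda>x. (f m x - f n x)\<^sup>2)" for m n
    using L2_diff[OF f f] by (auto simp: L2_def)
  have "\<exists>N. \<forall>m\<ge>N. \<forall>n\<ge>N. (\<integral>x. (f m x - f n x)\<^sup>2 \<partial>M) < (1/4) ^ k" for k :: nat
    by (rule Cauchy) simp
  then obtain N0 where N0: "\<And>k m n. m \<ge> N0 k \<Longrightarrow> n \<ge> N0 k \<Longrightarrow> (\<integral>x. (f m x - f n x)\<^sup>2 \<partial>M) < (1/4) ^ k"
    by metis
  define r where "r k = k + (\<Sum>i\<le>k. N0 i)" for k
  have rN: "r k \<ge> N0 k" and rSuc: "r (Suc k) \<ge> N0 k" and rk: "r k \<ge> k" for k
  proof -
    have "N0 k \<le> (\<Sum>i\<le>k. N0 i)" by (rule member_le_sum) auto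
    then show "r k \<ge> N0 k" "r (Suc k) \<ge> N0 k" by (auto simp: r_def)
    show "r k \<ge> k" by (simp add: r_def)
  qed
  define h where "h k x = f (r (Suc k)) x - f (r k) x" for k x
  have [measurable]: "h k \<in> borel_measurable M" for k unfolding h_def by measurable
  \<comment> \<open>The increment has squared norm below \<open>(1/4) ^ k\<close>, so the weight
    \<open>2 ^ k\<close> still leaves the summable bound \<open>(1/2) ^ k\<close>.\<close>
  have h: "(\<integral>\<^sup>+x. ennreal (2 ^ k * (h k x)\<^sup>2) \<partial>M) \<le> ennreal ((1/2) ^ k)" for k
  proof -
    have "(\<integral>\<^sup>+x. ennreal (2 ^ k * (h k x)\<^sup>2) \<partial>M) = ennreal (\<integral>x. 2 ^ k * (h k x)\<^sup>2 \<partial>M)"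
      by (rule nn_integral_eq_integral) (use dL in \<open>auto simp: h_def\<close>)
    also have "(\<integral>x. 2 ^ k * (h k x)\<^sup>2 \<partial>M) \<le> 2 ^ k * (1/4) ^ k"
      using N0[OF rSuc rN, of k] by (simp add: h_def)
    also have "\<dots> = (1/2) ^ k" by (simp add: power_mult_distrib[symmetric])
    finally show ?thesis by (simp add: ennreal_leI)
  qed
  have "(\<integral>\<^sup>+x. (\<Sum>k. ennreal (2 ^ k * (h k x)\<^sup>2)) \<partial>M) = (\<Sum>k. \<integral>\<^sup>+x. ennreal (2 ^ k * (h k x)\<^sup>2) \<partial>M)"
    by (rule nn_integral_suminf) measurable
  also have "\<dots> \<le> (\<Sum>k. ennreal ((1/2) ^ k))"
    by (intro suminf_le h) auto
  also have "\<dots> = ennreal (\<Sum>k. (1/2) ^ k)"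
    by (rule suminf_ennreal2) (auto intro: summable_geometric)
  also have "\<dots> < \<infinity>" by simp
  finally have "AE x in M. (\<Sum>k. ennreal (2 ^ k * (h k x)\<^sup>2)) \<noteq> \<infinity>"
    by (intro nn_integral_PInf_AE) auto
  then have conv: "AE x in M. convergent (\<lambda>k. f (r k) x)"
  proof eventually_elim
    case (elim x)
    have "summable (\<lambda>k. 2 ^ k * (h k x)\<^sup>2)"
      by (rule summable_suminf_not_top) (use elim in auto)
    then have "summable (\<lambda>k. h k x)" by (rule summable_of_summable_weighted_squares)
    then have "convergent (\<lambda>n. \<Sum>k<n. h k x)" by (simp add: summable_iff_convergent)
    then have "convergent (\<lambda>n. f (r n) x - f (r 0) x)"
      unfolding h_def by (subst (asm) sum_lessThan_telescope)
    then have "convergent (\<lambda>n. (f (r n) x - f (r 0) x) + f (r 0) x)"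
      by (intro convergent_add convergent_const)
    then show ?case by simp
  qed
  define g where "g x = lim (\<lambda>k. f (r k) x)" for x
  have [measurable]: "g \<in> borel_measurable M"
    unfolding g_def by (rule borel_measurable_lim_metric) measurable
  have lim: "AE x in M. (\<lambda>k. f (r k) x) \<longlonglongrightarrow> g x"
    using conv by eventually_elim (simp add: g_def convergent_LIMSEQ_iff)
  have bound: "(\<integral>\<^sup>+x. ennreal ((f m x - g x)\<^sup>2) \<partial>M) \<le> ennreal e"
    if N: "\<forall>m\<ge>N. \<forall>n\<ge>N. (\<integral>x. (f m x - f n x)\<^sup>2 \<partial>M) < e" and m: "m \<ge> N" for e N m
  proof -
    have "AE x in M. ennreal ((f m x - g x)\<^sup>2) = liminf (\<lambda>k. ennreal ((f m x - f (r k) x)\<^sup>2))"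
      using lim
    proof eventually_elim
      case (elim x)
      then have "(\<lambda>k. ennreal ((f m x - f (r k) x)\<^sup>2)) \<longlonglongrightarrow> ennreal ((f m x - g x)\<^sup>2)"
        by (intro tendsto_intros tendsto_ennrealI)
      then show ?case using lim_imp_Liminf by (metis sequentially_bot)
    qed
    then have "(\<integral>\<^sup>+x. ennreal ((f m x - g x)\<^sup>2) \<partial>M) =
        (\<integral>\<^sup>+x. liminf (\<lambda>k. ennreal ((f m x - f (r k) x)\<^sup>2)) \<partial>M)"
      by (rule nn_integral_cong_AE)
    also have "\<dots> \<le> liminf (\<lambda>k. \<integral>\<^sup>+x. ennreal ((f m x - f (r k) x)\<^sup>2) \<partial>M)"
      by (rule nn_integral_liminf) measurable
    also have "\<dots> \<le> ennreal e"
    proof (rule Liminf_le)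
      have "(\<integral>\<^sup>+x. ennreal ((f m x - f (r k) x)\<^sup>2) \<partial>M) \<le> ennreal e" if "k \<ge> N" for k
      proof -
        have "(\<integral>\<^sup>+x. ennreal ((f m x - f (r k) x)\<^sup>2) \<partial>M) = ennreal (\<integral>x. (f m x - f (r k) x)\<^sup>2 \<partial>M)"
          by (rule nn_integral_eq_integral) (use dL in auto)
        also have "\<dots> \<le> ennreal e"
          using N m order_trans[OF that rk] by (intro ennreal_leI less_imp_le) blast
        finally show ?thesis .
      qed
      then show "\<forall>\<^sub>F k in sequentially. (\<integral>\<^sup>+x. ennreal ((f m x - f (r k) x)\<^sup>2) \<partial>M) \<le> ennreal e"
        by (auto simp: eventually_sequentially)
    qed simp
    finally show ?thesis .
  qed
  obtain N1 where N1: "\<forall>m\<ge>N1. \<forall>n\<ge>N1. (\<integral>x. (f m x - f n x)\<^sup>2 \<partial>M) < 1" using Cauchy[of 1] by auto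
  have "(\<integral>\<^sup>+x. ennreal ((f N1 x - g x)\<^sup>2) \<partial>M) < \<infinity>"
    using bound[OF N1 order_refl] by (rule order_le_less_trans) simp
  then have "integrable M (\<lambda>x. (f N1 x - g x)\<^sup>2)"
    by (intro integrableI_bounded) auto
  then have "(\<lambda>x. f N1 x - g x) \<in> L2 M" by (simp add: L2_def)
  from L2_diff[OF f[of N1] this] have g: "g \<in> L2 M" by simp
  have "(\<lambda>n. \<integral>x. (f n x - g x)\<^sup>2 \<partial>M) \<longlonglongrightarrow> 0"
  proof (rule LIMSEQ_I)
    fix e :: real assume e: "e > 0"
    obtain N where N: "\<forall>m\<ge>N. \<forall>n\<ge>N. (\<integral>x. (f m x - f n x)\<^sup>2 \<partial>M) < e/2"
      using Cauchy[of "e/2"] e by auto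
    have "norm ((\<integral>x. (f m x - g x)\<^sup>2 \<partial>M) - 0) < e" if "m \<ge> N" for m
    proof -
      have "ennreal (\<integral>x. (f m x - g x)\<^sup>2 \<partial>M) = (\<integral>\<^sup>+x. ennreal ((f m x - g x)\<^sup>2) \<partial>M)"
        using L2_diff[OF f g] by (intro nn_integral_eq_integral[symmetric]) (auto simp: L2_def)
      also have "\<dots> \<le> ennreal (e/2)" by (rule bound[OF N that])
      finally have "(\<integral>x. (f m x - g x)\<^sup>2 \<partial>M) \<le> e/2" using e by (simp add: ennreal_le_iff)
      then show ?thesis using e by simp
    qed
    then show "\<exists>no. \<forall>n\<ge>no. norm ((\<integral>x. (f n x - g x)\<^sup>2 \<partial>M) - 0) < e" by auto
  qed
  then show ?thesis using f g by (auto simp: L2_converges_iff)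
qed

lemma L2_tendsto_integral_mult:
  assumes f: "\<And>i. f i \<in> L2 M" and g: "g \<in> L2 M" and h: "h \<in> L2 M"
    and lim: "((\<lambda>i. \<integral>x. (f i x - g x)\<^sup>2 \<partial>M) \<longlongrightarrow> 0) Fl"
  shows "((\<lambda>i. \<integral>x. h x * f i x \<partial>M) \<longlongrightarrow> (\<integral>x. h x * g x \<partial>M)) Fl"
proof -
  have eq: "(\<integral>x. h x * (f i x - g x) \<partial>M) = (\<integral>x. h x * f i x \<partial>M) - (\<integral>x. h x * g x \<partial>M)" for i
    using L2_integrable_mult[OF h f[of i]] L2_integrable_mult[OF h g] by (simp add: right_diff_distrib)
  have "((\<lambda>i. \<integral>x. h x * (f i x - g x) \<partial>M) \<longlongrightarrow> 0) Fl"
  proof (rule tendsto_rabs_zero_cancel, rule tendsto_sandwich[where f="\<lambda>_. 0"])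
    show "\<forall>\<^sub>F i in Fl. \<bar>\<integral>x. h x * (f i x - g x) \<partial>M\<bar> \<le> L2_norm M h * L2_norm M (\<lambda>x. f i x - g x)"
      by (intro always_eventually allI L2_Cauchy_Schwarz h L2_diff f g)
    have "((\<lambda>i. L2_norm M (\<lambda>x. f i x - g x)) \<longlongrightarrow> sqrt 0) Fl"
      unfolding L2_norm_def by (rule tendsto_real_sqrt[OF lim])
    then show "((\<lambda>i. L2_norm M h * L2_norm M (\<lambda>x. f i x - g x)) \<longlongrightarrow> 0) Fl"
      by (intro tendsto_mult_right_zero) simp
  qed auto
  then show ?thesis unfolding eq by (simp add: LIM_zero_iff)
qed


subsection \<open>Infinite sums\<close>

text \<open>Dominated convergence for unordered sums: a finite \<open>B\<close> carries all but
  \<open>e/2\<close> of the majorant, inside \<open>B\<close> there are finitely many limits, and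
  outside the tail of \<open>g\<close> bounds both signs. The filter is arbitrary because sequences
  and the net of finite subsets both occur.\<close>

lemma tannery_has_sum:
  fixes f :: "'i \<Rightarrow> 'b \<Rightarrow> real"
  assumes g: "g summable_on A"
    and f: "\<forall>\<^sub>F i in Fl. (f i has_sum s i) A \<and> (\<forall>x\<in>A. \<bar>f i x\<bar> \<le> g x)"
    and lim: "\<And>x. x \<in> A \<Longrightarrow> ((\<lambda>i. f i x) \<longlongrightarrow> 0) Fl"
  shows "(s \<longlongrightarrow> 0) Fl"
proof (rule tendstoI)
  fix e :: real assume e: "e > 0"
  have "(sum g \<longlongrightarrow> infsum g A) (finite_subsets_at_top A)"
    using has_sum_infsum[OF g] by (simp add: has_sum_def)
  then have "\<forall>\<^sub>F B in finite_subsets_at_top A. dist (sum g B) (infsum g A) < e/2"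
    using e by (intro tendstoD) auto
  then obtain B where B: "finite B" "B \<subseteq> A" "dist (sum g B) (infsum g A) < e/2"
    unfolding eventually_finite_subsets_at_top by blast
  have gs: "(g has_sum (infsum g A - sum g B)) (A - B)"
    by (rule has_sum_Diff[OF has_sum_infsum[OF g] _ B(2)]) (simp add: B(1))
  have "((\<lambda>i. \<Sum>x\<in>B. f i x) \<longlongrightarrow> (\<Sum>x\<in>B. 0)) Fl"
    using B(2) by (intro tendsto_sum lim) auto
  then have "\<forall>\<^sub>F i in Fl. dist (\<Sum>x\<in>B. f i x) 0 < e/2"
    using e by (intro tendstoD) auto
  then show "\<forall>\<^sub>F i in Fl. dist (s i) 0 < e"
    using f
  proof eventually_elim
    case (elim i)
    then have f: "(f i has_sum s i) A" and bound: "\<And>x. x \<in> A \<Longrightarrow> \<bar>f i x\<bar> \<le> g x" by auto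
    have fs: "(f i has_sum (s i - sum (f i) B)) (A - B)"
      by (rule has_sum_Diff[OF f _ B(2)]) (simp add: B(1))
    have "((\<lambda>x. - f i x) has_sum - (s i - sum (f i) B)) (A - B)"
      using fs by (simp add: has_sum_uminus)
    then have 1: "- (s i - sum (f i) B) \<le> infsum g A - sum g B"
      by (rule has_sum_mono[OF _ gs]) (use bound in fastforce)
    have 2: "s i - sum (f i) B \<le> infsum g A - sum g B"
      by (rule has_sum_mono[OF fs gs]) (use bound in fastforce)
    show ?case using 1 2 elim(1) B(3) by (simp add: dist_real_def abs_less_iff) linarith
  qed
qed

text \<open>Bridge between condition (iv), stated in the extended reals so that it makes sense for
  every \<open>F\<close>, and real summability, on which the multiplier arguments run.\<close>

lemma summable_on_iff_infsum_ennreal: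
  fixes f :: "'b \<Rightarrow> real"
  assumes "\<And>x. x \<in> A \<Longrightarrow> 0 \<le> f x"
  shows "f summable_on A \<longleftrightarrow> (\<Sum>\<^sub>\<infinity>x\<in>A. ennreal (f x)) < \<infinity>"
proof
  have sum: "(\<Sum>x\<in>B. ennreal (f x)) = ennreal (sum f B)" if "B \<subseteq> A" for B
    using that assms by (subst sum_ennreal) auto
  have sup: "(\<Sum>\<^sub>\<infinity>x\<in>A. ennreal (f x)) = (SUP B\<in>{B. finite B \<and> B \<subseteq> A}. ennreal (sum f B))"
    by (subst nonneg_infsum_complete) (auto intro!: SUP_cong simp: sum)
  show "(\<Sum>\<^sub>\<infinity>x\<in>A. ennreal (f x)) < \<infinity>" if "f summable_on A"
    using infsum_nonneg_is_SUPREMUM_ennreal[OF that assms] sup by (metis ennreal_less_top infinity_ennreal_def)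
  show "f summable_on A" if fin: "(\<Sum>\<^sub>\<infinity>x\<in>A. ennreal (f x)) < \<infinity>"
  proof (rule nonneg_bounded_partial_sums_imp_summable_on[where C="enn2real (\<Sum>\<^sub>\<infinity>x\<in>A. ennreal (f x))"])
    have "sum f B \<le> enn2real (\<Sum>\<^sub>\<infinity>x\<in>A. ennreal (f x))" if "finite B" "B \<subseteq> A" for B
    proof -
      have "ennreal (sum f B) \<le> (\<Sum>\<^sub>\<infinity>x\<in>A. ennreal (f x))"
        unfolding sup using that by (intro SUP_upper) auto
      then have "enn2real (ennreal (sum f B)) \<le> enn2real (\<Sum>\<^sub>\<infinity>x\<in>A. ennreal (f x))"
        using fin by (intro enn2real_mono) auto
      then show ?thesis using that assms by (simp add: sum_nonneg subset_iff)
    qed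
    then show "\<forall>\<^sub>F B in finite_subsets_at_top A. sum f B \<le> enn2real (\<Sum>\<^sub>\<infinity>x\<in>A. ennreal (f x))"
      by (intro eventually_finite_subsets_at_top_weakI) auto
  qed (use assms in auto)
qed

lemma has_sum_ennreal:
  fixes f :: "'a \<Rightarrow> real"
  assumes f: "(f has_sum s) A" and nonneg: "\<And>x. x \<in> A \<Longrightarrow> 0 \<le> f x"
  shows "((\<lambda>x. ennreal (f x)) has_sum ennreal s) A"
proof -
  have "((\<lambda>B. ennreal (sum f B)) \<longlongrightarrow> ennreal s) (finite_subsets_at_top A)"
    using f by (intro tendsto_ennrealI) (simp add: has_sum_def)
  moreover have "\<forall>\<^sub>F B in finite_subsets_at_top A. ennreal (sum f B) = (\<Sum>x\<in>B. ennreal (f x))"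
    by (intro eventually_finite_subsets_at_top_weakI) (use nonneg in \<open>auto simp: sum_ennreal subset_iff\<close>)
  ultimately show ?thesis unfolding has_sum_def by (rule Lim_transform_eventually)
qed

text \<open>Tonelli for unordered sums. Infinite values must be covered, since the two series in
  (iv) are claimed equal for every \<open>F\<close>; \<open>swap\<close> is stated for generic index
  sets so that finiteness of either side passes to the other.\<close>

lemma infsum_ennreal_swap:
  fixes f :: "'a \<Rightarrow> 'b \<Rightarrow> real"
  assumes nonneg: "\<And>x y. x \<in> A \<Longrightarrow> y \<in> B \<Longrightarrow> 0 \<le> f x y"
    and g: "\<And>x. x \<in> A \<Longrightarrow> (f x has_sum g x) B"
    and h: "\<And>y. y \<in> B \<Longrightarrow> ((\<lambda>x. f x y) has_sum h y) A"
  shows "(\<Sum>\<^sub>\<infinity>x\<in>A. ennreal (g x)) = (\<Sum>\<^sub>\<infinity>y\<in>B. ennreal (h y))"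
proof -
  have swap: "(h has_sum S) B"
    if nonneg: "\<And>x y. x \<in> A \<Longrightarrow> y \<in> B \<Longrightarrow> 0 \<le> f x y"
      and g: "\<And>x. x \<in> A \<Longrightarrow> (f x has_sum g x) B"
      and h: "\<And>y. y \<in> B \<Longrightarrow> ((\<lambda>x. f x y) has_sum h y) A"
      and S: "(g has_sum S) A"
    for A :: "'c set" and B :: "'d set" and f :: "'c \<Rightarrow> 'd \<Rightarrow> real" and g h S
  proof -
    have "(\<lambda>(x, y). f x y) summable_on A \<times> B"
      by (rule summable_on_SigmaI[where g=g]) (use nonneg g S in \<open>auto simp: summable_on_def\<close>)
    with g S have "((\<lambda>(x, y). f x y) has_sum S) (A \<times> B)" by (intro has_sum_SigmaI) auto
    then have "((\<lambda>(y, x). f x y) has_sum S) (B \<times> A)"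
      by (subst has_sum_swap) (simp add: case_prod_unfold)
    then show ?thesis by (rule has_sum_SigmaD) (use h in auto)
  qed
  have g0: "0 \<le> g x" if "x \<in> A" for x using has_sum_nonneg[OF g[OF that]] nonneg[OF that] by auto
  have h0: "0 \<le> h y" if "y \<in> B" for y using has_sum_nonneg[OF h[OF that]] nonneg[OF _ that] by auto
  show ?thesis
  proof (cases "g summable_on A")
    case True
    then obtain S where S: "(g has_sum S) A" by (auto simp: summable_on_def)
    have "(h has_sum S) B" by (rule swap[OF nonneg g h S])
    then show ?thesis using has_sum_ennreal[OF S g0] has_sum_ennreal[OF \<open>(h has_sum S) B\<close> h0]
      by (simp add: infsumI)
  next
    case False
    have "\<not> h summable_on B"
    proof
      assume "h summable_on B"
      then obtain S where S: "(h has_sum S) B" by (auto simp: summable_on_def)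
      have "(g has_sum S) A" by (rule swap[OF nonneg h g S])
      with False show False by (auto simp: summable_on_def)
    qed
    with False have "\<not> (\<Sum>\<^sub>\<infinity>x\<in>A. ennreal (g x)) < \<infinity>" "\<not> (\<Sum>\<^sub>\<infinity>y\<in>B. ennreal (h y)) < \<infinity>"
      using summable_on_iff_infsum_ennreal[of A g] summable_on_iff_infsum_ennreal[of B h] g0 h0 by auto
    then show ?thesis by (simp add: not_less top_unique)
  qed
qed

lemma nn_integral_count_space_has_sum:
  fixes f :: "nat \<Rightarrow> real"
  assumes f: "(f has_sum S) {1..}" and nonneg: "\<And>k. k \<ge> 1 \<Longrightarrow> 0 \<le> f k"
  shows "(\<integral>\<^sup>+k. ennreal (f k) \<partial>count_space {1..}) = ennreal S"
proof -
  have img: "{1..} = range Suc"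
  proof (intro equalityI subsetI)
    fix k :: nat assume "k \<in> {1..}"
    then have "k = Suc (k - 1)" by simp
    then show "k \<in> range Suc" by (rule range_eqI)
  qed auto
  have "((f \<circ> Suc) has_sum S) UNIV"
    using f unfolding img by (subst (asm) has_sum_reindex) auto
  then have sums: "(\<lambda>n. f (Suc n)) sums S"
    using has_sum_imp_sums by (fastforce simp: o_def)
  have "(\<integral>\<^sup>+k. ennreal (f k) \<partial>count_space {1..}) = (\<integral>\<^sup>+n. ennreal (f (Suc n)) \<partial>count_space UNIV)"
    unfolding img by (rule nn_integral_bij_count_space[symmetric]) (simp add: bij_betw_def)
  also have "\<dots> = (\<Sum>n. ennreal (f (Suc n)))" by (rule nn_integral_count_space_nat)
  also have "\<dots> = ennreal S" by (rule suminf_ennreal_eq) (use sums nonneg in auto)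
  finally show ?thesis .
qed


subsection \<open>Alternating sums over subsets\<close>

text \<open>Subsets without and with \<open>j\<close> are paired: \<open>L\<close> and
  \<open>insert j L\<close> have opposite signs and the same value of \<open>g\<close>.\<close>

lemma sum_Pow_alternating_eq_0:
  fixes g :: "'a set \<Rightarrow> real"
  assumes M: "finite M" and j: "j \<in> M" and g: "\<And>L. L \<subseteq> M \<Longrightarrow> g (insert j L) = g L"
  shows "(\<Sum>L\<in>Pow M. (- 1) ^ (card M - card L) * g L) = 0"
proof -
  define N where "N = M - {j}"
  have N: "finite N" "j \<notin> N" "M = insert j N" using M j by (auto simp: N_def)
  have "(\<Sum>L\<in>Pow M. (- 1) ^ (card M - card L) * g L) =
      (\<Sum>L\<in>Pow N. (- 1) ^ (card M - card L) * g L) +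
      (\<Sum>L\<in>insert j ` Pow N. (- 1) ^ (card M - card L) * g L)"
    unfolding N(3) Pow_insert using N by (intro sum.union_disjoint) auto
  also have "(\<Sum>L\<in>insert j ` Pow N. (- 1) ^ (card M - card L) * g L) =
      (\<Sum>L\<in>Pow N. (- 1) ^ (card M - card (insert j L)) * g (insert j L))"
    by (rule sum.reindex_cong[where l="insert j"]) (use N in \<open>auto simp: inj_on_def\<close>)
  also have "\<dots> = (\<Sum>L\<in>Pow N. - ((- 1) ^ (card M - card L) * g L))"
  proof (rule sum.cong[OF refl])
    fix L assume "L \<in> Pow N"
    then have L: "L \<subseteq> N" "finite L" "j \<notin> L" "L \<subseteq> M" using N finite_subset[of L N] by auto
    have c: "card L \<le> card N" by (rule card_mono[OF N(1) L(1)])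
    have "card M - card (insert j L) = card N - card L" "card M - card L = Suc (card N - card L)"
      using N L c by auto
    then show "(- 1) ^ (card M - card (insert j L)) * g (insert j L) = - ((- 1) ^ (card M - card L) * g L)"
      using g[OF L(4)] by simp
  qed
  finally show ?thesis by (simp add: sum_negf)
qed

text \<open>Moebius inversion on the subset lattice: after exchanging the sums, the coefficient of
  \<open>g L\<close> is the sum of \<open>(- 1) ^ card K\<close> over the subsets \<open>K\<close>
  of \<open>N - L\<close>, which vanishes unless \<open>L = N\<close>.\<close>

lemma sum_Pow_moebius:
  fixes g :: "'a set \<Rightarrow> real"
  assumes N: "finite N"
  shows "(\<Sum>M\<in>Pow N. \<Sum>L\<in>Pow M. (- 1) ^ (card M - card L) * g L) = g N"
proof -
  have fin: "M \<in> Pow N \<Longrightarrow> finite M" for M using N finite_subset by auto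
  have "(\<Sum>M\<in>Pow N. \<Sum>L\<in>Pow M. (- 1) ^ (card M - card L) * g L) =
      (\<Sum>M\<in>Pow N. \<Sum>L\<in>{L\<in>Pow N. L \<subseteq> M}. (- 1) ^ (card M - card L) * g L)"
    by (intro sum.cong) auto
  also have "\<dots> = (\<Sum>L\<in>Pow N. \<Sum>M\<in>{M\<in>Pow N. L \<subseteq> M}. (- 1) ^ (card M - card L) * g L)"
    by (rule sum.swap_restrict) (use N in auto)
  also have "\<dots> = (\<Sum>L\<in>Pow N. if L = N then g N else 0)"
  proof (rule sum.cong[OF refl])
    fix L assume L: "L \<in> Pow N"
    have "(\<Sum>M\<in>{M\<in>Pow N. L \<subseteq> M}. (- 1) ^ (card M - card L) * g L) =
        (\<Sum>K\<in>Pow (N - L). (- 1) ^ card K) * g L"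
      unfolding sum_distrib_right
    proof (rule sum.reindex_cong[where l="\<lambda>K. K \<union> L"])
      show "inj_on (\<lambda>K. K \<union> L) (Pow (N - L))" by (auto simp: inj_on_def)
      show "{M \<in> Pow N. L \<subseteq> M} = (\<lambda>K. K \<union> L) ` Pow (N - L)"
      proof (intro equalityI subsetI)
        fix M assume "M \<in> {M \<in> Pow N. L \<subseteq> M}"
        then have "M = (M - L) \<union> L" "M - L \<in> Pow (N - L)" by auto
        then show "M \<in> (\<lambda>K. K \<union> L) ` Pow (N - L)" by blast
      qed (use L in auto)
      fix K assume "K \<in> Pow (N - L)"
      then have "card (K \<union> L) = card K + card L"
        using N L by (intro card_Un_disjoint) (auto intro: finite_subset)
      then show "(- 1) ^ (card (K \<union> L) - card L) * g L = (- 1) ^ card K * g L" by simp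
    qed
    also have "(\<Sum>K\<in>Pow (N - L). (- 1::real) ^ card K) = (if L = N then 1 else 0)"
    proof (cases "L = N")
      case False
      then obtain j where j: "j \<in> N - L" using L by auto
      \<comment> \<open>Reversing the exponent changes all signs by one common factor and brings the
        sum into the alternating form with constant \<open>g\<close>.\<close>
      have "(\<Sum>K\<in>Pow (N - L). (- 1::real) ^ card K) =
          (- 1) ^ card (N - L) * (\<Sum>K\<in>Pow (N - L). (- 1) ^ (card (N - L) - card K) * 1)"
        unfolding sum_distrib_left
      proof (rule sum.cong[OF refl])
        fix K assume "K \<in> Pow (N - L)"
        then have "card K \<le> card (N - L)" using N by (intro card_mono) auto
        then show "(- 1::real) ^ card K = (- 1) ^ card (N - L) * ((- 1) ^ (card (N - L) - card K) * 1)"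
          by (auto simp: minus_one_power_iff)
      qed
      also have "\<dots> = 0" using sum_Pow_alternating_eq_0[OF _ j, of "\<lambda>_. 1"] N by simp
      finally show ?thesis using False by simp
    qed simp
    finally show "(\<Sum>M\<in>{M\<in>Pow N. L \<subseteq> M}. (- 1) ^ (card M - card L) * g L) = (if L = N then g N else 0)"
      by simp
  qed
  also have "\<dots> = g N" using N by simp
  finally show ?thesis .
qed


subsection \<open>Conditional expectations given independent random variables\<close>

lemma (in finite_measure) L2_integrable: "f \<in> L2 M \<Longrightarrow> integrable M f"
  by (auto simp: L2_def intro: square_integrable_imp_integrable)

text \<open>The sets on which the two integrals agree form a Dynkin system containing the
  intersection-stable \<open>G\<close>. Having \<open>space M\<close> in \<open>G\<close> is what
  handles complements.\<close>

lemma set_integral_eq_on_sigma_sets: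
  fixes f g :: "'a \<Rightarrow> real"
  assumes f: "integrable M f" and g: "integrable M g"
    and G: "Int_stable G" "G \<subseteq> sets M" "space M \<in> G"
    and eq: "\<And>A. A \<in> G \<Longrightarrow> (\<integral>x\<in>A. f x \<partial>M) = (\<integral>x\<in>A. g x \<partial>M)"
    and A: "A \<in> sigma_sets (space M) G"
  shows "(\<integral>x\<in>A. f x \<partial>M) = (\<integral>x\<in>A. g x \<partial>M)"
proof -
  have Gp: "G \<subseteq> Pow (space M)" using G(2) sets.space_closed by blast
  have sM: "sigma_sets (space M) G \<subseteq> sets M" by (rule sets.sigma_sets_subset[OF G(2)])
  have int: "set_integrable M B h" if "B \<in> sets M" "integrable M h" for B and h :: "'a \<Rightarrow> real"
    unfolding set_integrable_def using integrable_mult_indicator[OF that] .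
  show ?thesis
    using G(1) Gp A
  proof (induction rule: sigma_sets_induct_disjoint)
    case (basic A)
    then show ?case by (rule eq)
  next
    case empty
    show ?case by (simp add: set_lebesgue_integral_def)
  next
    case (compl A)
    then have A: "A \<in> sets M" using sM by auto
    have "(\<integral>x\<in>space M - A. h x \<partial>M) = (\<integral>x\<in>space M. h x \<partial>M) - (\<integral>x\<in>A. h x \<partial>M)"
      if h: "integrable M h" for h :: "'a \<Rightarrow> real"
    proof -
      have "(\<integral>x\<in>(space M - A) \<union> A. h x \<partial>M) = (\<integral>x\<in>space M - A. h x \<partial>M) + (\<integral>x\<in>A. h x \<partial>M)"
        by (rule set_integral_Un) (use A h in \<open>auto intro!: int\<close>)
      moreover have "(space M - A) \<union> A = space M" using sets.sets_into_space[OF A] by auto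
      ultimately show ?thesis by simp
    qed
    then show ?case using f g eq[OF G(3)] compl by simp
  next
    case (union A)
    have A: "A i \<in> sets M" for i using union(2) sM by auto
    have "(\<integral>x\<in>(\<Union>i. A i). h x \<partial>M) = (\<Sum>i. \<integral>x\<in>A i. h x \<partial>M)" if "integrable M h" for h :: "'a \<Rightarrow> real"
      by (rule lebesgue_integral_countable_add)
         (use A union(1) that in \<open>auto intro!: int simp: disjoint_family_on_def\<close>)
    then show ?case using f g union(3) by simp
  qed
qed

locale independent_sequence = prob_space P for P :: "'w measure" +
  fixes \<mu> :: "nat \<Rightarrow> 'e measure" and X :: "nat \<Rightarrow> 'w \<Rightarrow> 'e"
  assumes X_measurable: "\<And>n. n \<ge> 1 \<Longrightarrow> X n \<in> measurable P (\<mu> n)"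
    and X_indep: "indep_vars \<mu> X {1..}"
begin

abbreviation "\<A> \<equiv> sigma_X P \<mu> X"
abbreviation "Q \<equiv> P_F P \<mu> X"
abbreviation "H \<equiv> L2X P \<mu> X"
abbreviation "CE M \<equiv> real_cond_exp P (\<A> M)"
abbreviation "T M F \<equiv> hoeffding P \<mu> X F M"
text \<open>Squared norms are additive over orthogonal components. They are taken under
  \<open>P\<close>, where conditional expectations and the pairing are formed, while convergence is
  stated under \<open>Q\<close>; \<open>sqn_Q\<close> identifies the two.\<close>

abbreviation "sqn f \<equiv> (\<integral>w. (f w)\<^sup>2 \<partial>P)"

lemma subalgebra_\<A>: "M \<subseteq> {1..} \<Longrightarrow> subalgebra P (\<A> M)"
  by (rule subalgebra_sigma_X[OF X_measurable])

lemma sigma_fin: "M \<subseteq> {1..} \<Longrightarrow> sigma_finite_subalgebra P (\<A> M)"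
  using finite_measure_subalgebra_is_sigma_finite[of P "\<A> M"] subalgebra_\<A> finite_measure_axioms
  by (auto simp: finite_measure_subalgebra_def finite_measure_subalgebra_axioms_def)

lemma space_\<A>: "space (\<A> M) = space P"
  by (simp add: sigma_X_def space_measure_of_conv)

lemma sets_\<A>: "sets (\<A> M) = sigma_sets (space P) (\<Union>j\<in>M. {X j -` A \<inter> space P | A. A \<in> sets (\<mu> j)})"
  unfolding sigma_X_def by (rule sets_measure_of) auto

lemma sets_\<A>_mono: "M \<subseteq> N \<Longrightarrow> sets (\<A> M) \<subseteq> sets (\<A> N)"
  using subalgebra_sigma_X_mono[of M N P \<mu> X] by (auto simp: subalgebra_def)

lemma measurable_\<A>_mono: "f \<in> borel_measurable (\<A> M) \<Longrightarrow> M \<subseteq> N \<Longrightarrow> f \<in> borel_measurable (\<A> N)"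
  by (rule measurable_from_subalg[OF subalgebra_sigma_X_mono])

lemma measurable_\<A>: "f \<in> borel_measurable (\<A> M) \<Longrightarrow> M \<subseteq> {1..} \<Longrightarrow> f \<in> borel_measurable P"
  by (rule measurable_from_subalg[OF subalgebra_\<A>])

lemma measurable_Q: "f \<in> borel_measurable Q \<longleftrightarrow> f \<in> borel_measurable (\<A> {1..})"
  using measurable_in_subalg[OF subalgebra_\<A>[of "{1..}"]] measurable_in_subalg'[OF subalgebra_\<A>[of "{1..}"]]
  unfolding P_F_def by auto

lemma H_iff: "f \<in> H \<longleftrightarrow> f \<in> borel_measurable (\<A> {1..}) \<and> integrable P (\<lambda>x. (f x)\<^sup>2)"
proof -
  have "integrable Q (\<lambda>x. (f x)\<^sup>2) \<longleftrightarrow> integrable P (\<lambda>x. (f x)\<^sup>2)" if "f \<in> borel_measurable (\<A> {1..})"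
    unfolding P_F_def
    using integrable_from_subalg[OF subalgebra_\<A>[OF order_refl], of "\<lambda>x. (f x)\<^sup>2"]
      integrable_in_subalg[OF subalgebra_\<A>[OF order_refl] borel_measurable_power[OF that, of 2]] by blast
  then show ?thesis by (auto simp: L2X_def L2_def measurable_Q)
qed

lemma H_L2Q: "f \<in> L2 Q \<longleftrightarrow> f \<in> H"
  by (simp add: L2X_def)

lemma H_L2: "f \<in> H \<Longrightarrow> f \<in> L2 P"
  by (auto simp: H_iff L2_def intro: measurable_\<A>)

lemma H_measurable: "f \<in> H \<Longrightarrow> f \<in> borel_measurable P"
  using H_L2 by (auto simp: L2_def)

lemma H_integrable: "f \<in> H \<Longrightarrow> integrable P f"
  by (intro L2_integrable H_L2)

lemma H_sq: "f \<in> H \<Longrightarrow> integrable P (\<lambda>w. (f w)\<^sup>2)"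
  by (simp add: H_iff)

lemma H_mult: "f \<in> H \<Longrightarrow> g \<in> H \<Longrightarrow> integrable P (\<lambda>w. f w * g w)"
  by (intro L2_integrable_mult H_L2)

lemma H_add: "f \<in> H \<Longrightarrow> g \<in> H \<Longrightarrow> (\<lambda>w. f w + g w) \<in> H"
  unfolding L2X_def by (rule L2_add)

lemma H_diff: "f \<in> H \<Longrightarrow> g \<in> H \<Longrightarrow> (\<lambda>w. f w - g w) \<in> H"
  unfolding L2X_def by (rule L2_diff)

lemma H_cmult: "f \<in> H \<Longrightarrow> (\<lambda>w. c * f w) \<in> H"
  unfolding L2X_def by (rule L2_cmult)

lemma H_zero: "(\<lambda>w. 0) \<in> H"
  unfolding L2X_def by (rule L2_zero)

lemma H_sum: "(\<And>i. i \<in> I \<Longrightarrow> f i \<in> H) \<Longrightarrow> (\<lambda>w. \<Sum>i\<in>I. f i w) \<in> H"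
  unfolding L2X_def by (rule L2_sum)

lemma integral_Q: "f \<in> borel_measurable (\<A> {1..}) \<Longrightarrow> (\<integral>w. f w \<partial>Q) = (\<integral>w. f w \<partial>P)" for f :: "'w \<Rightarrow> real"
  unfolding P_F_def by (rule integral_subalgebra2[OF subalgebra_\<A>]) auto

lemma sqn_Q: "f \<in> H \<Longrightarrow> (\<integral>w. (f w)\<^sup>2 \<partial>Q) = sqn f"
  by (rule integral_Q) (auto simp: H_iff)

lemma converges_Q_iff:
  assumes "\<And>i. f i \<in> H"
  shows "L2_converges Q f g Fl \<longleftrightarrow> g \<in> H \<and> ((\<lambda>i. sqn (\<lambda>w. f i w - g w)) \<longlongrightarrow> 0) Fl"
  unfolding L2_converges_iff H_L2Q using assms sqn_Q[OF H_diff, OF assms] by (auto cong: conj_cong)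

lemma sqn_eq_0: 
  assumes f: "f \<in> H" and 0: "sqn f = 0"
  shows "AE w in P. f w = 0"
  using integral_nonneg_eq_0_iff_AE[OF H_sq[OF f]] 0 by simp

lemma sqn_cong: 
  assumes "AE w in P. f w = g w" "f \<in> H" "g \<in> H"
  shows "sqn f = sqn g"
  by (rule integral_cong_AE) (use assms H_measurable in \<open>auto intro!: borel_measurable_power\<close>)

lemma CE_H:
  assumes M: "M \<subseteq> {1..}" and f: "f \<in> H"
  shows "CE M f \<in> H"
proof -
  interpret sigma_finite_subalgebra P "\<A> M" by (rule sigma_fin[OF M])
  have conv: "convex_on UNIV (\<lambda>x::real. x\<^sup>2)"
    by (rule convex_on_subset[OF convex_power2]) auto
  have "integrable P (\<lambda>w. (CE M f w)\<^sup>2)"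
    by (rule integrable_convex_cond_exp[OF H_integrable[OF f], where I=UNIV])
       (use conv H_sq[OF f] in auto)
  moreover have "CE M f \<in> borel_measurable (\<A> {1..})"
    by (rule measurable_\<A>_mono[OF borel_measurable_cond_exp M])
  ultimately show ?thesis by (simp add: H_iff)
qed

lemma CE_ip:
  assumes M: "M \<subseteq> {1..}" and f: "f \<in> H" and g: "g \<in> H" "g \<in> borel_measurable (\<A> M)"
  shows "(\<integral>w. g w * CE M f w \<partial>P) = (\<integral>w. g w * f w \<partial>P)"
proof -
  interpret sigma_finite_subalgebra P "\<A> M" by (rule sigma_fin[OF M])
  show ?thesis by (rule real_cond_exp_intg(2)[OF H_mult[OF g(1) f] g(2) H_measurable[OF f]])
qed

lemma CE_id:
  assumes M: "M \<subseteq> {1..}" and g: "g \<in> H" "g \<in> borel_measurable (\<A> M)"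
  shows "AE w in P. CE M g w = g w"
proof -
  interpret sigma_finite_subalgebra P "\<A> M" by (rule sigma_fin[OF M])
  show ?thesis by (rule real_cond_exp_F_meas[OF H_integrable[OF g(1)] g(2)])
qed

lemma CE_add:
  assumes M: "M \<subseteq> {1..}" and "f \<in> H" "g \<in> H"
  shows "AE w in P. CE M (\<lambda>w. f w + g w) w = CE M f w + CE M g w"
proof -
  interpret sigma_finite_subalgebra P "\<A> M" by (rule sigma_fin[OF M])
  show ?thesis by (rule real_cond_exp_add) (use assms H_integrable in auto)
qed

lemma CE_cmult:
  assumes M: "M \<subseteq> {1..}" and "f \<in> H"
  shows "AE w in P. CE M (\<lambda>w. c * f w) w = c * CE M f w"
proof -
  interpret sigma_finite_subalgebra P "\<A> M" by (rule sigma_fin[OF M])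
  show ?thesis by (rule real_cond_exp_cmult) (use assms H_integrable in auto)
qed

lemma CE_cong:
  assumes M: "M \<subseteq> {1..}" and "f \<in> H" "g \<in> H" "AE w in P. f w = g w"
  shows "AE w in P. CE M f w = CE M g w"
proof -
  interpret sigma_finite_subalgebra P "\<A> M" by (rule sigma_fin[OF M])
  show ?thesis by (rule real_cond_exp_cong) (use assms H_measurable in auto)
qed

text \<open>Grouping of independent variables into disjoint blocks; \<open>case_bool M N\<close>
  names the blocks because \<open>indep_set\<close> is \<open>indep_sets\<close> over
  \<open>bool\<close>. The preimages under one \<open>X i\<close> are stable under intersection, so
  independence passes to the generated sigma-algebras.\<close>

lemma indep_\<A>:
  assumes MN: "M \<subseteq> {1..}" "N \<subseteq> {1..}" "M \<inter> N = {}"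
  shows "indep_set (sets (\<A> M)) (sets (\<A> N))"
proof -
  let ?E = "\<lambda>i. {X i -` A \<inter> space P | A. A \<in> sets (\<mu> i)}"
  have E: "indep_sets ?E {1..}" using X_indep by (simp add: indep_vars_def2)
  have "indep_sets (\<lambda>b. sigma_sets (space P) (\<Union>i\<in>case_bool M N b. ?E i)) UNIV"
  proof (rule indep_sets_collect_sigma)
    show "indep_sets ?E (\<Union>b\<in>UNIV. case_bool M N b)"
      by (rule indep_sets_mono_index[OF _ E]) (use MN in \<open>auto split: bool.splits\<close>)
    show "Int_stable (?E i)" for i
    proof (rule Int_stableI)
      fix a b assume "a \<in> ?E i" "b \<in> ?E i"
      then obtain A B where "a = X i -` A \<inter> space P" "b = X i -` B \<inter> space P"
        "A \<in> sets (\<mu> i)" "B \<in> sets (\<mu> i)" by auto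
      then have "a \<inter> b = X i -` (A \<inter> B) \<inter> space P" "A \<inter> B \<in> sets (\<mu> i)" by auto
      then show "a \<inter> b \<in> ?E i" by blast
    qed
    show "disjoint_family_on (case_bool M N) UNIV"
      using MN by (auto simp: disjoint_family_on_def split: bool.splits)
  qed
  moreover have "(\<lambda>b. sigma_sets (space P) (\<Union>i\<in>case_bool M N b. ?E i)) =
      case_bool (sets (\<A> M)) (sets (\<A> N))"
    by (rule ext) (simp add: sets_\<A> split: bool.splits)
  ultimately show ?thesis by (simp add: indep_set_def)
qed

lemma set_integral_indep:
  assumes MN: "M \<subseteq> {1..}" "N \<subseteq> {1..}" "M \<inter> N = {}"
    and C: "C \<in> sets (\<A> N)" and f: "f \<in> borel_measurable (\<A> M)" "integrable P f"
  shows "(\<integral>w\<in>C. f w \<partial>P) = prob C * (\<integral>w. f w \<partial>P)"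
proof -
  have CP: "C \<in> sets P" using C subalgebra_\<A>[OF MN(2)] by (auto simp: subalgebra_def)
  have "indep_var borel (indicator C :: 'w \<Rightarrow> real) borel f"
    unfolding indep_var_eq
  proof (intro conjI)
    show "random_variable borel (indicator C)" using CP by simp
    show "random_variable borel f" using f by auto
    have gen: "sigma_sets (space P) {g -` A \<inter> space P |A. A \<in> sets borel} \<subseteq> sets (\<A> K)"
      if g: "g \<in> borel_measurable (\<A> K)" for g :: "'w \<Rightarrow> real" and K
    proof -
      have "{g -` A \<inter> space P |A. A \<in> sets borel} \<subseteq> sets (\<A> K)"
        using measurable_sets[OF g] by (auto simp: space_\<A>)
      from sets.sigma_sets_subset[OF this] show ?thesis by (simp add: space_\<A>)
    qed
    have C': "(indicator C :: 'w \<Rightarrow> real) \<in> borel_measurable (\<A> N)" using C by simp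
    have "indep_set (sets (\<A> N)) (sets (\<A> M))" by (rule indep_\<A>) (use MN in auto)
    then show "indep_set (sigma_sets (space P) {indicator C -` A \<inter> space P |A. A \<in> sets (borel::real measure)})
        (sigma_sets (space P) {f -` A \<inter> space P |A. A \<in> sets (borel::real measure)})"
      unfolding indep_set_def
      by (rule indep_sets_mono_sets) (use gen[OF C'] gen[OF f(1)] in \<open>simp split: bool.splits\<close>)
  qed
  then have "(\<integral>w. indicator C w * f w \<partial>P) = (\<integral>w. indicator C w \<partial>P) * (\<integral>w. f w \<partial>P)"
    by (rule indep_var_lebesgue_integral) (use CP f in \<open>auto simp: integrable_real_indicator emeasure_eq_measure\<close>)
  then show ?thesis using CP by (simp add: set_lebesgue_integral_def)
qed

text \<open>By independence it suffices to test against the rectangles \<open>B \<inter> C\<close> with \<open>B\<close> in \<open>\<A> (M \<inter> N)\<close>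
  and \<open>C\<close> in \<open>\<A> (N - M)\<close>.\<close>

lemma CE_Int:
  assumes MN: "M \<subseteq> {1..}" "N \<subseteq> {1..}" and f: "f \<in> H"
  shows "AE w in P. CE N (CE M f) w = CE (M \<inter> N) f w"
proof -
  let ?g = "CE M f" and ?h = "CE (M \<inter> N) f"
  have MN': "M \<inter> N \<subseteq> {1..}" "N - M \<subseteq> {1..}" using MN by auto
  have g: "?g \<in> H" "?g \<in> borel_measurable (\<A> M)" and h: "?h \<in> H" "?h \<in> borel_measurable (\<A> (M \<inter> N))"
    using CE_H MN MN' f by auto
  interpret N: sigma_finite_subalgebra P "\<A> N" by (rule sigma_fin[OF MN(2)])
  interpret I: sigma_finite_subalgebra P "\<A> (M \<inter> N)" by (rule sigma_fin[OF MN'(1)])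
  have hg: "AE w in P. CE (M \<inter> N) ?g w = ?h w"
    by (rule I.real_cond_exp_nested_subalg[OF subalgebra_\<A>[OF MN(1)] subalgebra_sigma_X_mono H_integrable[OF f]]) auto
  have subP: "sets (\<A> K) \<subseteq> sets P" if "K \<subseteq> {1..}" for K using subalgebra_\<A>[OF that] by (auto simp: subalgebra_def)
  define G where "G = {B \<inter> C | B C. B \<in> sets (\<A> (M \<inter> N)) \<and> C \<in> sets (\<A> (N - M))}"
  have GI: "B \<inter> C \<in> G" if "B \<in> sets (\<A> (M \<inter> N))" "C \<in> sets (\<A> (N - M))" for B C
    using that by (auto simp: G_def)
  have spaceG: "space P \<in> sets (\<A> K)" for K using sets.top[of "\<A> K"] by (simp add: space_\<A>)
  \<comment> \<open>A generator of \<open>\<A> N\<close> is a preimage under a single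
    \<open>X j\<close>, hence lies in one of the two factors; the other side of the rectangle is the
    whole space.\<close>
  have GN: "sets (\<A> N) \<subseteq> sigma_sets (space P) G"
    unfolding sets_\<A>[of N]
  proof (rule sigma_sets_mono, safe)
    fix j A assume j: "j \<in> N" and A: "A \<in> sets (\<mu> j)"
    let ?S = "X j -` A \<inter> space P"
    have S: "?S \<in> sets (\<A> K)" if "j \<in> K" for K
      unfolding sets_\<A> using that A by (intro sigma_sets.Basic) auto
    have "?S \<inter> space P \<in> G \<or> space P \<inter> ?S \<in> G"
    proof (cases "j \<in> M")
      case True
      then show ?thesis using j by (intro disjI1 GI S spaceG) auto
    next
      case False
      then show ?thesis using j by (intro disjI2 GI S spaceG) auto
    qed
    then show "?S \<in> sigma_sets (space P) G" by (auto intro: sigma_sets.Basic simp: Int_ac)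
  qed
  show ?thesis
  proof (rule N.real_cond_exp_charact)
    show "integrable P ?g" "integrable P ?h" using g h H_integrable by auto
    show "?h \<in> borel_measurable (\<A> N)" by (rule measurable_\<A>_mono[OF h(2)]) auto
    fix A assume A: "A \<in> sets (\<A> N)"
    show "(\<integral>x\<in>A. ?g x \<partial>P) = (\<integral>x\<in>A. ?h x \<partial>P)"
    proof (rule set_integral_eq_on_sigma_sets[where G=G])
      show "integrable P ?g" "integrable P ?h" using g h H_integrable by auto
      show "Int_stable G"
      proof (rule Int_stableI)
        fix a b assume "a \<in> G" "b \<in> G"
        then obtain B C B' C' where "a = B \<inter> C" "b = B' \<inter> C'" "B \<in> sets (\<A> (M \<inter> N))" "B' \<in> sets (\<A> (M \<inter> N))"
          "C \<in> sets (\<A> (N - M))" "C' \<in> sets (\<A> (N - M))" by (auto simp: G_def)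
        moreover from this have "a \<inter> b = (B \<inter> B') \<inter> (C \<inter> C')" by auto
        ultimately show "a \<inter> b \<in> G" using GI by (metis sets.Int)
      qed
      show "G \<subseteq> sets P" using subP[OF MN'(1)] subP[OF MN'(2)] by (auto simp: G_def)
      show "space P \<in> G" using GI[OF spaceG spaceG] by simp
      show "A \<in> sigma_sets (space P) G" using A GN by auto
      fix A' assume "A' \<in> G"
      then obtain B C where A': "A' = B \<inter> C" and B: "B \<in> sets (\<A> (M \<inter> N))" and C: "C \<in> sets (\<A> (N - M))"
        by (auto simp: G_def)
      have BP: "B \<in> sets P" using B subP[OF MN'(1)] by auto
      have BM: "B \<in> sets (\<A> M)" using B sets_\<A>_mono[of "M \<inter> N" M] by auto
      \<comment> \<open>The product of \<open>indicator B\<close> and \<open>k\<close> is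
        \<open>\<A> M\<close>-measurable and \<open>C\<close> belongs to the disjoint block
        \<open>N - M\<close>, so \<open>C\<close> factors out. For \<open>?g\<close> and
        \<open>?h\<close> this leaves integrals over \<open>B\<close>, which agree by the tower
        property.\<close>
      have *: "(\<integral>w\<in>A'. k w \<partial>P) = prob C * (\<integral>w\<in>B. k w \<partial>P)"
        if k: "k \<in> borel_measurable (\<A> M)" "integrable P k" for k
      proof -
        have "(\<integral>w\<in>A'. k w \<partial>P) = (\<integral>w\<in>C. indicator B w * k w \<partial>P)"
          unfolding A' set_lebesgue_integral_def
          by (intro Bochner_Integration.integral_cong) (auto simp: indicator_def)
        also have "\<dots> = prob C * (\<integral>w. indicator B w * k w \<partial>P)"
          by (rule set_integral_indep[OF MN(1) MN'(2) _ C])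
             (use k BM integrable_mult_indicator[OF BP k(2)] in auto)
        finally show ?thesis by (simp add: set_lebesgue_integral_def)
      qed
      have "(\<integral>w\<in>B. ?g w \<partial>P) = (\<integral>w\<in>B. CE (M \<inter> N) ?g w \<partial>P)"
        by (rule I.real_cond_exp_intA[OF H_integrable[OF g(1)] B])
      also have "\<dots> = (\<integral>w\<in>B. ?h w \<partial>P)"
        unfolding set_lebesgue_integral_def
        by (rule integral_cong_AE)
           (use hg BP CE_H[OF MN'(1) g(1)] h(1) H_measurable in \<open>auto intro!: borel_measurable_times\<close>)
      finally have "(\<integral>w\<in>B. ?g w \<partial>P) = (\<integral>w\<in>B. ?h w \<partial>P)" .
      then show "(\<integral>x\<in>A'. ?g x \<partial>P) = (\<integral>x\<in>A'. ?h x \<partial>P)"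
        using *[OF g(2) H_integrable[OF g(1)]] *[of ?h] measurable_\<A>_mono[OF h(2), of M] H_integrable[OF h(1)]
        by auto
    qed
  qed
qed


subsection \<open>The Parseval identity\<close>

lemma Pfin_subset: "M \<in> Pfin \<Longrightarrow> M \<subseteq> {1..}"
  and Pfin_finite: "M \<in> Pfin \<Longrightarrow> finite M"
  by (auto simp: Pfin_def)

lemma Pow_Pfin: "N \<in> Pfin \<Longrightarrow> M \<in> Pow N \<Longrightarrow> M \<in> Pfin"
  by (auto simp: Pfin_def intro: finite_subset)

lemma atLeastAtMost_Pfin: "{1..n} \<in> Pfin"
  by (auto simp: Pfin_def)

lemma T_CE_sum: "T M F = (\<lambda>w. \<Sum>L\<in>Pow M. (- 1) ^ (card M - card L) * CE L F w)"
  by (simp add: fun_eq_iff hoeffding_def)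

lemma T_H: "M \<in> Pfin \<Longrightarrow> F \<in> H \<Longrightarrow> T M F \<in> H"
  unfolding T_CE_sum by (intro H_sum H_cmult CE_H) (auto simp: Pfin_def)

lemma T_measurable: "T M F \<in> borel_measurable (\<A> M)"
  unfolding T_CE_sum
  by (intro borel_measurable_sum borel_measurable_times borel_measurable_const
      measurable_\<A>_mono[OF borel_measurable_cond_exp]) auto

lemma AE_CE_Pow:
  assumes M: "M \<in> Pfin" and "\<And>L. L \<subseteq> {1..} \<Longrightarrow> AE w in P. R L w"
  shows "AE w in P. \<forall>L\<in>Pow M. R L w"
  by (rule AE_finite_allI) (use assms in \<open>auto simp: Pfin_def\<close>)

lemma T_add:
  assumes "M \<in> Pfin" "F \<in> H" "G \<in> H"
  shows "AE w in P. T M (\<lambda>w. F w + G w) w = T M F w + T M G w"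
proof -
  have "AE w in P. \<forall>L\<in>Pow M. CE L (\<lambda>w. F w + G w) w = CE L F w + CE L G w"
    by (rule AE_CE_Pow[OF assms(1) CE_add[OF _ assms(2,3)]])
  then show ?thesis by eventually_elim (simp add: hoeffding_def sum.distrib distrib_left)
qed

lemma T_cmult:
  assumes "M \<in> Pfin" "F \<in> H"
  shows "AE w in P. T M (\<lambda>w. c * F w) w = c * T M F w"
proof -
  have "AE w in P. \<forall>L\<in>Pow M. CE L (\<lambda>w. c * F w) w = c * CE L F w"
    by (rule AE_CE_Pow[OF assms(1) CE_cmult[OF _ assms(2)]])
  then show ?thesis by eventually_elim (simp add: hoeffding_def sum_distrib_left mult_ac)
qed

lemma T_cong:
  assumes "M \<in> Pfin" "F \<in> H" "G \<in> H" "AE w in P. F w = G w"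
  shows "AE w in P. T M F w = T M G w"
proof -
  have "AE w in P. \<forall>L\<in>Pow M. CE L F w = CE L G w"
    by (rule AE_CE_Pow[OF assms(1) CE_cong[OF _ assms(2-4)]])
  then show ?thesis by eventually_elim (simp add: hoeffding_def)
qed

lemma T_diff:
  assumes "M \<in> Pfin" "F \<in> H" "G \<in> H"
  shows "AE w in P. T M (\<lambda>w. F w - G w) w = T M F w - T M G w"
  using T_add[OF assms(1,2) H_cmult[OF assms(3)], of "-1"] T_cmult[OF assms(1,3), of "-1"]
  by eventually_elim simp

lemma CE_sum:
  assumes N: "N \<subseteq> {1..}" and "finite I" and f: "\<And>i. i \<in> I \<Longrightarrow> f i \<in> H"
  shows "AE w in P. CE N (\<lambda>w. \<Sum>i\<in>I. c i * f i w) w = (\<Sum>i\<in>I. c i * CE N (f i) w)"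
  using assms(2) f
proof (induction I rule: finite_induct)
  case empty
  show ?case using CE_cmult[OF N H_zero, of 0] by simp
next
  case (insert i I)
  have 1: "(\<lambda>w. c i * f i w) \<in> H" "(\<lambda>w. \<Sum>i\<in>I. c i * f i w) \<in> H"
    using insert by (auto intro!: H_sum H_cmult)
  have 2: "AE w in P. CE N (\<lambda>w. \<Sum>i\<in>I. c i * f i w) w = (\<Sum>i\<in>I. c i * CE N (f i) w)"
    using insert by auto
  have 3: "AE w in P. CE N (\<lambda>w. c i * f i w) w = c i * CE N (f i) w"
    using insert by (intro CE_cmult[OF N]) auto
  show ?case
    using CE_add[OF N 1] 2 3 by eventually_elim (use insert in simp)
qed

lemma CE_T:
  assumes N: "N \<subseteq> {1..}" and M: "M \<in> Pfin" and F: "F \<in> H"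
  shows "AE w in P. CE N (T M F) w = (\<Sum>L\<in>Pow M. (- 1) ^ (card M - card L) * CE (L \<inter> N) F w)"
proof -
  have M': "M \<subseteq> {1..}" "finite M" using M by (auto simp: Pfin_def)
  have "AE w in P. CE N (T M F) w = (\<Sum>L\<in>Pow M. (- 1) ^ (card M - card L) * CE N (CE L F) w)"
    unfolding T_CE_sum by (rule CE_sum[OF N]) (use M' F in \<open>auto intro!: CE_H\<close>)
  moreover have "AE w in P. \<forall>L\<in>Pow M. CE N (CE L F) w = CE (L \<inter> N) F w"
    by (rule AE_CE_Pow[OF M CE_Int[OF _ N F]])
  ultimately show ?thesis by eventually_elim simp
qed

text \<open>Conditioning on \<open>\<A> N\<close> erases any \<open>j\<close> of \<open>M\<close>
  outside \<open>N\<close>, so \<open>L\<close> and \<open>insert j L\<close> contribute equal terms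
  with opposite signs.\<close>

lemma CE_T_eq_0:
  assumes N: "N \<subseteq> {1..}" and M: "M \<in> Pfin" and F: "F \<in> H" and MN: "\<not> M \<subseteq> N"
  shows "AE w in P. CE N (T M F) w = 0"
proof -
  obtain j where j: "j \<in> M" "j \<notin> N" using MN by auto
  have "(\<Sum>L\<in>Pow M. (- 1) ^ (card M - card L) * CE (L \<inter> N) F w) = 0" for w
    by (rule sum_Pow_alternating_eq_0[OF Pfin_finite[OF M] j(1)]) (use j(2) in simp)
  then show ?thesis using CE_T[OF N M F] by simp
qed

text \<open>On components, conditioning is truncation: for \<open>M \<subseteq> N\<close> every
  \<open>N \<inter> L\<close> equals \<open>L\<close>, and otherwise an index of \<open>M\<close>
  outside \<open>N\<close> makes the alternating sum cancel.\<close>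

lemma T_CE:
  assumes N: "N \<subseteq> {1..}" and M: "M \<in> Pfin" and F: "F \<in> H"
  shows "AE w in P. T M (CE N F) w = (if M \<subseteq> N then T M F w else 0)"
proof -
  have "AE w in P. \<forall>L\<in>Pow M. CE L (CE N F) w = CE (N \<inter> L) F w"
    by (rule AE_CE_Pow[OF M CE_Int[OF N _ F]])
  then have *: "AE w in P. T M (CE N F) w = (\<Sum>L\<in>Pow M. (- 1) ^ (card M - card L) * CE (N \<inter> L) F w)"
    by eventually_elim (simp add: hoeffding_def)
  show ?thesis
  proof (cases "M \<subseteq> N")
    case True
    then have "N \<inter> L = L" if "L \<in> Pow M" for L using that by auto
    then show ?thesis using * True by (simp add: hoeffding_def)
  next
    case False
    then obtain j where j: "j \<in> M" "j \<notin> N" by auto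
    have "(\<Sum>L\<in>Pow M. (- 1) ^ (card M - card L) * CE (N \<inter> L) F w) = 0" for w
      by (rule sum_Pow_alternating_eq_0[OF Pfin_finite[OF M] j(1)]) (use j(2) in simp)
    then show ?thesis using * False by simp
  qed
qed

text \<open>Of two different sets, one is not contained in the other. Its component has conditional
  expectation zero given the sigma-algebra of the other set, with respect to which the other factor
  is measurable.\<close>

lemma T_orthogonal:
  assumes M: "M \<in> Pfin" and N: "N \<in> Pfin" and MN: "M \<noteq> N" and F: "F \<in> H" and G: "G \<in> H"
  shows "(\<integral>w. T M F w * T N G w \<partial>P) = 0"
proof -
  have *: "(\<integral>w. T N G w * T M F w \<partial>P) = 0"
    if M: "M \<in> Pfin" and N: "N \<in> Pfin" and MN: "\<not> M \<subseteq> N" and F: "F \<in> H" and G: "G \<in> H" for M N F G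
  proof -
    have "(\<integral>w. T N G w * T M F w \<partial>P) = (\<integral>w. T N G w * CE N (T M F) w \<partial>P)"
      by (rule CE_ip[symmetric, OF Pfin_subset[OF N] T_H[OF M F] T_H[OF N G] T_measurable])
    also have "\<dots> = 0"
      by (rule integral_eq_zero_AE)
         (use CE_T_eq_0[OF Pfin_subset[OF N] M F MN] in \<open>auto elim!: eventually_mono\<close>)
    finally show ?thesis .
  qed
  show ?thesis
  proof (cases "M \<subseteq> N")
    case False
    then show ?thesis using *[OF M N False F G] by (simp add: mult.commute)
  next
    case True
    then show ?thesis using *[OF N M _ G F] MN by auto
  qed
qed

text \<open>Moebius inversion writes \<open>CE N F\<close> as the sum of the components over the
  subsets of \<open>N\<close>, even pointwise, because it only rearranges the same functions;
  orthogonality removes the mixed products.\<close>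

lemma sqn_CE:
  assumes N: "N \<in> Pfin" and F: "F \<in> H"
  shows "sqn (CE N F) = (\<Sum>M\<in>Pow N. sqn (T M F))"
proof -
  have fin: "finite (Pow N)" using Pfin_finite[OF N] by simp
  have "CE N F w = (\<Sum>M\<in>Pow N. T M F w)" for w
    unfolding hoeffding_def by (rule sum_Pow_moebius[symmetric, OF Pfin_finite[OF N]])
  then have "sqn (CE N F) = (\<integral>w. (\<Sum>M\<in>Pow N. \<Sum>M'\<in>Pow N. T M F w * T M' F w) \<partial>P)"
    by (simp add: power2_eq_square sum_product)
  also have "\<dots> = (\<Sum>M\<in>Pow N. \<Sum>M'\<in>Pow N. \<integral>w. T M F w * T M' F w \<partial>P)"
    using Pow_Pfin[OF N] F by (subst Bochner_Integration.integral_sum)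
      (auto intro!: Bochner_Integration.integrable_sum H_mult T_H sum.cong Bochner_Integration.integral_sum)
  also have "\<dots> = (\<Sum>M\<in>Pow N. \<Sum>M'\<in>Pow N. if M' = M then sqn (T M F) else 0)"
    using T_orthogonal[OF Pow_Pfin[OF N] Pow_Pfin[OF N] _ F F]
    by (intro sum.cong refl) (auto simp: power2_eq_square)
  also have "\<dots> = (\<Sum>M\<in>Pow N. sqn (T M F))"
    using fin by simp
  finally show ?thesis .
qed

lemma sqn_diff_CE:
  assumes N: "N \<subseteq> {1..}" and F: "F \<in> H"
  shows "sqn (\<lambda>w. F w - CE N F w) = sqn F - sqn (CE N F)"
proof -
  have C: "CE N F \<in> H" by (rule CE_H[OF N F])
  have "(\<integral>w. CE N F w * F w \<partial>P) = (\<integral>w. CE N F w * CE N F w \<partial>P)"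
    by (rule CE_ip[symmetric, OF N F C borel_measurable_cond_exp])
  then have ip: "(\<integral>w. CE N F w * F w \<partial>P) = sqn (CE N F)" by (simp add: power2_eq_square)
  have "sqn (\<lambda>w. F w - CE N F w) = (\<integral>w. (F w)\<^sup>2 - 2 * (CE N F w * F w) + (CE N F w)\<^sup>2 \<partial>P)"
    by (intro Bochner_Integration.integral_cong refl) (simp add: power2_eq_square algebra_simps)
  also have "\<dots> = sqn F - 2 * (\<integral>w. CE N F w * F w \<partial>P) + sqn (CE N F)"
    using H_sq[OF F] H_sq[OF C] H_mult[OF C F] by simp
  finally show ?thesis using ip by simp
qed

lemma sqn_CE_le: "N \<subseteq> {1..} \<Longrightarrow> F \<in> H \<Longrightarrow> sqn (CE N F) \<le> sqn F"
proof -
  assume *: "N \<subseteq> {1..}" "F \<in> H"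
  have "0 \<le> sqn (\<lambda>w. F w - CE N F w)" by simp
  then show ?thesis using sqn_diff_CE[OF *] by simp
qed

text \<open>The limit exists by completeness since the norms increase; it is \<open>F\<close> because both have
  the same integrals over the sets in \<open>\<A> {1..n}\<close> for all \<open>n\<close>.\<close>

lemma CE_atLeastAtMost_tendsto:
  assumes F: "F \<in> H"
  shows "(\<lambda>n. sqn (\<lambda>w. F w - CE {1..n} F w)) \<longlonglongrightarrow> 0"
proof -
  let ?C = "\<lambda>n. CE {1..n} F"
  have sub: "{1..n} \<subseteq> {1..}" for n :: nat by auto
  have C: "?C n \<in> H" for n by (rule CE_H[OF sub F])
  have dist: "sqn (\<lambda>w. ?C m w - ?C n w) = sqn (?C m) - sqn (?C n)" if "n \<le> m" for m n
  proof -
    have eq: "{1..m} \<inter> {1..n} = {1..n}" using that by auto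
    have ae: "AE w in P. CE {1..n} (?C m) w = ?C n w"
      using CE_Int[OF sub[of m] sub[of n] F] unfolding eq .
    have "sqn (\<lambda>w. ?C m w - ?C n w) = sqn (\<lambda>w. ?C m w - CE {1..n} (?C m) w)"
    proof (rule sqn_cong[OF _ H_diff[OF C C] H_diff[OF C CE_H[OF sub C]]])
      show "AE w in P. ?C m w - ?C n w = ?C m w - CE {1..n} (?C m) w"
        using ae by eventually_elim simp
    qed
    also have "\<dots> = sqn (?C m) - sqn (CE {1..n} (?C m))" by (rule sqn_diff_CE[OF sub C])
    also have "sqn (CE {1..n} (?C m)) = sqn (?C n)"
      by (rule sqn_cong[OF ae CE_H[OF sub C] C])
    finally show ?thesis .
  qed
  have "convergent (\<lambda>n. sqn (?C n))"
  proof (rule Bseq_mono_convergent)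
    show "Bseq (\<lambda>n. sqn (?C n))" using sqn_CE_le[OF sub F] by (intro BseqI'[where K="sqn F"]) auto
    show "\<forall>m n. m \<le> n \<longrightarrow> sqn (?C m) \<le> sqn (?C n)"
    proof (intro allI impI)
      fix m n :: nat assume "m \<le> n"
      have "0 \<le> sqn (\<lambda>w. ?C n w - ?C m w)" by simp
      then show "sqn (?C m) \<le> sqn (?C n)" using dist[OF \<open>m \<le> n\<close>] by linarith
    qed
  qed
  then have Cauchy: "Cauchy (\<lambda>n. sqn (?C n))" by (rule convergent_Cauchy)
  have "\<exists>G. L2_converges Q ?C G sequentially"
  proof (rule L2_complete)
    show "?C n \<in> L2 Q" for n using C by (simp add: H_L2Q)
    fix e :: real assume "e > 0"
    from metric_CauchyD[OF Cauchy this] obtain N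
      where N: "\<forall>m\<ge>N. \<forall>n\<ge>N. dist (sqn (?C m)) (sqn (?C n)) < e" by auto
    have "(\<integral>x. (?C m x - ?C n x)\<^sup>2 \<partial>Q) < e" if "m \<ge> N" "n \<ge> N" for m n
    proof -
      have 1: "(\<integral>x. (?C m x - ?C n x)\<^sup>2 \<partial>Q) = sqn (\<lambda>w. ?C m w - ?C n w)" by (rule sqn_Q[OF H_diff[OF C C]])
      have 2: "sqn (\<lambda>w. ?C m w - ?C n w) = sqn (\<lambda>w. ?C n w - ?C m w)" by (simp add: power2_commute)
      have 3: "0 \<le> sqn (\<lambda>w. ?C m w - ?C n w)" by simp
      have "sqn (\<lambda>w. ?C m w - ?C n w) = \<bar>sqn (?C m) - sqn (?C n)\<bar>"
        using dist[of m n] dist[of n m] 2 3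
        by (cases "m \<le> n") auto
      then show ?thesis using N that 1 by (simp add: dist_real_def)
    qed
    then show "\<exists>N. \<forall>m\<ge>N. \<forall>n\<ge>N. (\<integral>x. (?C m x - ?C n x)\<^sup>2 \<partial>Q) < e" by auto
  qed
  then obtain G where "L2_converges Q ?C G sequentially" by auto
  then have G: "G \<in> H" and lim: "(\<lambda>n. sqn (\<lambda>w. ?C n w - G w)) \<longlonglongrightarrow> 0"
    using converges_Q_iff[of ?C G sequentially] C by auto
  interpret I: sigma_finite_subalgebra P "\<A> {1..}" by (rule sigma_fin) simp
  let ?G = "\<Union>n. sets (\<A> {1..n})"
  have GP: "?G \<subseteq> sets P" using subalgebra_\<A>[OF sub] by (auto simp: subalgebra_def)
  have GF: "sets (\<A> {1..}) \<subseteq> sigma_sets (space P) ?G"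
    unfolding sets_\<A>[of "{1..}"]
  proof (rule sigma_sets_mono, safe)
    fix j A assume "j \<ge> (1::nat)" "A \<in> sets (\<mu> j)"
    then have "X j -` A \<inter> space P \<in> sets (\<A> {1..j})"
      unfolding sets_\<A> by (intro sigma_sets.Basic UN_I[of j]) auto
    then show "X j -` A \<inter> space P \<in> sigma_sets (space P) ?G" by (auto intro!: sigma_sets.Basic)
  qed
  have "AE w in P. CE {1..} F w = G w"
  proof (rule I.real_cond_exp_charact)
    show "integrable P F" "integrable P G" using F G H_integrable by auto
    show "G \<in> borel_measurable (\<A> {1..})" using G by (simp add: H_iff)
    fix A assume A: "A \<in> sets (\<A> {1..})"
    show "(\<integral>x\<in>A. F x \<partial>P) = (\<integral>x\<in>A. G x \<partial>P)"
    proof (rule set_integral_eq_on_sigma_sets[where G="?G"])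
      show "integrable P F" "integrable P G" using F G H_integrable by auto
      show "Int_stable ?G"
      proof (rule Int_stableI)
        fix a b assume "a \<in> ?G" "b \<in> ?G"
        then obtain m n where "a \<in> sets (\<A> {1..m})" "b \<in> sets (\<A> {1..n})" by auto
        then have "a \<in> sets (\<A> {1..max m n})" "b \<in> sets (\<A> {1..max m n})"
          using sets_\<A>_mono[of "{1..m}" "{1..max m n}"] sets_\<A>_mono[of "{1..n}" "{1..max m n}"] by auto
        then show "a \<inter> b \<in> ?G" by blast
      qed
      show "?G \<subseteq> sets P" by (rule GP)
      show "space P \<in> ?G" using sets.top[of "\<A> {1..0}"] unfolding space_\<A> by blast
      show "A \<in> sigma_sets (space P) ?G" using A GF by auto
      fix B assume "B \<in> ?G"
      then obtain n where n: "B \<in> sets (\<A> {1..n})" by auto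
      have BP: "B \<in> sets P" using \<open>B \<in> ?G\<close> GP by auto
      have Bm: "B \<in> sets (\<A> {1..m})" if "m \<ge> n" for m
        using n sets_\<A>_mono[of "{1..n}" "{1..m}"] that by auto
      have B1: "B \<in> sets (\<A> {1..})" using n sets_\<A>_mono[of "{1..n}" "{1..}"] by auto
      have "(\<lambda>w. (indicator B w :: real)\<^sup>2) = indicator B" by (auto simp: indicator_def)
      then have iB: "(indicator B :: 'w \<Rightarrow> real) \<in> H"
        using B1 BP by (auto simp: H_iff integrable_real_indicator emeasure_eq_measure)
      have eq: "(\<integral>w. indicator B w * ?C m w \<partial>P) = (\<integral>w. indicator B w * F w \<partial>P)" if "m \<ge> n" for m
        by (rule CE_ip[OF sub F iB]) (use Bm[OF that] in simp)
      have "(\<lambda>m. \<integral>w. indicator B w * ?C m w \<partial>P) \<longlonglongrightarrow> (\<integral>w. indicator B w * G w \<partial>P)"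
        by (intro L2_tendsto_integral_mult H_L2 C G iB lim)
      moreover have "\<forall>\<^sub>F m in sequentially. (\<integral>w. indicator B w * ?C m w \<partial>P) = (\<integral>w. indicator B w * F w \<partial>P)"
        using eventually_ge_at_top[of n] by eventually_elim (rule eq)
      ultimately have "(\<lambda>m::nat. \<integral>w. indicator B w * F w \<partial>P) \<longlonglongrightarrow> (\<integral>w. indicator B w * G w \<partial>P)"
        by (rule Lim_transform_eventually)
      then show "(\<integral>w\<in>B. F w \<partial>P) = (\<integral>w\<in>B. G w \<partial>P)"
        by (simp add: LIMSEQ_const_iff set_lebesgue_integral_def)
    qed
  qed
  moreover have "AE w in P. CE {1..} F w = F w"
    by (rule CE_id) (use F in \<open>auto simp: H_iff\<close>)
  ultimately have FG: "AE w in P. F w = G w" by eventually_elim simp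
  have "sqn (\<lambda>w. F w - ?C n w) = sqn (\<lambda>w. ?C n w - G w)" for n
  proof -
    have "sqn (\<lambda>w. F w - ?C n w) = sqn (\<lambda>w. ?C n w - F w)" by (simp add: power2_commute)
    also have "\<dots> = sqn (\<lambda>w. ?C n w - G w)"
    proof (rule sqn_cong[OF _ H_diff[OF C F] H_diff[OF C G]])
      show "AE w in P. ?C n w - F w = ?C n w - G w"
        using FG by eventually_elim simp
    qed
    finally show ?thesis .
  qed
  then show ?thesis using lim by simp
qed

text \<open>The sets \<open>Pow {1..n}\<close> are cofinal among the finite subsets of
  \<open>Pfin\<close>, so an unordered sum can be evaluated along this sequence.\<close>

lemma filterlim_Pow_atLeastAtMost: "filterlim (\<lambda>n. Pow {1..n}) (finite_subsets_at_top Pfin) sequentially"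
  unfolding filterlim_iff
proof (intro allI impI)
  fix R :: "nat set set \<Rightarrow> bool" assume "eventually R (finite_subsets_at_top Pfin)"
  then obtain Y where Y: "finite Y" "Y \<subseteq> Pfin" "\<And>Z. finite Z \<and> Y \<subseteq> Z \<and> Z \<subseteq> Pfin \<Longrightarrow> R Z"
    unfolding eventually_finite_subsets_at_top by blast
  have "finite (\<Union>Y)" using Y by (auto simp: Pfin_def)
  then obtain n0 where n0: "\<Union>Y \<subseteq> {..n0}" by (auto simp: finite_nat_iff_bounded_le)
  have "R (Pow {1..n})" if "n \<ge> n0" for n
  proof (rule Y(3), intro conjI)
    show "Pow {1..n} \<subseteq> Pfin" by (auto simp: Pfin_def intro: finite_subset)
    show "Y \<subseteq> Pow {1..n}" using n0 that Y(2) by (fastforce simp: Pfin_def)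
  qed simp
  then show "\<forall>\<^sub>F n in sequentially. R (Pow {1..n})" by (auto simp: eventually_sequentially)
qed

text \<open>Bessel's inequality gives summability: a finite \<open>Y\<close> lies in
  \<open>Pow (\<Union>Y)\<close>, whose components add up to a conditional expectation. The value is
  read off along \<open>Pow {1..n}\<close>, where the defect is the squared distance from
  \<open>F\<close> to \<open>CE {1..n} F\<close>.\<close>

theorem parseval:
  assumes F: "F \<in> H"
  shows "((\<lambda>M. sqn (T M F)) has_sum sqn F) Pfin"
proof -
  have "(\<lambda>M. sqn (T M F)) summable_on Pfin"
  proof (rule nonneg_bounded_partial_sums_imp_summable_on[where C="sqn F"])
    have "(\<Sum>M\<in>Y. sqn (T M F)) \<le> sqn F" if Y: "finite Y" "Y \<subseteq> Pfin" for Y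
    proof -
      have U: "\<Union>Y \<in> Pfin" using Y by (auto simp: Pfin_def)
      have "(\<Sum>M\<in>Y. sqn (T M F)) \<le> (\<Sum>M\<in>Pow (\<Union>Y). sqn (T M F))"
        using Pfin_finite[OF U] by (intro sum_mono2) auto
      also have "\<dots> = sqn (CE (\<Union>Y) F)" by (rule sqn_CE[symmetric, OF U F])
      also have "\<dots> \<le> sqn F" by (rule sqn_CE_le[OF Pfin_subset[OF U] F])
      finally show ?thesis .
    qed
    then show "\<forall>\<^sub>F Y in finite_subsets_at_top Pfin. (\<Sum>M\<in>Y. sqn (T M F)) \<le> sqn F"
      by (intro eventually_finite_subsets_at_top_weakI) auto
  qed auto
  then obtain S where S: "((\<lambda>M. sqn (T M F)) has_sum S) Pfin" by (auto simp: summable_on_def)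
  have "(\<lambda>n. \<Sum>M\<in>Pow {1..n}. sqn (T M F)) \<longlonglongrightarrow> S"
    using S filterlim_Pow_atLeastAtMost unfolding has_sum_def by (rule filterlim_compose)
  moreover have "(\<Sum>M\<in>Pow {1..n}. sqn (T M F)) = sqn F - sqn (\<lambda>w. F w - CE {1..n} F w)" for n
    using sqn_CE[OF atLeastAtMost_Pfin F, of n] sqn_diff_CE[OF Pfin_subset[OF atLeastAtMost_Pfin] F, of n]
    by simp
  moreover have "(\<lambda>n. sqn F - sqn (\<lambda>w. F w - CE {1..n} F w)) \<longlonglongrightarrow> sqn F - 0"
    by (intro tendsto_diff tendsto_const CE_atLeastAtMost_tendsto[OF F])
  ultimately have "S = sqn F" using LIMSEQ_unique by auto
  then show ?thesis using S by simp
qed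


subsection \<open>Multipliers\<close>

text \<open>A relation rather than an operator: for unbounded \<open>c\<close> an image need not
  exist, and an image is unique only up to null sets.\<close>

definition multiplier :: "(nat set \<Rightarrow> real) \<Rightarrow> ('w \<Rightarrow> real) \<Rightarrow> ('w \<Rightarrow> real) \<Rightarrow> bool" where
  "multiplier c F G \<longleftrightarrow> G \<in> H \<and> (\<forall>M\<in>Pfin. AE w in P. T M G w = c M * T M F w)"

lemma multiplier_H: "multiplier c F G \<Longrightarrow> G \<in> H"
  by (simp add: multiplier_def)

lemma multiplier_AE: "multiplier c F G \<Longrightarrow> M \<in> Pfin \<Longrightarrow> AE w in P. T M G w = c M * T M F w"
  by (simp add: multiplier_def)

lemma multiplier_cong: "multiplier c F G \<Longrightarrow> (\<And>M. M \<in> Pfin \<Longrightarrow> c M = d M) \<Longrightarrow> multiplier d F G"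
  by (simp add: multiplier_def)

lemma multiplier_refl: "F \<in> H \<Longrightarrow> multiplier (\<lambda>_. 1) F F"
  by (simp add: multiplier_def)

lemma multiplier_cmult: "multiplier c F G \<Longrightarrow> multiplier (\<lambda>M. r * c M) F (\<lambda>w. r * G w)"
  unfolding multiplier_def
proof (intro conjI ballI)
  fix M assume *: "G \<in> H \<and> (\<forall>M\<in>Pfin. AE w in P. T M G w = c M * T M F w)" and M: "M \<in> Pfin"
  then have 1: "AE w in P. T M G w = c M * T M F w" and G: "G \<in> H" by auto
  show "AE w in P. T M (\<lambda>w. r * G w) w = r * c M * T M F w"
    using 1 T_cmult[OF M G, of r] by eventually_elim simp
qed (auto intro: H_cmult)

lemma multiplier_add:
  assumes "multiplier c F G" "multiplier d F K"
  shows "multiplier (\<lambda>M. c M + d M) F (\<lambda>w. G w + K w)"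
  unfolding multiplier_def
proof (intro conjI ballI)
  fix M assume M: "M \<in> Pfin"
  show "AE w in P. T M (\<lambda>w. G w + K w) w = (c M + d M) * T M F w"
    using multiplier_AE[OF assms(1) M] multiplier_AE[OF assms(2) M]
      T_add[OF M multiplier_H[OF assms(1)] multiplier_H[OF assms(2)]]
    by eventually_elim (simp add: distrib_right)
qed (intro H_add multiplier_H[OF assms(1)] multiplier_H[OF assms(2)])

lemma multiplier_diff:
  assumes "multiplier c F G" "multiplier d F K"
  shows "multiplier (\<lambda>M. c M - d M) F (\<lambda>w. G w - K w)"
  using multiplier_add[OF assms(1) multiplier_cmult[OF assms(2), of "-1"]] by simp

lemma multiplier_zero: "F \<in> H \<Longrightarrow> multiplier (\<lambda>_. 0) F (\<lambda>_. 0)"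
  using multiplier_cmult[OF multiplier_refl, of F 0] by simp

lemma multiplier_sum:
  assumes F: "F \<in> H" and I: "finite I" and G: "\<And>i. i \<in> I \<Longrightarrow> multiplier (c i) F (G i)"
  shows "multiplier (\<lambda>M. \<Sum>i\<in>I. c i M) F (\<lambda>w. \<Sum>i\<in>I. G i w)"
  using I G
  by (induction I rule: finite_induct) (auto intro: multiplier_zero[OF F] multiplier_add)

lemma multiplier_CE:
  assumes N: "N \<subseteq> {1..}" and F: "F \<in> H"
  shows "multiplier (\<lambda>M. of_bool (M \<subseteq> N)) F (CE N F)"
  unfolding multiplier_def
proof (intro conjI ballI CE_H[OF N F])
  fix M assume M: "M \<in> Pfin"
  show "AE w in P. T M (CE N F) w = of_bool (M \<subseteq> N) * T M F w"
    using T_CE[OF N M F] by eventually_elim simp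
qed

text \<open>Conditioning on all variables but \<open>X k\<close> keeps exactly the components with
  \<open>k \<notin> M\<close>, and \<open>D_comp\<close> subtracts these from
  \<open>F\<close>.\<close>

lemma multiplier_D_comp:
  assumes F: "F \<in> H"
  shows "multiplier (\<lambda>M. of_bool (k \<in> M)) F (D_comp P \<mu> X k F)"
proof -
  have "multiplier (\<lambda>M. 1 - of_bool (M \<subseteq> {1..} - {k})) F (\<lambda>w. F w - CE ({1..} - {k}) F w)"
    by (rule multiplier_diff[OF multiplier_refl[OF F] multiplier_CE[OF _ F]]) auto
  then have "multiplier (\<lambda>M. of_bool (k \<in> M)) F (\<lambda>w. F w - CE ({1..} - {k}) F w)"
    by (rule multiplier_cong) (auto simp: Pfin_def)
  moreover have "D_comp P \<mu> X k F = (\<lambda>w. F w - CE ({1..} - {k}) F w)"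
    by (simp add: fun_eq_iff D_comp_def)
  ultimately show ?thesis by simp
qed

lemma multiplier_sum_D_comp:
  assumes F: "F \<in> H"
  shows "multiplier (\<lambda>M. real (card (M \<inter> {1..m}))) F (\<lambda>w. \<Sum>k=1..m. D_comp P \<mu> X k F w)"
proof -
  have "multiplier (\<lambda>M. \<Sum>k=1..m. of_bool (k \<in> M)) F (\<lambda>w. \<Sum>k=1..m. D_comp P \<mu> X k F w)"
    by (rule multiplier_sum[OF F]) (auto intro: multiplier_D_comp[OF F])
  then show ?thesis
    by (rule multiplier_cong) (simp add: Int_commute Int_def)
qed

lemma multiplier_T:
  assumes N: "N \<in> Pfin" and F: "F \<in> H"
  shows "multiplier (\<lambda>M. of_bool (M = N)) F (T N F)"
proof -
  have fin: "finite N" by (rule Pfin_finite[OF N])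
  have "multiplier (\<lambda>M. \<Sum>L\<in>Pow N. (- 1) ^ (card N - card L) * of_bool (M \<subseteq> L)) F (T N F)"
    unfolding T_CE_sum
    by (rule multiplier_sum[OF F]) (use N fin in \<open>auto simp: Pfin_def intro!: multiplier_cmult multiplier_CE F\<close>)
  moreover have "(\<Sum>L\<in>Pow N. (- 1) ^ (card N - card L) * of_bool (M \<subseteq> L)) = (of_bool (M = N) :: real)" for M
  proof (cases "N \<subseteq> M")
    \<comment> \<open>Here the only subset of \<open>N\<close> that can contain \<open>M\<close> is
      \<open>N\<close> itself.\<close>
    case True
    then have "(\<Sum>L\<in>Pow N. (- 1) ^ (card N - card L) * of_bool (M \<subseteq> L)) =
        (\<Sum>L\<in>Pow N. if L = N then of_bool (M = N) else (0::real))"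
      by (intro sum.cong) auto
    then show ?thesis using fin by simp
  next
    case False
    then obtain j where j: "j \<in> N" "j \<notin> M" by auto
    have "(\<Sum>L\<in>Pow N. (- 1) ^ (card N - card L) * of_bool (M \<subseteq> L)) = (0::real)"
      by (rule sum_Pow_alternating_eq_0[OF fin j(1)]) (use j(2) in auto)
    then show ?thesis using False by auto
  qed
  ultimately show ?thesis by simp
qed

lemma multiplier_trans:
  assumes "multiplier c F G" "multiplier d G K"
  shows "multiplier (\<lambda>M. d M * c M) F K"
  unfolding multiplier_def
proof (intro conjI ballI multiplier_H[OF assms(2)])
  fix M assume M: "M \<in> Pfin"
  show "AE w in P. T M K w = d M * c M * T M F w"
    using multiplier_AE[OF assms(1) M] multiplier_AE[OF assms(2) M] by eventually_elim simp
qed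

lemma sqn_T_multiplier:
  assumes F: "F \<in> H" and G: "multiplier c F G" and M: "M \<in> Pfin"
  shows "sqn (T M G) = (c M)\<^sup>2 * sqn (T M F)"
proof -
  have "sqn (T M G) = sqn (\<lambda>w. c M * T M F w)"
    by (rule sqn_cong[OF multiplier_AE[OF G M]]) (intro T_H H_cmult M F multiplier_H[OF G])+
  then show ?thesis by (simp add: power_mult_distrib)
qed

lemma sqn_multiplier:
  assumes F: "F \<in> H" and G: "multiplier c F G"
  shows "((\<lambda>M. (c M)\<^sup>2 * sqn (T M F)) has_sum sqn G) Pfin"
  using parseval[OF multiplier_H[OF G]] sqn_T_multiplier[OF F G] by (simp cong: has_sum_cong)

text \<open>The difference has all coefficients zero, so its norm vanishes by Parseval. Later
  identities between functions are reduced by this to a comparison of coefficients.\<close>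

lemma multiplier_unique:
  assumes F: "F \<in> H" and G: "multiplier c F G" "multiplier c F K"
  shows "AE w in P. G w = K w"
proof -
  have "((\<lambda>M. (c M - c M)\<^sup>2 * sqn (T M F)) has_sum sqn (\<lambda>w. G w - K w)) Pfin"
    by (rule sqn_multiplier[OF F multiplier_diff[OF G]])
  then have "sqn (\<lambda>w. G w - K w) = 0" by (auto dest: infsumI)
  from sqn_eq_0[OF H_diff[OF multiplier_H[OF G(1)] multiplier_H[OF G(2)]] this]
  show ?thesis by simp
qed

lemma multiplier_AE_cong:
  assumes G: "multiplier c F G" and GK: "AE w in P. G w = K w" and K: "K \<in> H"
  shows "multiplier c F K"
  unfolding multiplier_def
proof (intro conjI ballI K)
  fix M assume M: "M \<in> Pfin"
  show "AE w in P. T M K w = c M * T M F w"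
    using multiplier_AE[OF G M] T_cong[OF M multiplier_H[OF G] K GK] by eventually_elim simp
qed

text \<open>Parseval turns the error into the sum of
  \<open>(c i M - d M)\<^sup>2 * sqn (T M F)\<close>, and the bound by
  \<open>\<bar>d M\<bar>\<close> supplies a summable majorant. Truncations, where
  \<open>c i M\<close> is \<open>0\<close> or \<open>d M\<close>, and increasing counts satisfy this
  bound.\<close>

lemma multiplier_converges:
  assumes F: "F \<in> H" and G: "multiplier d F G"
    and Gi: "\<forall>\<^sub>F i in Fl. multiplier (c i) F (Gi i) \<and> (\<forall>M\<in>Pfin. \<bar>c i M - d M\<bar> \<le> \<bar>d M\<bar>)"
    and lim: "\<And>M. M \<in> Pfin \<Longrightarrow> ((\<lambda>i. c i M) \<longlongrightarrow> d M) Fl"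
  shows "L2_converges Q Gi G Fl"
  unfolding L2_converges_iff H_L2Q
proof (intro conjI multiplier_H[OF G])
  show "\<forall>\<^sub>F i in Fl. Gi i \<in> H" using Gi by eventually_elim (auto dest: multiplier_H)
  have "((\<lambda>i. sqn (\<lambda>w. Gi i w - G w)) \<longlongrightarrow> 0) Fl"
  proof (rule tannery_has_sum)
    show "(\<lambda>M. (d M)\<^sup>2 * sqn (T M F)) summable_on Pfin"
      using sqn_multiplier[OF F G] by (auto simp: summable_on_def)
    show "\<forall>\<^sub>F i in Fl. ((\<lambda>M. (c i M - d M)\<^sup>2 * sqn (T M F)) has_sum sqn (\<lambda>w. Gi i w - G w)) Pfin \<and>
        (\<forall>M\<in>Pfin. \<bar>(c i M - d M)\<^sup>2 * sqn (T M F)\<bar> \<le> (d M)\<^sup>2 * sqn (T M F))"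
      using Gi
    proof eventually_elim
      case (elim i)
      then show ?case
        using sqn_multiplier[OF F multiplier_diff[OF conjunct1[OF elim] G]]
        by (auto simp: abs_mult intro!: mult_right_mono simp flip: abs_le_square_iff)
    qed
    fix M assume "M \<in> Pfin"
    then have "((\<lambda>i. (c i M - d M)\<^sup>2 * sqn (T M F)) \<longlongrightarrow> (d M - d M)\<^sup>2 * sqn (T M F)) Fl"
      by (intro tendsto_intros lim)
    then show "((\<lambda>i. (c i M - d M)\<^sup>2 * sqn (T M F)) \<longlongrightarrow> 0) Fl" by simp
  qed
  moreover have "\<forall>\<^sub>F i in Fl. sqn (\<lambda>w. Gi i w - G w) = (\<integral>w. (Gi i w - G w)\<^sup>2 \<partial>Q)"
    using Gi
  proof eventually_elim
    case (elim i)
    then show ?case by (intro sqn_Q[symmetric] H_diff multiplier_H[OF G]) (auto dest: multiplier_H)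
  qed
  ultimately show "((\<lambda>i. \<integral>w. (Gi i w - G w)\<^sup>2 \<partial>Q) \<longlongrightarrow> 0) Fl"
    by (rule Lim_transform_eventually)
qed

lemma sqn_T_le: "M \<in> Pfin \<Longrightarrow> F \<in> H \<Longrightarrow> sqn (T M F) \<le> sqn F"
  using has_sum_mono2[OF has_sum_finite[of "{M}"] parseval[of F]] by (simp add: has_sum_finite)

text \<open>Norm convergence passes to every component, because \<open>T M\<close> is a contraction
  by Parseval; the coefficients can thus be identified one \<open>M\<close> at a time.\<close>

lemma multiplier_closed:
  assumes F: "F \<in> H" and Fl: "Fl \<noteq> bot"
    and Gi: "\<forall>\<^sub>F i in Fl. multiplier (c i) F (Gi i)"
    and conv: "L2_converges Q Gi G Fl"
    and lim: "\<And>M. M \<in> Pfin \<Longrightarrow> ((\<lambda>i. c i M) \<longlongrightarrow> d M) Fl"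
  shows "multiplier d F G"
  unfolding multiplier_def
proof (intro conjI ballI)
  show G: "G \<in> H" using conv by (simp add: L2_converges_def H_L2Q)
  fix M assume M: "M \<in> Pfin"
  \<comment> \<open>The component of \<open>Gi i\<close>, which is \<open>c i M * T M F\<close>,
    serves as the intermediate point between \<open>T M G\<close> and \<open>d M * T M F\<close>;
    the factors 2 come from squaring the triangle inequality.\<close>
  define r where "r i = 2 * (\<integral>w. (Gi i w - G w)\<^sup>2 \<partial>Q) + 2 * ((c i M - d M)\<^sup>2 * sqn (T M F))" for i
  have "(r \<longlongrightarrow> 2 * 0 + 2 * ((d M - d M)\<^sup>2 * sqn (T M F))) Fl"
    unfolding r_def
    by (intro tendsto_intros lim[OF M]) (use conv in \<open>auto simp: L2_converges_iff\<close>)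
  then have r: "(r \<longlongrightarrow> 0) Fl" by simp
  let ?h = "\<lambda>w. T M G w - d M * T M F w"
  have h: "?h \<in> H" by (intro H_diff H_cmult T_H M F G)
  have "\<forall>\<^sub>F i in Fl. sqn ?h \<le> r i"
    using Gi
  proof eventually_elim
    case (elim i)
    have GiH: "Gi i \<in> H" by (rule multiplier_H[OF elim])
    let ?e = "\<lambda>w. Gi i w - G w"
    have e: "?e \<in> H" by (intro H_diff GiH G)
    have ae: "AE w in P. (?h w)\<^sup>2 \<le> 2 * (T M ?e w)\<^sup>2 + 2 * ((c i M - d M)\<^sup>2 * (T M F w)\<^sup>2)"
      using multiplier_AE[OF elim M] T_diff[OF M GiH G]
    proof eventually_elim
      case (elim w)
      have "(?h w)\<^sup>2 \<le> 2 * (T M G w - c i M * T M F w)\<^sup>2 + 2 * (c i M * T M F w - d M * T M F w)\<^sup>2"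
        by (rule power2_diff_le)
      also have "\<dots> = 2 * (T M ?e w)\<^sup>2 + 2 * ((c i M - d M)\<^sup>2 * (T M F w)\<^sup>2)"
        unfolding elim by (simp add: power2_eq_square algebra_simps)
      finally show ?case .
    qed
    have "sqn ?h \<le> (\<integral>w. 2 * (T M ?e w)\<^sup>2 + 2 * ((c i M - d M)\<^sup>2 * (T M F w)\<^sup>2) \<partial>P)"
      by (rule integral_mono_AE[OF _ _ ae])
         (use H_sq[OF h] H_sq[OF T_H[OF M e]] H_sq[OF T_H[OF M F]] in auto)
    also have "\<dots> = 2 * sqn (T M ?e) + 2 * ((c i M - d M)\<^sup>2 * sqn (T M F))"
      using H_sq[OF T_H[OF M e]] H_sq[OF T_H[OF M F]] by simp
    also have "\<dots> \<le> r i"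
      using sqn_T_le[OF M e] by (simp add: r_def sqn_Q[OF e])
    finally show ?case .
  qed
  then have "sqn ?h \<le> 0" by (rule tendsto_lowerbound[OF r _ Fl])
  moreover have "0 \<le> sqn ?h" by simp
  ultimately have "sqn ?h = 0" by linarith
  from sqn_eq_0[OF h this] show "AE w in P. T M G w = d M * T M F w" by simp
qed

lemma multiplier_partial_sum:
  assumes F: "F \<in> H" and A: "finite A" "A \<subseteq> Pfin"
  shows "multiplier (\<lambda>M. c M * of_bool (M \<in> A)) F (\<lambda>w. \<Sum>M\<in>A. c M * T M F w)"
proof -
  have "multiplier (\<lambda>M. \<Sum>N\<in>A. c N * of_bool (M = N)) F (\<lambda>w. \<Sum>M\<in>A. c M * T M F w)"
    by (rule multiplier_sum[OF F A(1)]) (use A in \<open>auto intro!: multiplier_cmult multiplier_T F\<close>)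
  moreover have "(\<Sum>N\<in>A. c N * of_bool (M = N)) = c M * of_bool (M \<in> A)" for M
  proof -
    have "(\<Sum>N\<in>A. c N * of_bool (M = N)) = (\<Sum>N\<in>A. if M = N then c M else 0)"
      by (intro sum.cong) auto
    then show ?thesis using A(1) by simp
  qed
  ultimately show ?thesis by simp
qed

lemma eventually_subset_atLeastAtMost:
  assumes "M \<in> Pfin"
  shows "\<forall>\<^sub>F n in sequentially. M \<subseteq> {1..n}"
proof -
  obtain n0 where "M \<subseteq> {..n0}" using Pfin_finite[OF assms] by (auto simp: finite_nat_iff_bounded_le)
  then have "M \<subseteq> {1..n}" if "n \<ge> n0" for n
    using Pfin_subset[OF assms] that by fastforce
  then show ?thesis by (auto simp: eventually_sequentially)
qed

text \<open>The truncations to \<open>Pow {1..n}\<close> form a Cauchy sequence because the given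
  series has small tails, and closedness identifies the coefficients of their limit.\<close>

theorem multiplier_exists:
  assumes F: "F \<in> H" and sum: "(\<lambda>M. (c M)\<^sup>2 * sqn (T M F)) summable_on Pfin"
  shows "\<exists>G. multiplier c F G"
proof -
  define G where "G n w = (\<Sum>M\<in>Pow {1..n}. c M * T M F w)" for n :: nat and w
  have G: "multiplier (\<lambda>M. c M * of_bool (M \<in> Pow {1..n})) F (G n)" for n
    unfolding G_def by (rule multiplier_partial_sum[OF F]) (auto simp: Pfin_def intro: finite_subset)
  \<comment> \<open>The tail of the series, over all \<open>M\<close> not contained in
    \<open>{1..n}\<close>. It tends to zero by dominated convergence, since each \<open>M\<close> is
    eventually contained.\<close>
  define r where "r n = (\<Sum>\<^sub>\<infinity>M\<in>Pfin. (c M)\<^sup>2 * sqn (T M F) * of_bool (\<not> M \<subseteq> {1..n}))" for n :: nat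
  have r_sum: "((\<lambda>M. (c M)\<^sup>2 * sqn (T M F) * of_bool (\<not> M \<subseteq> {1..n})) has_sum r n) Pfin" for n
    unfolding r_def
    by (intro has_sum_infsum summable_on_comparison_test[OF sum]) auto
  have r: "r \<longlonglongrightarrow> 0"
  proof (rule tannery_has_sum[OF sum])
    show "\<forall>\<^sub>F n in sequentially.
        ((\<lambda>M. (c M)\<^sup>2 * sqn (T M F) * of_bool (\<not> M \<subseteq> {1..n})) has_sum r n) Pfin \<and>
        (\<forall>M\<in>Pfin. \<bar>(c M)\<^sup>2 * sqn (T M F) * of_bool (\<not> M \<subseteq> {1..n})\<bar> \<le> (c M)\<^sup>2 * sqn (T M F))"
      by (intro always_eventually allI conjI r_sum ballI) (simp add: abs_mult)
    fix M assume "M \<in> Pfin"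
    from eventually_subset_atLeastAtMost[OF this]
    show "(\<lambda>n. (c M)\<^sup>2 * sqn (T M F) * of_bool (\<not> M \<subseteq> {1..n})) \<longlonglongrightarrow> 0"
      by (intro tendsto_eventually) (auto elim!: eventually_mono)
  qed
  \<comment> \<open>Both truncations keep every \<open>M \<subseteq> {1..N}\<close>, so such
    \<open>M\<close> cancel in the difference.\<close>
  have le: "sqn (\<lambda>w. G m w - G n w) \<le> r N" if "m \<ge> N" "n \<ge> N" for m n N
  proof (rule has_sum_mono[OF sqn_multiplier[OF F multiplier_diff[OF G G]] r_sum])
    fix M assume "M \<in> Pfin"
    have *: "(c M * of_bool (M \<in> Pow {1..m}) - c M * of_bool (M \<in> Pow {1..n}))\<^sup>2
        \<le> (c M)\<^sup>2 * of_bool (\<not> M \<subseteq> {1..N})"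
      using that by (auto simp: of_bool_def)
    then show "(c M * of_bool (M \<in> Pow {1..m}) - c M * of_bool (M \<in> Pow {1..n}))\<^sup>2 * sqn (T M F)
        \<le> (c M)\<^sup>2 * sqn (T M F) * of_bool (\<not> M \<subseteq> {1..N})"
      using mult_right_mono[OF *, of "sqn (T M F)"] by (simp only: mult_ac Bochner_Integration.integral_nonneg zero_le_power2)
  qed
  have "\<exists>K. L2_converges Q G K sequentially"
  proof (rule L2_complete)
    show "G n \<in> L2 Q" for n using multiplier_H[OF G] by (simp add: H_L2Q)
    fix e :: real assume "e > 0"
    then obtain N where "r N < e"
      using order_tendstoD(2)[OF r] by (auto simp: eventually_sequentially)
    then have "\<forall>m\<ge>N. \<forall>n\<ge>N. (\<integral>w. (G m w - G n w)\<^sup>2 \<partial>Q) < e"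
      using le[of N] by (auto simp: sqn_Q[OF H_diff[OF multiplier_H[OF G] multiplier_H[OF G]]] intro: order_le_less_trans)
    then show "\<exists>N. \<forall>m\<ge>N. \<forall>n\<ge>N. (\<integral>w. (G m w - G n w)\<^sup>2 \<partial>Q) < e" ..
  qed
  then obtain K where K: "L2_converges Q G K sequentially" ..
  have "multiplier c F K"
  proof (rule multiplier_closed[OF F _ _ K])
    fix M assume "M \<in> Pfin"
    from eventually_subset_atLeastAtMost[OF this]
    show "(\<lambda>n. c M * of_bool (M \<in> Pow {1..n})) \<longlonglongrightarrow> c M"
      by (intro tendsto_eventually) (auto elim!: eventually_mono)
  qed (use G in auto)
  then show ?thesis by blast
qed

section \<open>Unordered series of Hoeffding components\<close>

lemma tendsto_of_bool_finite_subsets: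
  "x \<in> I \<Longrightarrow> ((\<lambda>A. of_bool (x \<in> A) :: real) \<longlongrightarrow> 1) (finite_subsets_at_top I)"
  by (intro tendsto_eventually eventually_finite_subsets_at_top[THEN iffD2] exI[of _ "{x}"]) auto

lemma eventually_finite_subsets_finite_subset:
  "\<forall>\<^sub>F A in finite_subsets_at_top I. finite A \<and> A \<subseteq> I"
  by (intro eventually_finite_subsets_at_top_weakI) auto

lemma tendsto_mult_of_bool_finite_subsets:
  fixes c :: "'a \<Rightarrow> real"
  shows "((\<lambda>A. c M * of_bool (M \<in> A)) \<longlongrightarrow> c M * of_bool (M \<in> I)) (finite_subsets_at_top I)"
proof (cases "M \<in> I")
  case True
  then show ?thesis using tendsto_mult_left[OF tendsto_of_bool_finite_subsets[OF True], of "c M"] by simp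
next
  case False
  have "\<forall>\<^sub>F A in finite_subsets_at_top I. c M * of_bool (M \<in> A) = 0"
    using eventually_finite_subsets_finite_subset by eventually_elim (use False in auto)
  then show ?thesis using False by (simp add: tendsto_eventually)
qed

lemma multiplier_L2_has_sum:
  assumes F: "F \<in> H" and I: "I \<subseteq> Pfin" and G: "multiplier (\<lambda>M. c M * of_bool (M \<in> I)) F G"
  shows "L2_has_sum Q (\<lambda>M w. c M * T M F w) I G"
  unfolding L2_has_sum_def
proof (rule multiplier_converges[OF F G])
  show "\<forall>\<^sub>F A in finite_subsets_at_top I.
      multiplier (\<lambda>M. c M * of_bool (M \<in> A)) F (\<lambda>w. \<Sum>M\<in>A. c M * T M F w) \<and>
      (\<forall>M\<in>Pfin. \<bar>c M * of_bool (M \<in> A) - c M * of_bool (M \<in> I)\<bar> \<le> \<bar>c M * of_bool (M \<in> I)\<bar>)"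
    using eventually_finite_subsets_finite_subset
  proof eventually_elim
    case (elim A)
    then show ?case using multiplier_partial_sum[OF F, of A c] I by (auto simp: of_bool_def)
  qed
qed (rule tendsto_mult_of_bool_finite_subsets)

text \<open>Closedness of the multiplier relation along the net of finite subsets. It covers an
  arbitrary limit of the series, as \<open>J\<close> is one that \<open>SOME\<close>
  selects.\<close>

lemma L2_has_sum_multiplier:
  assumes F: "F \<in> H" and I: "I \<subseteq> Pfin" and G: "L2_has_sum Q (\<lambda>M w. c M * T M F w) I G"
  shows "multiplier (\<lambda>M. c M * of_bool (M \<in> I)) F G"
proof (rule multiplier_closed[OF F _ _ G[unfolded L2_has_sum_def]])
  show "finite_subsets_at_top I \<noteq> bot" by simp
  show "\<forall>\<^sub>F A in finite_subsets_at_top I.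
      multiplier (\<lambda>M. c M * of_bool (M \<in> A)) F (\<lambda>w. \<Sum>M\<in>A. c M * T M F w)"
    using eventually_finite_subsets_finite_subset
    by eventually_elim (use multiplier_partial_sum[OF F] I in auto)
qed (rule tendsto_mult_of_bool_finite_subsets)

text \<open>The coefficients are bounded by 1, so an image exists and the series has a sum; hence
  the choice in \<open>J_def\<close> meets its specification, and every sum has the same
  coefficients.\<close>

lemma multiplier_J:
  assumes F: "F \<in> H"
  shows "multiplier (\<lambda>M. of_bool (card M = p)) F (J P \<mu> X p F)"
proof -
  let ?I = "{M \<in> Pfin. card M = p}"
  have "(\<lambda>M. (of_bool (card M = p))\<^sup>2 * sqn (T M F)) summable_on Pfin"
    by (rule summable_on_comparison_test[OF has_sum_imp_summable[OF parseval[OF F]]]) auto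
  from multiplier_exists[OF F this] obtain G where "multiplier (\<lambda>M. of_bool (card M = p)) F G" ..
  then have "multiplier (\<lambda>M. 1 * of_bool (M \<in> ?I)) F G" by (rule multiplier_cong) auto
  from multiplier_L2_has_sum[OF F _ this] have "L2_has_sum Q (hoeffding P \<mu> X F) ?I G" by simp
  then have "L2_has_sum Q (hoeffding P \<mu> X F) ?I (J P \<mu> X p F)" 
    unfolding J_def by (rule someI[where P="L2_has_sum Q (hoeffding P \<mu> X F) ?I"])
  then have "multiplier (\<lambda>M. 1 * of_bool (M \<in> ?I)) F (J P \<mu> X p F)"
    by (intro L2_has_sum_multiplier[OF F]) auto
  then show ?thesis by (rule multiplier_cong) auto
qed

section \<open>The square norm of \<open>DF\<close> and the domain of \<open>D\<close>\<close>

lemma L2_kappa: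
  assumes U: "\<And>k. k \<ge> 1 \<Longrightarrow> (\<lambda>w. U (k, w)) \<in> H"
    and S: "((\<lambda>k. sqn (\<lambda>w. U (k, w))) has_sum S) {1..}"
  shows "U \<in> L2 (kappa_P P \<mu> X)" "(\<integral>z. (U z)\<^sup>2 \<partial>kappa_P P \<mu> X) = S"
proof -
  interpret Q: prob_space Q
    unfolding P_F_def by (rule prob_space_restr_to_subalg[OF subalgebra_\<A>]) (auto intro: prob_space_axioms)
  \<comment> \<open>The index set \<open>{1..}\<close> is countable, so measurability of the
    sections suffices.\<close>
  have [measurable]: "U \<in> borel_measurable (kappa_P P \<mu> X)"
    unfolding kappa_P_def
    by (rule measurable_pair_measure_countable1) (use U in \<open>auto simp: measurable_Q H_iff\<close>)
  have S0: "S \<ge> 0" by (rule has_sum_nonneg[OF S]) simp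
  have "(\<lambda>z. ennreal ((U z)\<^sup>2)) \<in> borel_measurable (kappa_P P \<mu> X)" by measurable
  then have "(\<integral>\<^sup>+z. ennreal ((U z)\<^sup>2) \<partial>kappa_P P \<mu> X) =
      (\<integral>\<^sup>+k. \<integral>\<^sup>+w. ennreal ((U (k, w))\<^sup>2) \<partial>Q \<partial>count_space {1..})"
    unfolding kappa_P_def by (rule Q.nn_integral_fst[symmetric])
  also have "\<dots> = (\<integral>\<^sup>+k. ennreal (sqn (\<lambda>w. U (k, w))) \<partial>count_space {1..})"
  proof (rule nn_integral_cong)
    fix k assume "k \<in> space (count_space {1::nat..})"
    then have k: "(\<lambda>w. U (k, w)) \<in> H" using U by auto
    have "(\<integral>\<^sup>+w. ennreal ((U (k, w))\<^sup>2) \<partial>Q) = ennreal (\<integral>w. (U (k, w))\<^sup>2 \<partial>Q)"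
      by (rule nn_integral_eq_integral) (use k in \<open>auto simp: L2X_def L2_def\<close>)
    then show "(\<integral>\<^sup>+w. ennreal ((U (k, w))\<^sup>2) \<partial>Q) = ennreal (sqn (\<lambda>w. U (k, w)))"
      by (simp add: sqn_Q[OF k])
  qed
  also have "\<dots> = ennreal S" by (rule nn_integral_count_space_has_sum[OF S]) simp
  finally have *: "(\<integral>\<^sup>+z. ennreal ((U z)\<^sup>2) \<partial>kappa_P P \<mu> X) = ennreal S" .
  then have "integrable (kappa_P P \<mu> X) (\<lambda>z. (U z)\<^sup>2)" by (intro integrableI_bounded) auto
  then show "U \<in> L2 (kappa_P P \<mu> X)" by (simp add: L2_def)
  show "(\<integral>z. (U z)\<^sup>2 \<partial>kappa_P P \<mu> X) = S"
    using * S0 by (intro integral_eq_nn_integral[THEN trans]) auto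
qed

text \<open>Double counting of the pairs \<open>k \<in> M\<close> with weight
  \<open>sqn (T M F)\<close>: summing over \<open>k\<close> first gives the factor
  \<open>card M\<close>, summing over \<open>M\<close> first gives
  \<open>sqn (D_comp P \<mu> X k F)\<close> by Parseval. So \<open>S\<close> is the squared norm of
  \<open>DF\<close>.\<close>

lemma has_sum_sqn_D_comp:
  assumes F: "F \<in> H" and S: "((\<lambda>M. real (card M) * sqn (T M F)) has_sum S) Pfin"
  shows "((\<lambda>k. sqn (D_comp P \<mu> X k F)) has_sum S) {1..}"
proof -
  let ?f = "\<lambda>(M, k). of_bool (k \<in> M) * sqn (T M F)"
  have 1: "((\<lambda>k. ?f (M, k)) has_sum real (card M) * sqn (T M F)) {1..}" if M: "M \<in> Pfin" for M
  proof -
    have "((\<lambda>k. ?f (M, k)) has_sum (\<Sum>k\<in>M. ?f (M, k))) M"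
      by (rule has_sum_finite[OF Pfin_finite[OF M]])
    then have "((\<lambda>k. ?f (M, k)) has_sum (\<Sum>k\<in>M. ?f (M, k))) {1..}"
      by (rule has_sum_cong_neutral[THEN iffD1, rotated -1]) (use Pfin_subset[OF M] in auto)
    then show ?thesis by simp
  qed
  have "?f summable_on Pfin \<times> {1..}"
    by (rule summable_on_SigmaI[OF 1]) (use S in \<open>auto simp: summable_on_def\<close>)
  with 1 S have "(?f has_sum S) (Pfin \<times> {1..})" by (intro has_sum_SigmaI) auto
  then have sw: "((\<lambda>(k, M). of_bool (k \<in> M) * sqn (T M F)) has_sum S) ({1..} \<times> Pfin)"
    by (subst has_sum_swap) (simp add: case_prod_unfold)
  show ?thesis
  proof (rule has_sum_SigmaD[OF sw])
    fix k :: nat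
    have sq: "(of_bool b :: real)\<^sup>2 = of_bool b" for b by simp
    show "((\<lambda>M. (\<lambda>(k, M). of_bool (k \<in> M) * sqn (T M F)) (k, M)) has_sum sqn (D_comp P \<mu> X k F)) Pfin"
      using sqn_multiplier[OF F multiplier_D_comp[OF F, of k]] by (simp add: sq)
  qed
qed


subsection \<open>The divergence and the Ornstein-Uhlenbeck generator\<close>

lemma L2_D:
  assumes F: "F \<in> H" and S: "(\<lambda>M. real (card M) * sqn (T M F)) summable_on Pfin"
  shows "D P \<mu> X F \<in> L2 (kappa_P P \<mu> X)"
proof (rule L2_kappa)
  show "(\<lambda>w. D P \<mu> X F (k, w)) \<in> H" for k
    using multiplier_H[OF multiplier_D_comp[OF F]] by (simp add: D_def)
  show "((\<lambda>k. sqn (\<lambda>w. D P \<mu> X F (k, w))) has_sum (\<Sum>\<^sub>\<infinity>M\<in>Pfin. real (card M) * sqn (T M F))) {1..}"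
    using has_sum_sqn_D_comp[OF F has_sum_infsum[OF S]] by (simp add: D_def)
qed

text \<open>The approximants \<open>CE {1..n} F\<close> lie in \<open>S_X\<close>. Their error
  consists of the components with \<open>M\<close> not contained in \<open>{1..n}\<close>, and the
  squared norm of its \<open>D\<close>-image weighs these by \<open>card M\<close>, so the given
  series is the majorant for convergence of the \<open>D\<close>-images.\<close>

lemma dom_D_I:
  assumes F: "F \<in> H" and S: "(\<lambda>M. real (card M) * sqn (T M F)) summable_on Pfin"
  shows "F \<in> dom_D P \<mu> X"
proof -
  let ?C = "\<lambda>n. CE {1..n} F"
  have sub: "{1..n} \<subseteq> {1..}" for n :: nat by auto
  have C: "multiplier (\<lambda>M. of_bool (M \<subseteq> {1..n})) F (?C n)" for n by (rule multiplier_CE[OF sub F])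
  note CH = multiplier_H[OF C]
  let ?e = "\<lambda>n w. ?C n w - F w"
  have e: "multiplier (\<lambda>M. of_bool (M \<subseteq> {1..n}) - 1) F (?e n)" for n
    by (rule multiplier_diff[OF C multiplier_refl[OF F]])
  note eH = multiplier_H[OF e]
  have sC: "sqn (T M (?C n)) = of_bool (M \<subseteq> {1..n}) * sqn (T M F)" if "M \<in> Pfin" for M n
    using sqn_T_multiplier[OF F C that, of n] by simp
  have se: "sqn (T M (?e n)) = of_bool (\<not> M \<subseteq> {1..n}) * sqn (T M F)" if "M \<in> Pfin" for M n
    using sqn_T_multiplier[OF F e that, of n] by (simp add: of_bool_def)
  have DC: "D P \<mu> X (?C n) \<in> L2 (kappa_P P \<mu> X)" for n
    by (rule L2_D[OF CH], rule summable_on_comparison_test[OF S]) (auto simp: sC simp del: One_nat_def)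
  have DF: "D P \<mu> X F \<in> L2 (kappa_P P \<mu> X)" by (rule L2_D[OF F S])
  have ce: "(\<lambda>M. real (card M) * sqn (T M (?e n))) summable_on Pfin" for n
    by (rule summable_on_comparison_test[OF S]) (auto simp: se simp del: One_nat_def)
  define s where "s n = (\<Sum>\<^sub>\<infinity>M\<in>Pfin. real (card M) * sqn (T M (?e n)))" for n
  have s: "((\<lambda>M. real (card M) * sqn (T M (?e n))) has_sum s n) Pfin" for n
    unfolding s_def by (rule has_sum_infsum[OF ce])
  have "s \<longlonglongrightarrow> 0"
  proof (rule tannery_has_sum[OF S])
    show "\<forall>\<^sub>F n in sequentially. ((\<lambda>M. real (card M) * sqn (T M (?e n))) has_sum s n) Pfin \<and>
        (\<forall>M\<in>Pfin. \<bar>real (card M) * sqn (T M (?e n))\<bar> \<le> real (card M) * sqn (T M F))"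
      by (intro always_eventually allI conjI s ballI) (simp add: se abs_mult del: One_nat_def)
    fix M assume M: "M \<in> Pfin"
    from eventually_subset_atLeastAtMost[OF M]
    show "(\<lambda>n. real (card M) * sqn (T M (?e n))) \<longlonglongrightarrow> 0"
      by (intro tendsto_eventually) (auto simp: se[OF M] simp del: One_nat_def elim!: eventually_mono)
  qed
  moreover have "(\<integral>z. (D P \<mu> X (?C n) z - D P \<mu> X F z)\<^sup>2 \<partial>kappa_P P \<mu> X) = s n" for n
  proof (rule L2_kappa(2))
    have DH: "D_comp P \<mu> X k G \<in> H" if "G \<in> H" for k G
      by (rule multiplier_H[OF multiplier_D_comp[OF that]])
    show "(\<lambda>w. D P \<mu> X (?C n) (k, w) - D P \<mu> X F (k, w)) \<in> H" for k
      using H_diff[OF DH[OF CH] DH[OF F]] by (simp add: D_def)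
    \<comment> \<open>\<open>D_comp\<close> is additive only almost everywhere; the two sides are
      matched by their coefficients relative to \<open>F\<close>.\<close>
    have "sqn (\<lambda>w. D_comp P \<mu> X k (?C n) w - D_comp P \<mu> X k F w) = sqn (D_comp P \<mu> X k (?e n))" for k
    proof (rule sqn_cong[OF _ H_diff[OF DH[OF CH] DH[OF F]] DH[OF eH]])
      have "multiplier (\<lambda>M. of_bool (k \<in> M) * of_bool (M \<subseteq> {1..n}) - of_bool (k \<in> M)) F
          (\<lambda>w. D_comp P \<mu> X k (?C n) w - D_comp P \<mu> X k F w)"
        by (intro multiplier_diff multiplier_trans[OF C] multiplier_D_comp CH F)
      moreover have "multiplier (\<lambda>M. of_bool (k \<in> M) * (of_bool (M \<subseteq> {1..n}) - 1)) F (D_comp P \<mu> X k (?e n))"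
        by (intro multiplier_trans[OF e] multiplier_D_comp eH)
      then have "multiplier (\<lambda>M. of_bool (k \<in> M) * of_bool (M \<subseteq> {1..n}) - of_bool (k \<in> M)) F (D_comp P \<mu> X k (?e n))"
        by (rule multiplier_cong) (simp add: right_diff_distrib)
      ultimately show "AE w in P. D_comp P \<mu> X k (?C n) w - D_comp P \<mu> X k F w = D_comp P \<mu> X k (?e n) w"
        by (rule multiplier_unique[OF F])
    qed
    then show "((\<lambda>k. sqn (\<lambda>w. D P \<mu> X (?C n) (k, w) - D P \<mu> X F (k, w))) has_sum s n) {1..}"
      using has_sum_sqn_D_comp[OF eH s] by (simp add: D_def)
  qed
  ultimately have "L2_converges (kappa_P P \<mu> X) (\<lambda>n. D P \<mu> X (?C n)) (D P \<mu> X F) sequentially"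
    using DC DF by (simp add: L2_converges_iff)
  moreover have "L2_converges Q ?C F sequentially"
    using CE_atLeastAtMost_tendsto[OF F] F by (simp only: converges_Q_iff[OF CH] power2_commute[of "F _"])
  moreover have "?C n \<in> S_X P \<mu> X" for n
    using CH by (auto simp: S_X_def intro!: exI[of _ n])
  ultimately have "(F, D P \<mu> X F) \<in> D_closure P \<mu> X"
    unfolding D_closure_def mem_Collect_eq prod.case by (intro exI[of _ ?C]) simp
  then show ?thesis unfolding dom_D_def by blast
qed

lemma dom_D_H: "F \<in> dom_D P \<mu> X \<Longrightarrow> F \<in> H"
  by (auto simp: dom_D_def D_closure_def L2_converges_def H_L2Q)

text \<open>Source of the test functions: with finitely many nonzero components, the weights
  \<open>card M\<close> cannot spoil summability.\<close>

lemma multiplier_finite_dom_D: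
  assumes F: "F \<in> H" and G: "multiplier c F G" and c: "\<And>M. M \<in> Pfin \<Longrightarrow> \<not> M \<subseteq> {1..n} \<Longrightarrow> c M = 0"
  shows "G \<in> dom_D P \<mu> X"
proof (rule dom_D_I[OF multiplier_H[OF G]], rule finite_nonzero_values_imp_summable_on)
  have "{M \<in> Pfin. real (card M) * sqn (T M G) \<noteq> 0} \<subseteq> Pow {1..n}"
    using c sqn_T_multiplier[OF F G] by fastforce
  then show "finite {M \<in> Pfin. real (card M) * sqn (T M G) \<noteq> 0}" by (rule finite_subset) simp
qed

text \<open>\<open>D_comp P \<mu> X k\<close> is the projection complementary to
  \<open>CE ({1..} - {k})\<close>, so replacing it by the identity on \<open>G\<close> only adds a
  term orthogonal to \<open>D_comp P \<mu> X k F\<close>.\<close>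

lemma integral_D_comp_mult_D_comp:
  assumes F: "F \<in> H" and G: "G \<in> H"
  shows "(\<integral>w. D_comp P \<mu> X k G w * D_comp P \<mu> X k F w \<partial>P) = (\<integral>w. G w * D_comp P \<mu> X k F w \<partial>P)"
proof -
  let ?N = "{1..} - {k}"
  have N: "?N \<subseteq> {1..}" by auto
  have C: "CE ?N G \<in> H" "CE ?N F \<in> H" using CE_H[OF N] F G by auto
  have DF: "D_comp P \<mu> X k F \<in> H" by (rule multiplier_H[OF multiplier_D_comp[OF F]])
  have "(\<integral>w. CE ?N G w * D_comp P \<mu> X k F w \<partial>P) =
      (\<integral>w. CE ?N G w * F w \<partial>P) - (\<integral>w. CE ?N G w * CE ?N F w \<partial>P)"
    using H_mult[OF C(1) F] H_mult[OF C] by (simp add: D_comp_def right_diff_distrib)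
  also have "\<dots> = 0" using CE_ip[OF N F C(1)] by simp
  finally have 0: "(\<integral>w. CE ?N G w * D_comp P \<mu> X k F w \<partial>P) = 0" .
  have "(\<integral>w. D_comp P \<mu> X k G w * D_comp P \<mu> X k F w \<partial>P) =
      (\<integral>w. G w * D_comp P \<mu> X k F w - CE ?N G w * D_comp P \<mu> X k F w \<partial>P)"
    by (simp add: D_comp_def[of P \<mu> X k G] left_diff_distrib)
  also have "\<dots> = (\<integral>w. G w * D_comp P \<mu> X k F w \<partial>P)"
    using H_mult[OF G DF] H_mult[OF C(1) DF] 0 by simp
  finally show ?thesis .
qed

lemma sum_integral_D_comp_mult:
  assumes F: "F \<in> H" and G: "G \<in> H"
  shows "(\<Sum>k<m. \<integral>w. D_comp P \<mu> X (Suc k) G w * D P \<mu> X F (Suc k, w) \<partial>P) =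
    (\<integral>w. G w * (\<Sum>k=1..m. D_comp P \<mu> X k F w) \<partial>P)"
proof -
  have "(\<Sum>k<m. \<integral>w. D_comp P \<mu> X (Suc k) G w * D P \<mu> X F (Suc k, w) \<partial>P) =
      (\<Sum>k<m. \<integral>w. G w * D_comp P \<mu> X (Suc k) F w \<partial>P)"
    using integral_D_comp_mult_D_comp[OF F G] by (simp add: D_def)
  also have "\<dots> = (\<Sum>k=1..m. \<integral>w. G w * D_comp P \<mu> X k F w \<partial>P)"
    by (rule sum.reindex_cong[symmetric, of Suc]) (auto simp: image_Suc_lessThan)
  also have "\<dots> = (\<integral>w. (\<Sum>k=1..m. G w * D_comp P \<mu> X k F w) \<partial>P)"
    by (rule Bochner_Integration.integral_sum[symmetric])
       (intro H_mult G multiplier_H[OF multiplier_D_comp[OF F]])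
  finally show ?thesis by (simp add: sum_distrib_left)
qed

abbreviation (input) partial_sum :: "('w \<Rightarrow> real) \<Rightarrow> nat \<Rightarrow> 'w \<Rightarrow> real" where
  "partial_sum F m w \<equiv> (\<Sum>k=1..m. D_comp P \<mu> X k F w)"

lemma tendsto_card_Int:
  assumes "M \<in> Pfin"
  shows "(\<lambda>m. real (card (M \<inter> {1..m}))) \<longlonglongrightarrow> real (card M)"
proof (rule tendsto_eventually)
  show "\<forall>\<^sub>F m in sequentially. real (card (M \<inter> {1..m})) = real (card M)"
    using eventually_subset_atLeastAtMost[OF assms]
    by eventually_elim (simp add: Int_absorb2 del: One_nat_def)
qed

text \<open>The counts \<open>card (M \<inter> {1..m})\<close> increase to \<open>card M\<close>, so
  their defects are dominated by \<open>card M\<close>. The factor \<open>r\<close> is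
  \<open>1\<close> for the sums themselves and \<open>-1\<close> for \<open>LF\<close>.\<close>

lemma multiplier_card_converges:
  assumes F: "F \<in> H" and V: "multiplier (\<lambda>M. r * real (card M)) F V"
  shows "L2_converges Q (\<lambda>m w. r * partial_sum F m w) V sequentially"
proof (rule multiplier_converges[OF F V])
  show "\<forall>\<^sub>F m in sequentially. multiplier (\<lambda>M. r * real (card (M \<inter> {1..m}))) F (\<lambda>w. r * partial_sum F m w) \<and>
      (\<forall>M\<in>Pfin. \<bar>r * real (card (M \<inter> {1..m})) - r * real (card M)\<bar> \<le> \<bar>r * real (card M)\<bar>)"
  proof (intro always_eventually allI conjI ballI)
    fix m M assume "M \<in> Pfin"
    then have "card (M \<inter> {1..m}) \<le> card M" by (intro card_mono Pfin_finite) auto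
    then have "\<bar>real (card (M \<inter> {1..m})) - real (card M)\<bar> \<le> \<bar>real (card M)\<bar>" by simp
    then show "\<bar>r * real (card (M \<inter> {1..m})) - r * real (card M)\<bar> \<le> \<bar>r * real (card M)\<bar>"
      by (simp only: right_diff_distrib[symmetric] abs_mult mult_left_mono abs_ge_zero)
  qed (intro multiplier_cmult multiplier_sum_D_comp F)
  fix M assume M: "M \<in> Pfin"
  show "(\<lambda>m. r * real (card (M \<inter> {1..m}))) \<longlonglongrightarrow> r * real (card M)"
    by (rule tendsto_mult_left[OF tendsto_card_Int[OF M]])
qed

text \<open>The partial sums of the pairing are integrals of \<open>G\<close> against
  \<open>partial_sum F m\<close>, which tends to \<open>V\<close> in norm. The functional that
  defines the divergence of \<open>DF\<close> is thus the inner product with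
  \<open>V\<close>.\<close>

lemma D_pairing_eq:
  assumes F: "F \<in> H" and V: "multiplier (\<lambda>M. real (card M)) F V" and G: "G \<in> H"
  shows "D_pairing P \<mu> X G (D P \<mu> X F) = (\<integral>w. G w * V w \<partial>P)"
proof -
  have VH: "V \<in> H" by (rule multiplier_H[OF V])
  have SH: "partial_sum F m \<in> H" for m by (rule multiplier_H[OF multiplier_sum_D_comp[OF F]])
  have "L2_converges Q (partial_sum F) V sequentially"
    using multiplier_card_converges[OF F, of 1 V] V by simp
  then have "(\<lambda>m. sqn (\<lambda>w. partial_sum F m w - V w)) \<longlonglongrightarrow> 0"
    using converges_Q_iff[of "partial_sum F" V sequentially, OF SH] by blast
  then have "(\<lambda>m. \<integral>w. G w * partial_sum F m w \<partial>P) \<longlonglongrightarrow> (\<integral>w. G w * V w \<partial>P)"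
    by (intro L2_tendsto_integral_mult H_L2 SH VH G)
  then have "(\<lambda>k. \<integral>w. D_comp P \<mu> X (Suc k) G w * D P \<mu> X F (Suc k, w) \<partial>P) sums (\<integral>w. G w * V w \<partial>P)"
    unfolding sums_def sum_integral_D_comp_mult[OF F G] .
  then show ?thesis unfolding D_pairing_def by (rule sums_unique[symmetric])
qed

abbreviation L_summable :: "('w \<Rightarrow> real) \<Rightarrow> bool" where
  "L_summable F \<equiv> (\<lambda>M. (real (card M))\<^sup>2 * sqn (T M F)) summable_on Pfin"

lemma L_summable_D: "L_summable F \<Longrightarrow> F \<in> H \<Longrightarrow> (\<lambda>M. real (card M) * sqn (T M F)) summable_on Pfin"
proof (erule summable_on_comparison_test)
  fix M show "real (card M) * sqn (T M F) \<le> (real (card M))\<^sup>2 * sqn (T M F)"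
    by (intro mult_right_mono) (auto simp: power2_eq_square simp flip: of_nat_mult)
qed auto

text \<open>By Cauchy-Schwarz the norm of \<open>V\<close> is a valid constant for the
  functional.\<close>

lemma dom_L_I:
  assumes F: "F \<in> H" and S: "L_summable F"
  shows "F \<in> dom_L P \<mu> X"
proof -
  obtain V where V: "multiplier (\<lambda>M. real (card M)) F V" using multiplier_exists[OF F S] by blast
  have "\<bar>D_pairing P \<mu> X G (D P \<mu> X F)\<bar> \<le> L2_norm P V * L2_norm P G" if "G \<in> dom_D P \<mu> X" for G
    using L2_Cauchy_Schwarz[OF H_L2[OF dom_D_H[OF that]] H_L2[OF multiplier_H[OF V]]]
    by (simp add: D_pairing_eq[OF F V dom_D_H[OF that]] mult.commute)
  then show ?thesis
    using dom_D_I[OF F L_summable_D[OF S F]] L2_D[OF F L_summable_D[OF S F]]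
    by (auto simp: dom_L_def dom_\<delta>_def)
qed

text \<open>Shared by condition (iii) and the bound on the functional. One \<open>{1..n}\<close>
  covers all members of a finite \<open>Y\<close>; there the coefficients already equal
  \<open>card M\<close>, so the finite sum is at most \<open>sqn (G n)\<close>.\<close>

lemma L_summable_of_bounded:
  assumes F: "F \<in> H" and G: "\<And>n. multiplier (c n) F (G n)"
    and c: "\<And>n M. M \<in> Pfin \<Longrightarrow> M \<subseteq> {1..n} \<Longrightarrow> c n M = real (card M)"
    and bound: "\<And>n::nat. n \<ge> 1 \<Longrightarrow> sqn (G n) \<le> C"
  shows "L_summable F"
proof (rule nonneg_bounded_partial_sums_imp_summable_on[where C=C])
  have "(\<Sum>M\<in>Y. (real (card M))\<^sup>2 * sqn (T M F)) \<le> C" if Y: "finite Y" "Y \<subseteq> Pfin" for Y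
  proof -
    have U: "\<Union>Y \<in> Pfin" using Y by (auto simp: Pfin_def)
    have "\<forall>\<^sub>F n in sequentially. \<Union>Y \<subseteq> {1..n} \<and> 1 \<le> n"
      using eventually_subset_atLeastAtMost[OF U] eventually_ge_at_top[of 1] by eventually_elim simp
    \<comment> \<open>The bound is given for positive \<open>n\<close> only, matching the range of
      the supremum in (iii).\<close>
    then obtain n where n: "\<Union>Y \<subseteq> {1..n}" "n \<ge> 1" by (auto simp: eventually_sequentially)
    have "(\<Sum>M\<in>Y. (real (card M))\<^sup>2 * sqn (T M F)) = (\<Sum>M\<in>Y. (c n M)\<^sup>2 * sqn (T M F))"
      by (rule sum.cong[OF refl], subst c) (use Y n in auto)
    also have "\<dots> \<le> sqn (G n)"
      by (rule finite_sum_le_has_sum[OF sqn_multiplier[OF F G] Y]) auto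
    also have "\<dots> \<le> C" by (rule bound[OF n(2)])
    finally show ?thesis .
  qed
  then show "\<forall>\<^sub>F Y in finite_subsets_at_top Pfin. (\<Sum>M\<in>Y. (real (card M))\<^sup>2 * sqn (T M F)) \<le> C"
    by (intro eventually_finite_subsets_at_top_weakI) auto
qed auto

text \<open>Testing the functional against a truncation \<open>G\<close> of the partial sum of \<open>D_comp P \<mu> X k F\<close>
  yields \<open>\<parallel>G\<parallel>\<^sup>2 \<le> C \<parallel>G\<parallel>\<close>.\<close>

lemma dom_L_D:
  assumes "F \<in> dom_L P \<mu> X"
  shows "L_summable F"
proof -
  obtain C where F: "F \<in> H"
    and C: "\<And>G. G \<in> dom_D P \<mu> X \<Longrightarrow> \<bar>D_pairing P \<mu> X G (D P \<mu> X F)\<bar> \<le> C * L2_norm P G"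
    using assms dom_D_H by (auto simp: dom_L_def dom_\<delta>_def)
  \<comment> \<open>The same \<open>n\<close> is used twice: \<open>D_comp P \<mu> X k (G n)\<close>
    vanishes almost everywhere for \<open>k > n\<close>, so the pairing with \<open>DF\<close> meets
    exactly the summands of \<open>partial_sum F n\<close>.\<close>
  define G where "G n = CE {1..n} (partial_sum F n)" for n
  have sub: "{1..n} \<subseteq> {1..}" for n :: nat by auto
  note S = multiplier_sum_D_comp[OF F]
  have G: "multiplier (\<lambda>M. of_bool (M \<subseteq> {1..n}) * real (card (M \<inter> {1..n}))) F (G n)" for n
    unfolding G_def by (rule multiplier_trans[OF S multiplier_CE[OF sub multiplier_H[OF S]]])
  have "sqn (G n) \<le> C\<^sup>2" for n
  proof -
    have GH: "G n \<in> H" by (rule multiplier_H[OF G])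
    have "G n \<in> dom_D P \<mu> X" by (rule multiplier_finite_dom_D[OF F G, of n]) simp
    then have "\<bar>D_pairing P \<mu> X (G n) (D P \<mu> X F)\<bar> \<le> C * L2_norm P (G n)" by (rule C)
    moreover have "D_pairing P \<mu> X (G n) (D P \<mu> X F) = sqn (G n)"
    proof -
      have "(\<integral>w. D_comp P \<mu> X (Suc k) (G n) w * D P \<mu> X F (Suc k, w) \<partial>P) = 0" if "k \<notin> {..<n}" for k
      proof (rule integral_eq_zero_AE)
        have "multiplier (\<lambda>M. of_bool (Suc k \<in> M) * (of_bool (M \<subseteq> {1..n}) * real (card (M \<inter> {1..n})))) F
            (D_comp P \<mu> X (Suc k) (G n))"
          by (rule multiplier_trans[OF G multiplier_D_comp[OF GH]])
        then have "multiplier (\<lambda>_. 0) F (D_comp P \<mu> X (Suc k) (G n))"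
          by (rule multiplier_cong) (use that in auto)
        from multiplier_unique[OF F this multiplier_zero[OF F]]
        show "AE w in P. D_comp P \<mu> X (Suc k) (G n) w * D P \<mu> X F (Suc k, w) = 0"
          by eventually_elim simp
      qed
      then have "D_pairing P \<mu> X (G n) (D P \<mu> X F) =
          (\<Sum>k<n. \<integral>w. D_comp P \<mu> X (Suc k) (G n) w * D P \<mu> X F (Suc k, w) \<partial>P)"
        unfolding D_pairing_def by (intro suminf_finite) auto
      also have "\<dots> = (\<integral>w. G n w * partial_sum F n w \<partial>P)"
        by (rule sum_integral_D_comp_mult[OF F GH])
      \<comment> \<open>\<open>G n\<close> is \<open>\<A> {1..n}\<close>-measurable, so
        \<open>partial_sum F n\<close> may be replaced by its conditional expectation, which is
        \<open>G n\<close> itself.\<close>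
      also have "\<dots> = (\<integral>w. G n w * G n w \<partial>P)"
        using GH unfolding G_def
        by (intro CE_ip[symmetric, OF sub multiplier_H[OF S]] borel_measurable_cond_exp)
      finally show ?thesis by (simp add: power2_eq_square)
    qed
    ultimately have *: "(L2_norm P (G n))\<^sup>2 \<le> C * L2_norm P (G n)"
      by (simp add: L2_norm_power2)
    have "(L2_norm P (G n))\<^sup>2 \<le> C\<^sup>2"
    \<comment> \<open>The constant \<open>C\<close> comes without a sign, and the norm can be
      cancelled only where it is positive.\<close>
    proof (cases "L2_norm P (G n) = 0")
      case False
      then have "L2_norm P (G n) > 0" using L2_norm_nonneg[of P "G n"] by simp
      then have "L2_norm P (G n) \<le> C" using * by (simp add: power2_eq_square)
      then show ?thesis by (intro power_mono L2_norm_nonneg)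
    qed simp
    then show ?thesis by (simp add: L2_norm_power2)
  qed
  then show ?thesis by (intro L_summable_of_bounded[OF F G, where C="C\<^sup>2"]) (auto simp: Int_absorb2)
qed

lemma dom_L_iff: "F \<in> H \<Longrightarrow> F \<in> dom_L P \<mu> X \<longleftrightarrow> L_summable F"
  using dom_L_I dom_L_D by blast

text \<open>\<open>V\<close> shows that the choice in \<open>\<delta>_def\<close> can be met. Two
  functions meeting it differ by some \<open>K\<close> orthogonal to \<open>dom D\<close>. As
  \<open>CE {1..n} K\<close> lies in \<open>dom D\<close>, it is orthogonal to \<open>K\<close> and
  hence has norm zero, yet it tends to \<open>K\<close>.\<close>

lemma multiplier_L:
  assumes F: "F \<in> dom_L P \<mu> X"
  shows "multiplier (\<lambda>M. - real (card M)) F (L P \<mu> X F)"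
proof -
  have FH: "F \<in> H" using F dom_D_H by (auto simp: dom_L_def)
  obtain V where V: "multiplier (\<lambda>M. real (card M)) F V"
    using multiplier_exists[OF FH dom_L_D[OF F]] by blast
  let ?R = "\<lambda>V. V \<in> H \<and> (\<forall>G \<in> dom_D P \<mu> X. (\<integral>w. G w * V w \<partial>P) = D_pairing P \<mu> X G (D P \<mu> X F))"
  define V' where "V' = \<delta> P \<mu> X (D P \<mu> X F)"
  have RV: "?R V" using multiplier_H[OF V] D_pairing_eq[OF FH V] dom_D_H by auto
  then have RV': "?R V'" unfolding V'_def \<delta>_def by (rule someI[where P="?R"])
  let ?K = "\<lambda>w. V w - V' w"
  have K: "?K \<in> H" using RV RV' by (intro H_diff) auto
  have sub: "{1..n} \<subseteq> {1..}" for n :: nat by auto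
  have "sqn (\<lambda>w. ?K w - CE {1..n} ?K w) = sqn ?K" for n
  proof -
    let ?G = "CE {1..n} ?K"
    have G: "multiplier (\<lambda>M. of_bool (M \<subseteq> {1..n})) ?K ?G" by (rule multiplier_CE[OF sub K])
    have Gd: "?G \<in> dom_D P \<mu> X" by (rule multiplier_finite_dom_D[OF K G, of n]) simp
    have "sqn ?G = (\<integral>w. ?G w * ?K w \<partial>P)"
      using CE_ip[OF sub K multiplier_H[OF G] borel_measurable_cond_exp] by (simp add: power2_eq_square)
    also have "\<dots> = (\<integral>w. ?G w * V w \<partial>P) - (\<integral>w. ?G w * V' w \<partial>P)"
      using H_mult[OF multiplier_H[OF G]] RV RV' by (simp add: right_diff_distrib)
    also have "\<dots> = 0" using RV RV' Gd by simp
    finally show ?thesis using sqn_diff_CE[OF sub K, of n] by simp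
  qed
  then have "sqn ?K = 0" using CE_atLeastAtMost_tendsto[OF K] by (simp add: LIMSEQ_const_iff)
  from sqn_eq_0[OF K this] have "AE w in P. V w = V' w" by eventually_elim simp
  with V have "multiplier (\<lambda>M. real (card M)) F V'" using RV' by (intro multiplier_AE_cong[OF V]) auto
  from multiplier_cmult[OF this, of "-1"] show ?thesis by (simp add: L_def V'_def)
qed

section \<open>The equivalent conditions and the series for \<open>LF\<close>\<close>

lemma nn_integral_sq_H: "F \<in> H \<Longrightarrow> (\<integral>\<^sup>+w. ennreal ((F w)\<^sup>2) \<partial>P) = ennreal (sqn F)"
  by (rule nn_integral_eq_integral) (auto intro: H_sq)

text \<open>Two orders of one double sum over \<open>p\<close> and \<open>M\<close> with the
  indicator of \<open>card M = p\<close>: summing over \<open>M\<close> first gives the norm of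
  \<open>J\<close> by Parseval, summing over \<open>p\<close> first leaves the term
  \<open>p = card M\<close>.\<close>

lemma infsum_J_eq:
  assumes F: "F \<in> H"
  shows "(\<Sum>\<^sub>\<infinity>p\<in>{1..}. ennreal ((real p)\<^sup>2) * (\<integral>\<^sup>+w. ennreal ((J P \<mu> X p F w)\<^sup>2) \<partial>P)) =
    (\<Sum>\<^sub>\<infinity>M\<in>Pfin. ennreal ((real (card M))\<^sup>2 * sqn (T M F)))"
proof -
  let ?f = "\<lambda>p M. (real p)\<^sup>2 * (of_bool (card M = p) * sqn (T M F))"
  have "(\<Sum>\<^sub>\<infinity>p\<in>{1..}. ennreal ((real p)\<^sup>2 * sqn (J P \<mu> X p F))) =
      (\<Sum>\<^sub>\<infinity>M\<in>Pfin. ennreal ((real (card M))\<^sup>2 * sqn (T M F)))"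
  proof (rule infsum_ennreal_swap)
    fix p :: nat
    have sq: "(of_bool b :: real)\<^sup>2 = of_bool b" for b by simp
    have "((\<lambda>M. of_bool (card M = p) * sqn (T M F)) has_sum sqn (J P \<mu> X p F)) Pfin"
      using sqn_multiplier[OF F multiplier_J[OF F, of p]] by (simp only: sq)
    then show "(?f p has_sum (real p)\<^sup>2 * sqn (J P \<mu> X p F)) Pfin"
      by (rule has_sum_cmult_right)
  next
    fix M :: "nat set"
    \<comment> \<open>For \<open>card M = 0\<close> this index set is empty, in agreement with the
      weight \<open>0\<close>.\<close>
    have "((\<lambda>p. ?f p M) has_sum (\<Sum>p\<in>{card M} \<inter> {1..}. ?f p M)) ({card M} \<inter> {1..})"
      by (rule has_sum_finite) simp
    then have "((\<lambda>p. ?f p M) has_sum (\<Sum>p\<in>{card M} \<inter> {1..}. ?f p M)) {1..}"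
      by (rule has_sum_cong_neutral[THEN iffD1, rotated -1]) auto
    also have "(\<Sum>p\<in>{card M} \<inter> {1..}. ?f p M) = (real (card M))\<^sup>2 * sqn (T M F)"
      by (cases "card M = 0") auto
    finally show "((\<lambda>p. ?f p M) has_sum (real (card M))\<^sup>2 * sqn (T M F)) {1..}" .
  qed simp
  then show ?thesis
    using multiplier_H[OF multiplier_J[OF F]] by (simp add: nn_integral_sq_H ennreal_mult)
qed

lemma infsum_T_eq:
  assumes F: "F \<in> H"
  shows "(\<Sum>\<^sub>\<infinity>M\<in>Pfin. ennreal ((real (card M))\<^sup>2) * (\<integral>\<^sup>+w. ennreal ((T M F w)\<^sup>2) \<partial>P)) =
    (\<Sum>\<^sub>\<infinity>M\<in>Pfin. ennreal ((real (card M))\<^sup>2 * sqn (T M F)))"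
  by (rule infsum_cong) (simp add: nn_integral_sq_H T_H[OF _ F] ennreal_mult)

text \<open>Any limit of the partial sums carries the coefficients \<open>card M\<close>, because
  the multiplier relation is closed, and Parseval for that limit is the required
  summability.\<close>

lemma dom_L_iff_converges:
  assumes F: "F \<in> H"
  shows "F \<in> dom_L P \<mu> X \<longleftrightarrow> (\<exists>G. L2_converges Q (partial_sum F) G sequentially)"
proof
  assume "F \<in> dom_L P \<mu> X"
  then obtain V where V: "multiplier (\<lambda>M. real (card M)) F V"
    using multiplier_exists[OF F dom_L_D] by blast
  then show "\<exists>G. L2_converges Q (partial_sum F) G sequentially"
    using multiplier_card_converges[OF F, of 1 V] by auto
next
  assume "\<exists>G. L2_converges Q (partial_sum F) G sequentially"
  then obtain G where G: "L2_converges Q (partial_sum F) G sequentially" ..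
  have "multiplier (\<lambda>M. real (card M)) F G"
  proof (rule multiplier_closed[OF F _ _ G])
    fix M assume M: "M \<in> Pfin"
    show "(\<lambda>m. real (card (M \<inter> {1..m}))) \<longlonglongrightarrow> real (card M)"
      by (rule tendsto_card_Int[OF M])
  qed (use multiplier_sum_D_comp[OF F] in auto)
  then have "L_summable F" using sqn_multiplier[OF F] by (auto simp: summable_on_def)
  then show "F \<in> dom_L P \<mu> X" by (rule dom_L_I[OF F])
qed

text \<open>The counts \<open>card (M \<inter> {1..m})\<close> stay below \<open>card M\<close>, so
  \<open>sqn V\<close> bounds all partial sums; conversely they equal \<open>card M\<close> as soon
  as \<open>M \<subseteq> {1..m}\<close>.\<close>

lemma dom_L_iff_bounded:
  assumes F: "F \<in> H"
  shows "F \<in> dom_L P \<mu> X \<longleftrightarrow>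
    (SUP m\<in>{1::nat..}. \<integral>\<^sup>+w. ennreal ((partial_sum F m w)\<^sup>2) \<partial>P) < \<infinity>"
proof -
  note S = multiplier_sum_D_comp[OF F]
  have nn: "(\<integral>\<^sup>+w. ennreal ((partial_sum F m w)\<^sup>2) \<partial>P) = ennreal (sqn (partial_sum F m))" for m
    by (rule nn_integral_sq_H[OF multiplier_H[OF S]])
  show ?thesis
    unfolding nn
  proof
    assume "F \<in> dom_L P \<mu> X"
    then obtain V where V: "multiplier (\<lambda>M. real (card M)) F V"
      using multiplier_exists[OF F dom_L_D] by blast
    have "sqn (partial_sum F m) \<le> sqn V" for m
    proof (rule has_sum_mono[OF sqn_multiplier[OF F S] sqn_multiplier[OF F V]])
      fix M assume "M \<in> Pfin"
      then have "card (M \<inter> {1..m}) \<le> card M" by (intro card_mono Pfin_finite) auto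
      then show "(real (card (M \<inter> {1..m})))\<^sup>2 * sqn (T M F) \<le> (real (card M))\<^sup>2 * sqn (T M F)"
        by (intro mult_right_mono power_mono) auto
    qed
    then have "(SUP m\<in>{1::nat..}. ennreal (sqn (partial_sum F m))) \<le> ennreal (sqn V)"
      by (intro SUP_least ennreal_leI)
    then show "(SUP m\<in>{1::nat..}. ennreal (sqn (partial_sum F m))) < \<infinity>"
      by (rule order_le_less_trans) simp
  next
    let ?s = "SUP m\<in>{1::nat..}. ennreal (sqn (partial_sum F m))"
    assume fin: "?s < \<infinity>"
    have "sqn (partial_sum F m) \<le> enn2real ?s" if "m \<ge> 1" for m
    proof -
      have "ennreal (sqn (partial_sum F m)) \<le> ?s" using that by (intro SUP_upper) auto
      then have "enn2real (ennreal (sqn (partial_sum F m))) \<le> enn2real ?s"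
        using fin by (intro enn2real_mono) auto
      then show ?thesis by simp
    qed
    then have "L_summable F"
      by (intro L_summable_of_bounded[where G="partial_sum F", OF F S])
         (simp_all only: Int_absorb2)
    then show "F \<in> dom_L P \<mu> X" by (rule dom_L_I[OF F])
  qed
qed

lemma L2_has_sum_L_J:
  assumes F: "F \<in> dom_L P \<mu> X"
  shows "L2_has_sum Q (\<lambda>p w. - real p * J P \<mu> X p F w) {1..} (L P \<mu> X F)"
  unfolding L2_has_sum_def
proof -
  have FH: "F \<in> H" using F dom_D_H by (auto simp: dom_L_def)
  show "L2_converges Q (\<lambda>A w. \<Sum>p\<in>A. - real p * J P \<mu> X p F w) (L P \<mu> X F) (finite_subsets_at_top {1..})"
  proof (rule multiplier_converges[OF FH multiplier_L[OF F]])
    let ?c = "\<lambda>A M. - real (card M) * of_bool (card M \<in> A)"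
    show "\<forall>\<^sub>F A in finite_subsets_at_top {1..}.
        multiplier (?c A) F (\<lambda>w. \<Sum>p\<in>A. - real p * J P \<mu> X p F w) \<and>
        (\<forall>M\<in>Pfin. \<bar>?c A M - - real (card M)\<bar> \<le> \<bar>- real (card M)\<bar>)"
      using eventually_finite_subsets_finite_subset
    proof eventually_elim
      case (elim A)
      then have A: "finite A" by simp
      have "multiplier (\<lambda>M. \<Sum>p\<in>A. - real p * of_bool (card M = p)) F (\<lambda>w. \<Sum>p\<in>A. - real p * J P \<mu> X p F w)"
        by (intro multiplier_sum[OF FH A] multiplier_cmult multiplier_J[OF FH])
      moreover have "(\<Sum>p\<in>A. - real p * of_bool (card M = p)) = ?c A M" for M :: "nat set"
      proof -
        have "(\<Sum>p\<in>A. - real p * of_bool (card M = p)) = (\<Sum>p\<in>A. if card M = p then - real (card M) else 0)"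
          by (intro sum.cong) auto
        then show ?thesis using A by simp
      qed
      ultimately show ?case by (auto simp: of_bool_def)
    qed
    fix M :: "nat set" assume "M \<in> Pfin"
    show "((\<lambda>A. ?c A M) \<longlongrightarrow> - real (card M)) (finite_subsets_at_top {1..})"
    \<comment> \<open>No \<open>A \<subseteq> {1..}\<close> ever contains the cardinality of the
      empty set, but its limiting coefficient is \<open>0\<close> as well.\<close>
    proof (cases "card M = 0")
      case False
      then have "card M \<in> {1..}" by simp
      from tendsto_mult_left[OF tendsto_of_bool_finite_subsets[OF this], of "- real (card M)"]
      show ?thesis by simp
    qed simp
  qed
qed

end


theorem proposition2p8:
  fixes P :: "'w measure" and \<mu> :: "nat \<Rightarrow> 'e measure" and X :: "nat \<Rightarrow> 'w \<Rightarrow> 'e"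
    and F :: "'w \<Rightarrow> real"
  assumes "prob_space P"
    and "\<And>n. n \<ge> 1 \<Longrightarrow> prob_space (\<mu> n)"
    and "\<And>n. n \<ge> 1 \<Longrightarrow> X n \<in> measurable P (\<mu> n)"
    and "\<And>n. n \<ge> 1 \<Longrightarrow> distr P (\<mu> n) (X n) = \<mu> n"
    and "prob_space.indep_vars P \<mu> X {1..}"
    and "F \<in> L2X P \<mu> X"
  shows
    "\<comment> \<open>(i) iff (ii)\<close>
     (F \<in> dom_L P \<mu> X \<longleftrightarrow>
        (\<exists>G. L2_converges (P_F P \<mu> X) (\<lambda>m w. \<Sum>k=1..m. D_comp P \<mu> X k F w) G sequentially)) \<and>
     \<comment> \<open>(i) iff (iii)\<close>
     (F \<in> dom_L P \<mu> X \<longleftrightarrow>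
        (SUP m\<in>{1::nat..}. \<integral>\<^sup>+w. ennreal ((\<Sum>k=1..m. D_comp P \<mu> X k F w)\<^sup>2) \<partial>P) < \<infinity>) \<and>
     \<comment> \<open>(i) iff (iv), where the two series in (iv) always agree in the extended reals\<close>
     (\<Sum>\<^sub>\<infinity>p\<in>{1..}. ennreal ((real p)\<^sup>2) * (\<integral>\<^sup>+w. ennreal ((J P \<mu> X p F w)\<^sup>2) \<partial>P)) =
       (\<Sum>\<^sub>\<infinity>M\<in>Pfin. ennreal ((real (card M))\<^sup>2) * (\<integral>\<^sup>+w. ennreal ((hoeffding P \<mu> X F M w)\<^sup>2) \<partial>P)) \<and>
     (F \<in> dom_L P \<mu> X \<longleftrightarrow>
        (\<Sum>\<^sub>\<infinity>p\<in>{1..}. ennreal ((real p)\<^sup>2) * (\<integral>\<^sup>+w. ennreal ((J P \<mu> X p F w)\<^sup>2) \<partial>P)) < \<infinity>) \<and>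
     \<comment> \<open>the formulas for \<open>LF\<close>\<close>
     (F \<in> dom_L P \<mu> X \<longrightarrow>
        L2_converges (P_F P \<mu> X) (\<lambda>m w. - (\<Sum>k=1..m. D_comp P \<mu> X k F w)) (L P \<mu> X F) sequentially \<and>
        L2_has_sum (P_F P \<mu> X) (\<lambda>M w. - real (card M) * hoeffding P \<mu> X F M w) Pfin (L P \<mu> X F) \<and>
        L2_has_sum (P_F P \<mu> X) (\<lambda>p w. - real p * J P \<mu> X p F w) {1..} (L P \<mu> X F) \<and>
        (\<forall>M\<in>Pfin. AE w in P.
           hoeffding P \<mu> X (L P \<mu> X F) M w = - real (card M) * hoeffding P \<mu> X F M w) \<and>
        (\<forall>p. AE w in P. J P \<mu> X p (L P \<mu> X F) w = - real p * J P \<mu> X p F w))"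
proof -
  interpret prob_space P by fact
  interpret independent_sequence P \<mu> X
    by unfold_locales (use assms in auto)
  note F = assms(6)
  have LF: "L2_converges Q (\<lambda>m w. - (\<Sum>k=1..m. D_comp P \<mu> X k F w)) (L P \<mu> X F) sequentially"
    "L2_has_sum Q (\<lambda>M w. - real (card M) * T M F w) Pfin (L P \<mu> X F)"
    "AE w in P. J P \<mu> X p (L P \<mu> X F) w = - real p * J P \<mu> X p F w"
    if dom: "F \<in> dom_L P \<mu> X" for p
  proof -
    note LF = multiplier_L[OF dom]
    show "L2_converges Q (\<lambda>m w. - (\<Sum>k=1..m. D_comp P \<mu> X k F w)) (L P \<mu> X F) sequentially"
      using multiplier_card_converges[OF F, of "-1"] LF by simp
    show "L2_has_sum Q (\<lambda>M w. - real (card M) * T M F w) Pfin (L P \<mu> X F)"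
      by (rule multiplier_L2_has_sum[OF F order_refl], rule multiplier_cong[OF LF]) simp
    have "multiplier (\<lambda>M. of_bool (card M = p) * - real (card M)) F (J P \<mu> X p (L P \<mu> X F))"
      by (rule multiplier_trans[OF LF multiplier_J[OF multiplier_H[OF LF]]])
    \<comment> \<open>Where the indicator is nonzero, \<open>card M\<close> equals \<open>p\<close>,
      so the constant \<open>- real p\<close> acts as \<open>- real (card M)\<close>.\<close>
    moreover have "multiplier (\<lambda>M. of_bool (card M = p) * - real (card M)) F (\<lambda>w. - real p * J P \<mu> X p F w)"
      by (rule multiplier_cong[OF multiplier_cmult[OF multiplier_J[OF F]]]) simp
    ultimately show "AE w in P. J P \<mu> X p (L P \<mu> X F) w = - real p * J P \<mu> X p F w"
      by (rule multiplier_unique[OF F])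
  qed
  show ?thesis
    using dom_L_iff_converges[OF F] dom_L_iff_bounded[OF F] dom_L_iff[OF F] infsum_J_eq[OF F] infsum_T_eq[OF F]
      summable_on_iff_infsum_ennreal[of Pfin "\<lambda>M. (real (card M))\<^sup>2 * sqn (T M F)"]
      LF L2_has_sum_L_J multiplier_AE[OF multiplier_L]
    by auto
qed

end
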